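(* Let $k$ be an algebraically closed field of characteristic zero and let $G$ be a finite Abelian group with the sequence of invariant factors $m_1,\ldots,m_r$. If a (faithful) rational action $\varrho$ of $G$ on an $n$-dimensional irreducible variety, $n\ge 1$, has a fixed point, then $n\ge r$ and $\varrho$ is obtained by a nontrivial base change from a linear action $\lambda\colon G\hookrightarrow\mathrm{GL}_n(k)$ on $\mathbf A^n$ such that $\lambda(G)=T_n(m_1,\ldots,m_r)$.
   Context: The sequence of invariant factors $m_1,\ldots,m_r$ of a finite Abelian group $G$ is the unique sequence such that $G\cong\bigoplus_{i=1}^r\mathbf Z/m_i\mathbf Z$, $m_i$ divides $m_{i+1}$ for $i<r$, and $m_1>1$ if $|G|>1$. For $n\ge r$, $$T_n(m_1,\ldots,m_r):=\{(t_1x_1,\ldots,t_rx_r,x_{r+1},\ldots,x_n)\mid t_i\in k,\ t_i^{m_i}=1,\ 1\le i\le r\}\subset\mathrm{GL}_n(k)$$ is the corresponding group of diagonal transformations of $\mathbf A^n$. Varieties are algebraic varieties over $k$. A (faithful) rational action of $G$ on an irreducible variety $X$ is an injective homomorphism $\varrho\colon G\hookrightarrow\mathrm{Bir}(X)$. A regularization of $\varrho$ is a regular action of $G$ on an irreducible smooth complete variety $Y$ such that there is a $G$-equivariant birational isomorphism $X\dashrightarrow Y$; $\varrho$ has a fixed point if there is a regularization with $Y^G\ne\varnothing$. A rational action $\varrho_1\colon G\hookrightarrow\mathrm{Bir}(X_1)$ is obtained by a nontrivial base change from a rational action $\varrho_2\colon G\hookrightarrow\mathrm{Bir}(X_2)$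 if there is a $G$-equivariant dominant rational map $X_1\dashrightarrow X_2$ which is not a birational isomorphism. *)

theory Defs
  imports
    "HOL-Algebra.Group_Action"
    "HOL-Algebra.Product_Groups"
    "HOL-Analysis.Function_Topology"
    "HOL-Library.Function_Algebras"
    "HOL-Library.Extended_Nat"
    "HOL-Computational_Algebra.Polynomial"
    "Jordan_Normal_Form.Matrix"
begin

text \<open>
  The ground field is a type \<open>'k\<close>, in the end of sort \<open>{alg_closed_field, field_char_0}\<close>.
  Varieties are treated classically: a variety is its set of (closed) points together with the
  Zariski topology and the sheaf of regular \<open>'k\<close>-valued functions. Affine \<open>n\<close>-space has
  \<open>carrier_vec n\<close> as its set of points.
\<close>

section \<open>Spaces with functions\<close>

text \<open>
  \<open>regf X U\<close> is meaningful for open \<open>U\<close> only. A function on \<open>U\<close> is represented by any total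
  function extending it, so values outside \<open>U\<close> are irrelevant (last clause of
  \<open>space_with_functions\<close>).
\<close>

record ('p, 'k) fspace =
  zar :: "'p topology"
  regf :: "'p set \<Rightarrow> ('p \<Rightarrow> 'k) set"

abbreviation points :: "('p, 'k) fspace \<Rightarrow> 'p set" where
  "points X \<equiv> topspace (zar X)"

definition space_with_functions :: "('p, 'k::field) fspace \<Rightarrow> bool" where
  "space_with_functions X \<longleftrightarrow>
     (\<forall>U. openin (zar X) U \<longrightarrow>
        (\<forall>c. (\<lambda>_. c) \<in> regf X U) \<and>
        (\<forall>f\<in>regf X U. \<forall>g\<in>regf X U. (\<lambda>x. f x + g x) \<in> regf X U \<and> (\<lambda>x. f x * g x) \<in> regf X U)) \<and>
     (\<forall>U V f. openin (zar X) U \<and> openin (zar X) V \<and> V \<subseteq> U \<and> f \<in> regf X U \<longrightarrow> f \<in> regf X V) \<and>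
     (\<forall>\<U> f. (\<forall>U\<in>\<U>. openin (zar X) U \<and> f \<in> regf X U) \<longrightarrow> f \<in> regf X (\<Union>\<U>)) \<and>
     (\<forall>U f g. openin (zar X) U \<and> f \<in> regf X U \<and> (\<forall>x\<in>U. f x = g x) \<longrightarrow> g \<in> regf X U)"

definition open_subspace :: "('p, 'k) fspace \<Rightarrow> 'p set \<Rightarrow> ('p, 'k) fspace" where
  "open_subspace X U = \<lparr>zar = subtopology (zar X) U, regf = regf X\<rparr>"

definition morphism :: "('p, 'k) fspace \<Rightarrow> ('q, 'k) fspace \<Rightarrow> ('p \<Rightarrow> 'q) \<Rightarrow> bool" where
  "morphism X Y f \<longleftrightarrow> continuous_map (zar X) (zar Y) f \<and>
     (\<forall>V h. openin (zar Y) V \<and> h \<in> regf Y V \<longrightarrow> h \<circ> f \<in> regf X {x \<in> points X. f x \<in> V})"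

definition isomorphic :: "('p, 'k) fspace \<Rightarrow> ('q, 'k) fspace \<Rightarrow> bool" where
  "isomorphic X Y \<longleftrightarrow> (\<exists>f g. morphism X Y f \<and> morphism Y X g \<and>
     (\<forall>x\<in>points X. g (f x) = x) \<and> (\<forall>y\<in>points Y. f (g y) = y))"


section \<open>Affine varieties\<close>

inductive_set polyfun :: "nat \<Rightarrow> ('k::field vec \<Rightarrow> 'k) set" for n :: nat where
  const: "(\<lambda>_. c) \<in> polyfun n"
| coord: "i < n \<Longrightarrow> (\<lambda>v. v $ i) \<in> polyfun n"
| add: "P \<in> polyfun n \<Longrightarrow> Q \<in> polyfun n \<Longrightarrow> (\<lambda>v. P v + Q v) \<in> polyfun n"
| mult: "P \<in> polyfun n \<Longrightarrow> Q \<in> polyfun n \<Longrightarrow> (\<lambda>v. P v * Q v) \<in> polyfun n"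

definition zariski_topology :: "nat \<Rightarrow> 'k::field vec topology" where
  "zariski_topology n =
     topology (\<lambda>U. \<exists>F\<subseteq>polyfun n. U = {v \<in> carrier_vec n. \<exists>P\<in>F. P v \<noteq> 0})"

lemma openin_zariski:
  "openin (zariski_topology n) U \<longleftrightarrow>
     (\<exists>F\<subseteq>polyfun n. U = {v \<in> carrier_vec n. \<exists>P\<in>F. P v \<noteq> 0})"
proof -
  let ?D = "\<lambda>F. {v :: 'a vec \<in> carrier_vec n. \<exists>P\<in>F. P v \<noteq> 0}"
  let ?op = "\<lambda>U. \<exists>F\<subseteq>polyfun n. U = ?D F"
  have 1: "?op (S \<inter> T)" if S: "?op S" and T: "?op T" for S T
  proof -
    from S obtain F where F: "F \<subseteq> polyfun n" "S = ?D F" by blast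
    from T obtain H where H: "H \<subseteq> polyfun n" "T = ?D H" by blast
    let ?FH = "(\<lambda>(P, Q) v. P v * Q v) ` (F \<times> H)"
    have "?FH \<subseteq> polyfun n"
      using F(1) H(1) by (auto intro!: polyfun.mult)
    moreover have "S \<inter> T = ?D ?FH"
      unfolding F(2) H(2) by auto
    ultimately show ?thesis by blast
  qed
  have 2: "?op (\<Union>K)" if K: "\<forall>S\<in>K. ?op S" for K
  proof -
    from bchoice[OF K] obtain F where F: "\<forall>S\<in>K. F S \<subseteq> polyfun n \<and> S = ?D (F S)" by blast
    have "(\<Union>S\<in>K. F S) \<subseteq> polyfun n"
      using F by blast
    moreover have "\<Union>K = (\<Union>S\<in>K. ?D (F S))"
      using F by auto
    then have "\<Union>K = ?D (\<Union>S\<in>K. F S)"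
      by auto
    ultimately show ?thesis by blast
  qed
  have "istopology ?op"
    unfolding istopology_def using 1 2 by presburger
  then show ?thesis
    by (simp add: zariski_topology_def topology_inverse')
qed

lemma topspace_zariski: "topspace (zariski_topology n) = carrier_vec n"
proof
  have "openin (zariski_topology n) (carrier_vec n :: 'a vec set)"
    unfolding openin_zariski by (rule exI[of _ "{\<lambda>_. 1}"]) (auto intro: polyfun.const)
  then show "carrier_vec n \<subseteq> topspace (zariski_topology n :: 'a vec topology)"
    by (rule openin_subset)
  show "topspace (zariski_topology n) \<subseteq> (carrier_vec n :: 'a vec set)"
    unfolding topspace_def openin_zariski by blast
qed

lemma closedin_zariski:
  "closedin (zariski_topology n) S \<longleftrightarrow>
     (\<exists>F\<subseteq>polyfun n. S = {v \<in> carrier_vec n. \<forall>P\<in>F. P v = 0})"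
proof -
  have *: "S \<subseteq> carrier_vec n \<and> carrier_vec n - S = {v \<in> carrier_vec n. \<exists>P\<in>F. P v \<noteq> 0}
      \<longleftrightarrow> S = {v \<in> carrier_vec n. \<forall>P\<in>F. P v = 0}" for F :: "('a vec \<Rightarrow> 'a) set"
    by blast
  show ?thesis
    unfolding closedin_def topspace_zariski openin_zariski *[symmetric] by blast
qed

text \<open>A locally closed subset of affine space with its induced structure.\<close>

definition embedded_space :: "nat \<Rightarrow> 'k::field vec set \<Rightarrow> ('k vec, 'k) fspace" where
  "embedded_space n S =
     \<lparr>zar = subtopology (zariski_topology n) S,
      regf = (\<lambda>U. {f. \<forall>x\<in>U. \<exists>V. openin (subtopology (zariski_topology n) S) V \<and> x \<in> V \<and> V \<subseteq> U \<and>
        (\<exists>P\<in>polyfun n. \<exists>Q\<in>polyfun n. \<forall>y\<in>V. Q y \<noteq> 0 \<and> f y = P y / Q y)})\<rparr>"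

definition affine_space :: "nat \<Rightarrow> ('k::field vec, 'k) fspace" where
  "affine_space n = embedded_space n (carrier_vec n)"

definition affine_variety :: "('p, 'k::field) fspace \<Rightarrow> bool" where
  "affine_variety X \<longleftrightarrow>
     (\<exists>n S. closedin (zariski_topology n) S \<and> isomorphic X (embedded_space n S))"


section \<open>Varieties\<close>

definition prevariety :: "('p, 'k::field) fspace \<Rightarrow> bool" where
  "prevariety X \<longleftrightarrow> space_with_functions X \<and>
     (\<exists>\<U>. finite \<U> \<and> \<Union>\<U> = points X \<and>
        (\<forall>U\<in>\<U>. openin (zar X) U \<and> affine_variety (open_subspace X U)))"

text \<open>
  The Zariski topology of the product variety: a basis is given by the nonvanishing loci
  of functions \<open>(x, y) \<mapsto> \<Sum>i<m. f i x * g i y\<close> on open rectangles \<open>U \<times> V\<close> with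
  \<open>f i\<close> regular on \<open>U\<close> and \<open>g i\<close> regular on \<open>V\<close>. (This is not \<open>prod_topology\<close>.)
\<close>

definition prod_zariski ::
    "('p, 'k::field) fspace \<Rightarrow> ('q, 'k) fspace \<Rightarrow> ('p \<times> 'q) topology" where
  "prod_zariski X Y = topology_generated_by
     {{(x, y). x \<in> U \<and> y \<in> V \<and> (\<Sum>i<m. f i x * g i y) \<noteq> 0} | U V (m::nat) f g.
        openin (zar X) U \<and> openin (zar Y) V \<and>
        (\<forall>i<m. f i \<in> regf X U) \<and> (\<forall>i<m. g i \<in> regf Y V)}"

definition variety :: "('p, 'k::field) fspace \<Rightarrow> bool" where
  "variety X \<longleftrightarrow> prevariety X \<and> closedin (prod_zariski X X) {(x, x) | x. x \<in> points X}"

definition irreducible_variety :: "('p, 'k::field) fspace \<Rightarrow> bool" where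
  "irreducible_variety X \<longleftrightarrow> variety X \<and> points X \<noteq> {} \<and>
     (\<forall>A B. closedin (zar X) A \<and> closedin (zar X) B \<and> A \<union> B = points X \<longrightarrow>
        A = points X \<or> B = points X)"

text \<open>
  \<open>Y\<close> is complete if for every variety \<open>Z\<close> the projection of \<open>Y \<times> Z\<close> to \<open>Z\<close> is closed.
  Taking the points of \<open>Z\<close> in \<open>'k vec\<close> is no restriction: over an infinite field every variety,
  being a finite union of sets embeddable in \<open>carrier_vec n\<close>, has an isomorphic copy there.
\<close>

definition complete_variety :: "('p, 'k::field) fspace \<Rightarrow> bool" where
  "complete_variety Y \<longleftrightarrow> variety Y \<and>
     (\<forall>Z :: ('k vec, 'k) fspace. variety Z \<longrightarrow> closed_map (prod_zariski Y Z) (zar Z) snd)"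

text \<open>
  The dimension of an irreducible variety is the transcendence degree of its function field.
  Finitely many rational functions are represented by regular functions on a common
  nonempty open set.
\<close>

definition alg_independent ::
    "('p, 'k::field) fspace \<Rightarrow> 'p set \<Rightarrow> nat \<Rightarrow> (nat \<Rightarrow> 'p \<Rightarrow> 'k) \<Rightarrow> bool" where
  "alg_independent X U d f \<longleftrightarrow>
     (\<forall>P\<in>polyfun d. (\<forall>x\<in>U. P (Matrix.vec d (\<lambda>i. f i x)) = 0) \<longrightarrow> (\<forall>v\<in>carrier_vec d. P v = 0))"

definition dimension :: "('p, 'k::field) fspace \<Rightarrow> enat" where
  "dimension X = (SUP d \<in> {d. \<exists>U f. openin (zar X) U \<and> U \<noteq> {} \<and>
     (\<forall>i<d. f i \<in> regf X U) \<and> alg_independent X U d f}. enat d)"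

definition germ :: "('p, 'k) fspace \<Rightarrow> 'p \<Rightarrow> 'p set \<Rightarrow> ('p \<Rightarrow> 'k) \<Rightarrow> ('p set \<times> ('p \<Rightarrow> 'k)) set" where
  "germ X x U f = {(V, g). openin (zar X) V \<and> x \<in> V \<and> g \<in> regf X V \<and>
     (\<exists>W. openin (zar X) W \<and> x \<in> W \<and> W \<subseteq> U \<inter> V \<and> (\<forall>y\<in>W. f y = g y))}"

text \<open>
  The tangent space at \<open>x\<close>: \<open>'k\<close>-derivations of the local ring at \<open>x\<close> with values in the
  residue field \<open>'k\<close>, extended by \<open>0\<close> outside the local ring.
\<close>

definition tangent_space ::
    "('p, 'k::field) fspace \<Rightarrow> 'p \<Rightarrow> (('p set \<times> ('p \<Rightarrow> 'k)) set \<Rightarrow> 'k) set" where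
  "tangent_space X x = {D.
     (\<forall>s. s \<notin> {germ X x U f | U f. openin (zar X) U \<and> x \<in> U \<and> f \<in> regf X U} \<longrightarrow> D s = 0) \<and>
     (\<forall>U. openin (zar X) U \<and> x \<in> U \<longrightarrow>
        (\<forall>c. D (germ X x U (\<lambda>_. c)) = 0) \<and>
        (\<forall>f\<in>regf X U. \<forall>g\<in>regf X U.
           D (germ X x U (\<lambda>y. f y + g y)) = D (germ X x U f) + D (germ X x U g) \<and>
           D (germ X x U (\<lambda>y. f y * g y)) = f x * D (germ X x U g) + g x * D (germ X x U f)))}"

definition scale_fun :: "'k::field \<Rightarrow> ('s \<Rightarrow> 'k) \<Rightarrow> 's \<Rightarrow> 'k" where
  "scale_fun c D = (\<lambda>s. c * D s)"

interpretation scale_fun: vector_space "scale_fun :: 'k::field \<Rightarrow> ('s \<Rightarrow> 'k) \<Rightarrow> 's \<Rightarrow> 'k"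
  by unfold_locales (auto simp: scale_fun_def fun_eq_iff algebra_simps)

lemma subspace_tangent_space: "scale_fun.subspace (tangent_space X x)"
proof (rule scale_fun.subspaceI)
  show "0 \<in> tangent_space X x"
    by (simp add: tangent_space_def)
  show "D + E \<in> tangent_space X x" if "D \<in> tangent_space X x" "E \<in> tangent_space X x" for D E
    using that unfolding tangent_space_def by (simp add: algebra_simps)
  show "scale_fun c D \<in> tangent_space X x" if "D \<in> tangent_space X x" for c D
    using that unfolding tangent_space_def by (simp add: scale_fun_def algebra_simps)
qed

definition smooth :: "('p, 'k::field) fspace \<Rightarrow> bool" where
  "smooth X \<longleftrightarrow> (\<forall>x\<in>points X. enat (scale_fun.dim (tangent_space X x)) = dimension X)"


section \<open>Rational maps\<close>

text \<open>The domain \<open>X\<close> is always an irreducible variety.\<close>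

definition rat_reps :: "('p, 'k) fspace \<Rightarrow> ('q, 'k) fspace \<Rightarrow> ('p set \<times> ('p \<Rightarrow> 'q)) set" where
  "rat_reps X Y = {(U, f). openin (zar X) U \<and> U \<noteq> {} \<and> morphism (open_subspace X U) Y f}"

definition rat_eq :: "('p, 'k) fspace \<Rightarrow> ('q, 'k) fspace \<Rightarrow>
    (('p set \<times> ('p \<Rightarrow> 'q)) \<times> ('p set \<times> ('p \<Rightarrow> 'q))) set" where
  "rat_eq X Y = {((U, f), (V, g)). (U, f) \<in> rat_reps X Y \<and> (V, g) \<in> rat_reps X Y \<and>
     (\<exists>W. openin (zar X) W \<and> W \<noteq> {} \<and> W \<subseteq> U \<inter> V \<and> (\<forall>x\<in>W. f x = g x))}"

type_synonym ('p, 'q) rat_map = "('p set \<times> ('p \<Rightarrow> 'q)) set"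

definition rational_maps :: "('p, 'k) fspace \<Rightarrow> ('q, 'k) fspace \<Rightarrow> ('p, 'q) rat_map set" where
  "rational_maps X Y = rat_reps X Y // rat_eq X Y"

definition rat_of :: "('p, 'k) fspace \<Rightarrow> ('q, 'k) fspace \<Rightarrow> ('p \<Rightarrow> 'q) \<Rightarrow> ('p, 'q) rat_map" where
  "rat_of X Y f = rat_eq X Y `` {(points X, f)}"

definition dominant :: "('q, 'k) fspace \<Rightarrow> ('p, 'q) rat_map \<Rightarrow> bool" where
  "dominant Y \<phi> \<longleftrightarrow> (\<exists>(U, f)\<in>\<phi>. zar Y closure_of (f ` U) = points Y)"

text \<open>
  The composite of \<open>\<phi>\<close> from \<open>X\<close> to \<open>Y\<close> and \<open>\<psi>\<close> from \<open>Y\<close> to \<open>Z\<close>. If \<open>\<phi>\<close> is dominant, this is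
  a single equivalence class.
\<close>

definition rat_comp :: "('p, 'k) fspace \<Rightarrow> ('r, 'k) fspace \<Rightarrow>
    ('q, 'r) rat_map \<Rightarrow> ('p, 'q) rat_map \<Rightarrow> ('p, 'r) rat_map" where
  "rat_comp X Z \<psi> \<phi> = {(W, h) \<in> rat_reps X Z. \<exists>(U, f)\<in>\<phi>. \<exists>(V, g)\<in>\<psi>.
     \<exists>W'. openin (zar X) W' \<and> W' \<noteq> {} \<and> W' \<subseteq> W \<inter> U \<and> f ` W' \<subseteq> V \<and> (\<forall>x\<in>W'. h x = g (f x))}"

definition birational_iso ::
    "('p, 'k) fspace \<Rightarrow> ('q, 'k) fspace \<Rightarrow> ('p, 'q) rat_map \<Rightarrow> bool" where
  "birational_iso X Y \<phi> \<longleftrightarrow> \<phi> \<in> rational_maps X Y \<and> dominant Y \<phi> \<and>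
     (\<exists>\<psi>\<in>rational_maps Y X. dominant X \<psi> \<and>
        rat_comp X X \<psi> \<phi> = rat_of X X (\<lambda>x. x) \<and> rat_comp Y Y \<phi> \<psi> = rat_of Y Y (\<lambda>y. y))"

definition Bir :: "('p, 'k) fspace \<Rightarrow> ('p, 'p) rat_map monoid" where
  "Bir X = \<lparr>carrier = {\<phi>. birational_iso X X \<phi>},
            monoid.mult = rat_comp X X,
            one = rat_of X X (\<lambda>x. x)\<rparr>"


section \<open>Group actions\<close>

definition rational_action ::
    "('g, 'a) monoid_scheme \<Rightarrow> ('p, 'k) fspace \<Rightarrow> ('g \<Rightarrow> ('p, 'p) rat_map) \<Rightarrow> bool" where
  "rational_action G X \<rho> \<longleftrightarrow> \<rho> \<in> mon G (Bir X)"

definition regular_action ::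
    "('g, 'a) monoid_scheme \<Rightarrow> ('p, 'k) fspace \<Rightarrow> ('g \<Rightarrow> 'p \<Rightarrow> 'p) \<Rightarrow> bool" where
  "regular_action G Y \<sigma> \<longleftrightarrow>
     group_action G (points Y) \<sigma> \<and> (\<forall>g\<in>carrier G. morphism Y Y (\<sigma> g))"

text \<open>Only used for dominant \<open>\<phi>\<close>, see \<open>rat_comp\<close>.\<close>

definition equivariant :: "('g, 'a) monoid_scheme \<Rightarrow>
    ('p, 'k) fspace \<Rightarrow> ('g \<Rightarrow> ('p, 'p) rat_map) \<Rightarrow>
    ('q, 'k) fspace \<Rightarrow> ('g \<Rightarrow> ('q, 'q) rat_map) \<Rightarrow> ('p, 'q) rat_map \<Rightarrow> bool" where
  "equivariant G X \<rho> Y \<tau> \<phi> \<longleftrightarrow>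
     (\<forall>g\<in>carrier G. rat_comp X Y \<phi> (\<rho> g) = rat_comp X Y (\<tau> g) \<phi>)"

definition regularization :: "('g, 'a) monoid_scheme \<Rightarrow>
    ('p, 'k::field) fspace \<Rightarrow> ('g \<Rightarrow> ('p, 'p) rat_map) \<Rightarrow>
    ('q, 'k) fspace \<Rightarrow> ('g \<Rightarrow> 'q \<Rightarrow> 'q) \<Rightarrow> bool" where
  "regularization G X \<rho> Y \<sigma> \<longleftrightarrow>
     irreducible_variety Y \<and> smooth Y \<and> complete_variety Y \<and> regular_action G Y \<sigma> \<and>
     (\<exists>\<phi>. birational_iso X Y \<phi> \<and> equivariant G X \<rho> Y (\<lambda>g. rat_of Y Y (\<sigma> g)) \<phi>)"

text \<open>
  Types cannot be quantified existentially, so the type \<open>'q\<close> of the points of the regularization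
  is a parameter.
\<close>

definition has_fixed_point :: "'q itself \<Rightarrow> ('g, 'a) monoid_scheme \<Rightarrow>
    ('p, 'k::field) fspace \<Rightarrow> ('g \<Rightarrow> ('p, 'p) rat_map) \<Rightarrow> bool" where
  "has_fixed_point (_ :: 'q itself) G X \<rho> \<longleftrightarrow>
     (\<exists>(Y :: ('q, 'k) fspace) \<sigma>. regularization G X \<rho> Y \<sigma> \<and>
        (\<exists>y\<in>points Y. \<forall>g\<in>carrier G. \<sigma> g y = y))"

definition nontrivial_base_change :: "('g, 'a) monoid_scheme \<Rightarrow>
    ('p, 'k) fspace \<Rightarrow> ('g \<Rightarrow> ('p, 'p) rat_map) \<Rightarrow>
    ('q, 'k) fspace \<Rightarrow> ('g \<Rightarrow> ('q, 'q) rat_map) \<Rightarrow> bool" where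
  "nontrivial_base_change G X\<^sub>1 \<rho>\<^sub>1 X\<^sub>2 \<rho>\<^sub>2 \<longleftrightarrow>
     (\<exists>\<phi>\<in>rational_maps X\<^sub>1 X\<^sub>2. dominant X\<^sub>2 \<phi> \<and> equivariant G X\<^sub>1 \<rho>\<^sub>1 X\<^sub>2 \<rho>\<^sub>2 \<phi> \<and>
        \<not> birational_iso X\<^sub>1 X\<^sub>2 \<phi>)"

definition GL :: "'k::field itself \<Rightarrow> nat \<Rightarrow> 'k mat monoid" where
  "GL ty n = units_of (ring_mat ty n ())"

definition linear_rational_action ::
    "nat \<Rightarrow> ('g \<Rightarrow> 'k::field mat) \<Rightarrow> 'g \<Rightarrow> ('k vec, 'k vec) rat_map" where
  "linear_rational_action n L g =
     rat_of (affine_space n) (affine_space n) (\<lambda>v. L g *\<^sub>v v)"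


section \<open>Invariant factors\<close>

text \<open>
  \<open>ms ! i\<close> is \<open>m\<^bsub>i+1\<^esub>\<close>. The trivial group has the sequence \<open>[1]\<close>: for it the remaining
  conditions allow any number of entries \<open>1\<close>, and the last clause restores uniqueness.
\<close>

definition invariant_factors :: "('g, 'a) monoid_scheme \<Rightarrow> nat list \<Rightarrow> bool" where
  "invariant_factors G ms \<longleftrightarrow> ms \<noteq> [] \<and>
     G \<cong> sum_group {..<length ms} (\<lambda>i. integer_mod_group (ms ! i)) \<and>
     (\<forall>i. Suc i < length ms \<longrightarrow> ms ! i dvd ms ! Suc i) \<and>
     (Coset.order G > 1 \<longrightarrow> ms ! 0 > 1) \<and>
     (Coset.order G = 1 \<longrightarrow> length ms = 1)"

definition T_group :: "nat \<Rightarrow> nat list \<Rightarrow> 'k::field mat set" where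
  "T_group n ms = {mat_diag n (\<lambda>i. if i < length ms then t i else 1) | t.
     \<forall>i<length ms. t i ^ (ms ! i) = 1}"

end

theory Submission
  imports Defs "HOL-Analysis.Abstract_Limits"
begin

text \<open>
  Let \<open>y\<close> be a fixed point on a smooth complete model \<open>Y\<close>. A group element that acts trivially on
  the cotangent space at \<open>y\<close> acts trivially on the local ring, by averaging and Nakayama's lemma. So
  the \<open>p\<close>-torsion of \<open>G\<close>, for a prime \<open>p\<close> dividing all invariant factors, embeds into the diagonal
  \<open>p\<close>-torsion matrices of size \<open>n\<close>, and \<open>r \<le> n\<close>.

  For every character of \<open>G\<close> there is a nonzero rational eigenfunction on \<open>Y\<close>: average a function
  that separates one point of a free orbit from the others. The invariants of \<open>k(Y)\<close> contain \<open>n\<close>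
  algebraically independent elements, because the eigencomponents of a transcendence basis are roots
  of invariants; multiplying the eigenfunctions by invariants makes \<open>n\<close> of them with prescribed
  characters algebraically independent. Taking a basis of the character group, followed by trivial
  characters, gives an equivariant dominant map to the linear model. Replacing the first function by
  its power with exponent \<open>m\<^sub>1 + 1\<close> keeps its character and makes the map non-birational.
\<close>

section \<open>Polynomial functions\<close>

text \<open>Function fields do not occur: rational functions are represented by regular functions on
  a common open set, and \<open>dimension\<close> is a supremum of lengths of independent families.
  Hence the inequality behind transcendence degree, that \<open>n\<close> independent elements
  algebraic over \<open>j\<close> others force \<open>n\<close> \<le> \<open>j\<close>, is obtained
  by counting: there are \<open>M ^ n\<close> monomials with exponents below \<open>M\<close>, and
  after clearing denominators they lie in a space whose dimension grows like \<open>M ^ j\<close>.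

  Smoothness says that the tangent space at the fixed point has dimension \<open>n\<close>, so the
  cotangent space has at most \<open>n\<close> eigenvectors in a basis; this bounds the rank. The
  eigenfunctions of the linear model are instead made at a generic point, because there the orbit is
  free and every character occurs.

  The exponent \<open>m\<^sub>1 + 1\<close> is the least one above 1 that preserves a character of
  order \<open>m\<^sub>1\<close>. It is at least 2 also for \<open>m\<^sub>1 = 1\<close>, which
  covers the trivial group. A birational map would make the first coordinate of affine space a
  proper power of a rational function.\<close>

lemma polyfun_uminus: "P \<in> polyfun n \<Longrightarrow> (\<lambda>v. - P v) \<in> polyfun n"
  using polyfun.mult[OF polyfun.const[of "-1"], of P n] by simp

lemma polyfun_sum: "(\<And>i. i \<in> I \<Longrightarrow> P i \<in> polyfun n) \<Longrightarrow> (\<lambda>v. \<Sum>i\<in>I. P i v) \<in> polyfun n"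
  by (induction I rule: infinite_finite_induct) (auto intro: polyfun.intros)

lemma polyfun_prod: "(\<And>i. i \<in> I \<Longrightarrow> P i \<in> polyfun n) \<Longrightarrow> (\<lambda>v. \<Prod>i\<in>I. P i v) \<in> polyfun n"
  by (induction I rule: infinite_finite_induct) (auto intro: polyfun.intros)

lemma polyfun_power: "P \<in> polyfun n \<Longrightarrow> (\<lambda>v. P v ^ m) \<in> polyfun n"
  by (induction m) (auto intro: polyfun.intros)

text \<open>Polynomial functions carry no coefficients or degree, so substitution into them is
  handled by closure: \<open>R\<close> becomes in turn a set of polynomial functions, of
  one-variable polynomials, of regular functions, of germs, or of functions with controlled
  growth.\<close>

lemma polyfun_subst_closed:
  assumes "P \<in> polyfun n"
    and "\<And>c. (\<lambda>_. c) \<in> R"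
    and "\<And>f g. f \<in> R \<Longrightarrow> g \<in> R \<Longrightarrow> (\<lambda>x. f x + g x) \<in> R"
    and "\<And>f g. f \<in> R \<Longrightarrow> g \<in> R \<Longrightarrow> (\<lambda>x. f x * g x) \<in> R"
    and "\<And>i. i < n \<Longrightarrow> h i \<in> R"
  shows "(\<lambda>x. P (Matrix.vec n (\<lambda>i. h i x))) \<in> R"
  using assms(1) by induction (use assms(2-) in auto)

lemma polyfun_comp:
  assumes "P \<in> polyfun n" "\<And>i. i < n \<Longrightarrow> Q i \<in> polyfun m"
  shows "(\<lambda>v. P (Matrix.vec n (\<lambda>i. Q i v))) \<in> polyfun m"
  using assms(1) by (rule polyfun_subst_closed) (auto intro: polyfun.intros assms)

lemma polyfun_vec_cong:
  assumes "P \<in> polyfun n" "\<And>i. i < n \<Longrightarrow> v $ i = w $ i"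
  shows "P v = P w"
  using assms(1) by induction (use assms(2) in auto)

text \<open>Restriction to a curve with polynomial coordinates gives a genuine \<open>poly\<close>,
  for which finiteness of roots and degrees are available.\<close>

lemma polyfun_poly_subst:
  fixes q :: "nat \<Rightarrow> 'k::field poly"
  assumes "P \<in> polyfun n"
  shows "\<exists>p. \<forall>t. P (Matrix.vec n (\<lambda>i. poly (q i) t)) = poly p t"
proof -
  have "(\<lambda>t. P (Matrix.vec n (\<lambda>i. poly (q i) t))) \<in> range poly"
    using assms
  proof (rule polyfun_subst_closed)
    show "(\<lambda>_. c) \<in> range poly" for c :: 'k
      by (rule range_eqI[of _ _ "[:c:]"]) auto
    show "(\<lambda>x. f x + g x) \<in> range poly" "(\<lambda>x. f x * g x) \<in> range poly"
      if "f \<in> range poly" "g \<in> range poly" for f g :: "'k \<Rightarrow> 'k"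
    proof -
      from that obtain p r where "f = poly p" "g = poly r" by auto
      then have "(\<lambda>x. f x + g x) = poly (p + r)" "(\<lambda>x. f x * g x) = poly (p * r)" by auto
      then show "(\<lambda>x. f x + g x) \<in> range poly" "(\<lambda>x. f x * g x) \<in> range poly" by auto
    qed
  qed auto
  then obtain p where "(\<lambda>t. P (Matrix.vec n (\<lambda>i. poly (q i) t))) = poly p" by blast
  then show ?thesis
    by (intro exI[of _ p] allI) (rule fun_cong)
qed

text \<open>On the line through \<open>a\<close> and \<open>b\<close> both functions become nonzero
  polynomials in one variable, whose product has only finitely many roots in an infinite field. This
  is the irreducibility of affine space.\<close>

lemma polyfun_nonzero_mult:
  fixes P Q :: "'k::field_char_0 vec \<Rightarrow> 'k"
  assumes P: "P \<in> polyfun n" "a \<in> carrier_vec n" "P a \<noteq> 0"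
    and Q: "Q \<in> polyfun n" "b \<in> carrier_vec n" "Q b \<noteq> 0"
  obtains c where "c \<in> carrier_vec n" "P c \<noteq> 0" "Q c \<noteq> 0"
proof -
  define line where "line t = Matrix.vec n (\<lambda>i. poly [:a $ i, b $ i - a $ i:] t)" for t
  obtain p where p: "\<forall>t. P (line t) = poly p t"
    unfolding line_def using polyfun_poly_subst[OF P(1), of "\<lambda>i. [:a $ i, b $ i - a $ i:]"] by (elim exE)
  obtain q where q: "\<forall>t. Q (line t) = poly q t"
    unfolding line_def using polyfun_poly_subst[OF Q(1), of "\<lambda>i. [:a $ i, b $ i - a $ i:]"] by (elim exE)
  have "line 0 = a" "line 1 = b"
    using P(2) Q(2) by (auto simp: line_def)
  then have "poly p 0 \<noteq> 0" "poly q 1 \<noteq> 0"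
    using P(3) Q(3) p[THEN spec, of 0] q[THEN spec, of 1] by simp_all
  then have "p * q \<noteq> 0" by auto
  then have "finite {t. poly (p * q) t = 0}" by (rule poly_roots_finite)
  then obtain t where "poly (p * q) t \<noteq> 0"
    using ex_new_if_finite[OF infinite_UNIV_char_0] by blast
  then show ?thesis
    using p q by (intro that[of "line t"]) (auto simp: line_def)
qed

text \<open>Turns a relation among \<open>Suc j\<close> functions into an equation for the last one
  over the first \<open>j\<close>.\<close>

lemma polyfun_last_variable:
  assumes "P \<in> polyfun (Suc j)"
  obtains e p where "\<And>i. p i \<in> polyfun j"
    "\<And>w. P (Matrix.vec (Suc j) w) = (\<Sum>i\<le>e. p i (Matrix.vec j w) * w j ^ i)"
proof -
  \<comment> \<open>Vanishing of the coefficients beyond \<open>e\<close> is added for the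
    induction: sums of different lengths can then be padded, and products are Cauchy
    products.\<close>
  have "\<exists>e p. (\<forall>i. p i \<in> polyfun j) \<and> (\<forall>i>e. p i = (\<lambda>_. 0)) \<and>
      (\<forall>w. P (Matrix.vec (Suc j) w) = (\<Sum>i\<le>e. p i (Matrix.vec j w) * w j ^ i))"
    using assms
  proof induction
    case (const c)
    show ?case
      by (rule exI[of _ 0], rule exI[of _ "\<lambda>i. if i = 0 then (\<lambda>_. c) else (\<lambda>_. 0)"])
        (auto intro: polyfun.intros)
  next
    case (coord i)
    show ?case
    proof (cases "i = j")
      case True
      show ?thesis
        by (rule exI[of _ 1], rule exI[of _ "\<lambda>i. if i = 1 then (\<lambda>_. 1) else (\<lambda>_. 0)"])
          (auto intro: polyfun.intros simp: True)
    next
      case False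
      then show ?thesis using coord
        by (intro exI[of _ 0] exI[of _ "\<lambda>k. if k = 0 then (\<lambda>v. v $ i) else (\<lambda>_. 0)"])
          (auto intro: polyfun.intros)
    qed
  next
    case (add P Q)
    from add.IH(1) obtain d p where
      p: "\<forall>i. p i \<in> polyfun j" "\<forall>i>d. p i = (\<lambda>_. 0)"
        "\<forall>w. P (Matrix.vec (Suc j) w) = (\<Sum>i\<le>d. p i (Matrix.vec j w) * w j ^ i)"
      by (elim exE conjE)
    from add.IH(2) obtain e q where
      q: "\<forall>i. q i \<in> polyfun j" "\<forall>i>e. q i = (\<lambda>_. 0)"
        "\<forall>w. Q (Matrix.vec (Suc j) w) = (\<Sum>i\<le>e. q i (Matrix.vec j w) * w j ^ i)"
      by (elim exE conjE)
    have "(\<Sum>i\<le>d. p i (Matrix.vec j w) * w j ^ i) = (\<Sum>i\<le>max d e. p i (Matrix.vec j w) * w j ^ i)" for w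
      using p(2) by (intro sum.mono_neutral_left) auto
    moreover have "(\<Sum>i\<le>e. q i (Matrix.vec j w) * w j ^ i) = (\<Sum>i\<le>max d e. q i (Matrix.vec j w) * w j ^ i)" for w
      using q(2) by (intro sum.mono_neutral_left) auto
    ultimately have "P (Matrix.vec (Suc j) w) + Q (Matrix.vec (Suc j) w) =
        (\<Sum>i\<le>max d e. (p i (Matrix.vec j w) + q i (Matrix.vec j w)) * w j ^ i)" for w
      unfolding p(3)[rule_format] q(3)[rule_format] by (simp only: sum.distrib distrib_right)
    moreover have "(\<lambda>v. p i v + q i v) \<in> polyfun j" for i
      using p(1) q(1) by (intro polyfun.add) auto
    ultimately show ?case
      using p(2) q(2) by (intro exI[of _ "max d e"] exI[of _ "\<lambda>i v. p i v + q i v"] conjI allI) simp_all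
  next
    case (mult P Q)
    from mult.IH(1) obtain d p where
      p: "\<forall>i. p i \<in> polyfun j" "\<forall>i>d. p i = (\<lambda>_. 0)"
        "\<forall>w. P (Matrix.vec (Suc j) w) = (\<Sum>i\<le>d. p i (Matrix.vec j w) * w j ^ i)"
      by (elim exE conjE)
    from mult.IH(2) obtain e q where
      q: "\<forall>i. q i \<in> polyfun j" "\<forall>i>e. q i = (\<lambda>_. 0)"
        "\<forall>w. Q (Matrix.vec (Suc j) w) = (\<Sum>i\<le>e. q i (Matrix.vec j w) * w j ^ i)"
      by (elim exE conjE)
    have "P (Matrix.vec (Suc j) w) * Q (Matrix.vec (Suc j) w) =
        (\<Sum>r\<le>d+e. (\<Sum>k\<le>r. p k (Matrix.vec j w) * q (r-k) (Matrix.vec j w)) * w j ^ r)" for w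
      unfolding p(3)[rule_format] q(3)[rule_format]
      by (rule polynomial_product) (use p(2) q(2) in auto)
    moreover have "(\<lambda>v. \<Sum>k\<le>r. p k v * q (r-k) v) = (\<lambda>_. 0)" if "r > d + e" for r
    proof
      fix v
      have "p k v * q (r-k) v = 0" if "k \<le> r" for k
        using p(2) q(2) that \<open>r > d + e\<close> by (cases "k > d") auto
      then show "(\<Sum>k\<le>r. p k v * q (r-k) v) = 0" by (intro sum.neutral) auto
    qed
    moreover have "(\<lambda>v. \<Sum>k\<le>r. p k v * q (r-k) v) \<in> polyfun j" for r
      using p(1) q(1) by (intro polyfun_sum polyfun.mult) auto
    ultimately show ?case
      by (intro exI[of _ "d+e"] exI[of _ "\<lambda>r v. \<Sum>k\<le>r. p k v * q (r-k) v"] conjI allI impI)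
  qed
  then show ?thesis using that by blast
qed

text \<open>A difference of values of a polynomial lies in the ideal generated by the differences of
  the arguments. With constant \<open>h\<close> this expands a function at the fixed point; with
  \<open>h'\<close> the translate of \<open>h\<close> by a group element it measures how that
  element moves a function.\<close>

lemma polyfun_diff_factor:
  assumes "P \<in> polyfun n"
    and "\<And>c. (\<lambda>_. c) \<in> R"
    and "\<And>f g. f \<in> R \<Longrightarrow> g \<in> R \<Longrightarrow> (\<lambda>x. f x + g x) \<in> R"
    and "\<And>f g. f \<in> R \<Longrightarrow> g \<in> R \<Longrightarrow> (\<lambda>x. f x * g x) \<in> R"
    and "\<And>i. i < n \<Longrightarrow> h i \<in> R" "\<And>i. i < n \<Longrightarrow> h' i \<in> R"
  shows "\<exists>C. (\<forall>i<n. C i \<in> R) \<and> (\<forall>x. P (Matrix.vec n (\<lambda>i. h' i x)) - P (Matrix.vec n (\<lambda>i. h i x))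
    = (\<Sum>i<n. C i x * (h' i x - h i x)))"
  using assms(1)
proof induction
  case (const c)
  show ?case using assms(2)[of 0] by (intro exI[of _ "\<lambda>_ _. 0"]) auto
next
  case (coord k)
  then show ?case using assms(2)[of 0] assms(2)[of 1]
    by (intro exI[of _ "\<lambda>i. if i = k then (\<lambda>_. 1) else (\<lambda>_. 0)"]) (auto simp: if_distrib if_distribR cong: if_cong)
next
  case (add P Q)
  then obtain C D where
    C: "\<forall>i<n. C i \<in> R" "\<forall>x. P (Matrix.vec n (\<lambda>i. h' i x)) - P (Matrix.vec n (\<lambda>i. h i x))
      = (\<Sum>i<n. C i x * (h' i x - h i x))" and
    D: "\<forall>i<n. D i \<in> R" "\<forall>x. Q (Matrix.vec n (\<lambda>i. h' i x)) - Q (Matrix.vec n (\<lambda>i. h i x))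
      = (\<Sum>i<n. D i x * (h' i x - h i x))"
    by blast
  have "P (Matrix.vec n (\<lambda>i. h' i x)) + Q (Matrix.vec n (\<lambda>i. h' i x)) -
     (P (Matrix.vec n (\<lambda>i. h i x)) + Q (Matrix.vec n (\<lambda>i. h i x)))
      = (\<Sum>i<n. (C i x + D i x) * (h' i x - h i x))" for x
  proof -
    have "P (Matrix.vec n (\<lambda>i. h' i x)) + Q (Matrix.vec n (\<lambda>i. h' i x)) -
        (P (Matrix.vec n (\<lambda>i. h i x)) + Q (Matrix.vec n (\<lambda>i. h i x)))
      = (P (Matrix.vec n (\<lambda>i. h' i x)) - P (Matrix.vec n (\<lambda>i. h i x)))
        + (Q (Matrix.vec n (\<lambda>i. h' i x)) - Q (Matrix.vec n (\<lambda>i. h i x)))"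
      by simp
    also have "\<dots> = (\<Sum>i<n. (C i x + D i x) * (h' i x - h i x))"
      unfolding C(2)[rule_format] D(2)[rule_format] by (simp add: sum.distrib distrib_right)
    finally show ?thesis .
  qed
  then show ?case using C(1) D(1) assms(3)
    by (intro exI[of _ "\<lambda>i x. C i x + D i x"]) auto
next
  case (mult P Q)
  then obtain C D where
    C: "\<forall>i<n. C i \<in> R" "\<forall>x. P (Matrix.vec n (\<lambda>i. h' i x)) - P (Matrix.vec n (\<lambda>i. h i x))
      = (\<Sum>i<n. C i x * (h' i x - h i x))" and
    D: "\<forall>i<n. D i \<in> R" "\<forall>x. Q (Matrix.vec n (\<lambda>i. h' i x)) - Q (Matrix.vec n (\<lambda>i. h i x))
      = (\<Sum>i<n. D i x * (h' i x - h i x))"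
    by blast
  let ?P = "\<lambda>x. P (Matrix.vec n (\<lambda>i. h' i x))" and ?Q = "\<lambda>x. Q (Matrix.vec n (\<lambda>i. h i x))"
  have PR: "?P \<in> R" using mult(1) by (rule polyfun_subst_closed) (use assms in auto)
  have QR: "?Q \<in> R" using mult(2) by (rule polyfun_subst_closed) (use assms in auto)
  have "?P x * Q (Matrix.vec n (\<lambda>i. h' i x)) - P (Matrix.vec n (\<lambda>i. h i x)) * ?Q x
      = (\<Sum>i<n. (?Q x * C i x + ?P x * D i x) * (h' i x - h i x))" for x
  proof -
    have "?P x * Q (Matrix.vec n (\<lambda>i. h' i x)) - P (Matrix.vec n (\<lambda>i. h i x)) * ?Q x
      = ?Q x * (?P x - P (Matrix.vec n (\<lambda>i. h i x))) + ?P x * (Q (Matrix.vec n (\<lambda>i. h' i x)) - ?Q x)"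
      by (simp add: algebra_simps)
    also have "\<dots> = (\<Sum>i<n. (?Q x * C i x + ?P x * D i x) * (h' i x - h i x))"
      unfolding C(2)[rule_format] D(2)[rule_format]
      by (simp add: sum.distrib distrib_right sum_distrib_left mult.assoc)
    finally show ?thesis .
  qed
  then show ?case using C(1) D(1) assms(3,4) PR QR
    by (intro exI[of _ "\<lambda>i x. ?Q x * C i x + ?P x * D i x"]) auto
qed

text \<open>Kronecker's substitution \<open>x\<^sub>i \<mapsto> t ^ (M ^ i)\<close> turns the monomial whose exponents are the
  base-\<open>M\<close> digits of \<open>a\<close> into \<open>t ^ a\<close>.\<close>

lemma digit_sum: "(\<Sum>i<n. (a div M ^ i) mod M * M ^ i) = a mod M ^ n" for a M :: nat
proof (induction n)
  case (Suc n)
  have "a mod M ^ Suc n = M ^ n * (a div M ^ n mod M) + a mod M ^ n"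
    unfolding power_Suc mult.commute[of M] by (rule mod_mult2_eq)
  then show ?case using Suc by (simp add: mult.commute)
qed simp

lemma digit_monomials_independent:
  fixes c :: "nat \<Rightarrow> 'k::field_char_0"
  assumes "\<And>v. v \<in> carrier_vec n \<Longrightarrow> (\<Sum>a<M ^ n. c a * (\<Prod>i<n. v $ i ^ (a div M ^ i mod M))) = 0"
    and "a < M ^ n"
  shows "c a = 0"
proof -
  define p :: "'k poly" where "p = (\<Sum>a<M ^ n. monom (c a) a)"
  have "poly p t = 0" for t
  proof -
    have *: "(\<Prod>i<n. (t ^ M ^ i) ^ (a div M ^ i mod M)) = t ^ a" if "a < M ^ n" for a
    proof -
      have "(\<Prod>i<n. (t ^ M ^ i) ^ (a div M ^ i mod M)) = t ^ (\<Sum>i<n. (a div M ^ i) mod M * M ^ i)"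
        unfolding power_sum by (intro prod.cong refl) (subst mult.commute, rule power_mult[symmetric])
      then show ?thesis using that by (simp add: digit_sum)
    qed
    have "poly p t = (\<Sum>a<M ^ n. c a * t ^ a)"
      by (simp add: p_def poly_sum poly_monom)
    also have "\<dots> = (\<Sum>a<M ^ n. c a * (\<Prod>i<n. Matrix.vec n (\<lambda>i. t ^ M ^ i) $ i ^ (a div M ^ i mod M)))"
      by (intro sum.cong refl arg_cong2[where f = "(*)"] trans[OF *[symmetric] prod.cong]) auto
    also have "\<dots> = 0"
      by (rule assms(1)) auto
    finally show ?thesis .
  qed
  then have "p = 0" using poly_all_0_iff_0[of p] by blast
  then have "coeff p a = 0" by simp
  then show ?thesis
    using assms(2) by (simp add: p_def coeff_sum)
qed

section \<open>Roots of unity\<close>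

text \<open>A root of the polynomial 1 + X + ... + X^(p-1) will do: it is a p-th root of unity, and
  it differs from 1, where the value is \<open>p\<close>, nonzero in characteristic 0.\<close>

lemma ex_nontrivial_prime_root_of_unity:
  assumes "prime (p::nat)"
  obtains w :: "'k :: {alg_closed_field, field_char_0}" where "w ^ p = 1" "w \<noteq> 1"
proof -
  have p: "p > 1" using assms by (rule prime_gt_1_nat)
  obtain w :: 'k where w: "(\<Sum>k\<le>p - 1. 1 * w ^ k) = 0"
    using alg_closed[of "p - 1" "\<lambda>_. 1"] p by auto
  have "(w - 1) * (\<Sum>k<p. w ^ k) = w ^ p - 1"
    by (rule power_diff_1_eq[symmetric])
  moreover have "{..<p} = {..p-1}" using p by auto
  ultimately have "w ^ p = 1" using w by simp
  moreover have "w \<noteq> 1"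
    using w p by (auto simp: of_nat_eq_0_iff)
  ultimately show ?thesis using that by blast
qed

text \<open>Orders are built up one prime at a time: for \<open>m = p * m'\<close>, a suitable p-th
  root of a primitive root for \<open>m'\<close> is primitive for \<open>m\<close>.\<close>

lemma ex_primitive_root_of_unity:
  assumes "m > 0"
  shows "\<exists>z :: 'k :: {alg_closed_field, field_char_0}. \<forall>k. z ^ k = 1 \<longleftrightarrow> m dvd k"
  using assms
proof (induction m rule: less_induct)
  case (less m)
  show ?case
  proof (cases "m = 1")
    case True
    then show ?thesis by (intro exI[of _ 1]) auto
  next
    case False
    then obtain p where p: "prime p" "p dvd m"
      using prime_factor_nat by blast
    then obtain m' where m: "m = p * m'" by auto
    have m': "m' > 0" "m' < m" using less.prems m prime_gt_1_nat[OF p(1)] by auto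
    obtain z' :: 'k where z': "\<And>k. z' ^ k = 1 \<longleftrightarrow> m' dvd k"
      using less.IH[OF m'(2,1)] by blast
    obtain z0 where z0: "z0 ^ p = z'"
      using nth_root_exists[of p z'] prime_gt_0_nat[OF p(1)] by auto
    obtain w :: 'k where w: "w ^ p = 1" "w \<noteq> 1"
      using ex_nontrivial_prime_root_of_unity[OF p(1)] by blast
    have dvd_p: "p dvd k" if "u ^ p = 1" "u ^ k = 1" "u \<noteq> 1" for u :: 'k and k
    proof (rule ccontr)
      assume "\<not> p dvd k"
      then have "coprime k p" using prime_imp_coprime[OF p(1)] by (simp add: coprime_commute)
      moreover have "k \<noteq> 0" using \<open>\<not> p dvd k\<close> by (metis dvd_0_right)
      ultimately obtain x y where "k * x = p * y + 1"
        using bezout_nat[of k p] by auto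
      then have "u ^ (k * x) = u * (u ^ p) ^ y" by (simp add: power_mult)
      then show False using that by (simp add: power_mult)
    qed
    \<comment> \<open>If every p-th root of \<open>z'\<close> had \<open>m'\<close>-th power 1, then
      comparing \<open>z0\<close> with \<open>z0 * w\<close> gives \<open>w ^ m' = 1\<close>, so
      \<open>p\<close> divides \<open>m'\<close>. With \<open>m' = p * l\<close> this yields
      \<open>z' ^ l = z0 ^ m' = 1\<close>, against the order of \<open>z'\<close>.\<close>
    have "\<exists>z. z ^ p = z' \<and> z ^ m' \<noteq> 1"
    proof (rule ccontr)
      assume *: "\<not> ?thesis"
      then have 1: "z0 ^ m' = 1" using z0 by blast
      have "(z0 * w) ^ p = z'" using z0 w by (simp add: power_mult_distrib)
      then have "(z0 * w) ^ m' = 1" using * by blast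
      then have "w ^ m' = 1" using 1 by (simp add: power_mult_distrib)
      then have "p dvd m'" using dvd_p w by blast
      then obtain l where l: "m' = p * l" by auto
      then have "z' ^ l = 1" using 1 z0 by (simp add: power_mult)
      then have "m' dvd l" using z' by blast
      then have "m' \<le> l" using l m'(1) by (intro dvd_imp_le) auto
      moreover have "l < p * l" using l m'(1) prime_gt_1_nat[OF p(1)] by simp
      ultimately show False using l by simp
    qed
    then obtain z where z: "z ^ p = z'" "z ^ m' \<noteq> 1" by blast
    have zm: "z ^ m = 1" using z z' by (simp add: m power_mult)
    \<comment> \<open>Passing to \<open>z'\<close> shows that \<open>m'\<close> divides
      \<open>k\<close>; the quotient is divisible by \<open>p\<close> because \<open>z ^ m'\<close>
      is a p-th root of unity other than 1.\<close>
    have "m dvd k" if k: "z ^ k = 1" for k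
    proof -
      have "z' ^ k = 1"
        unfolding z(1)[symmetric] using k by (simp add: power_mult[symmetric] mult.commute[of p]) (simp add: power_mult)
      then obtain l where l: "k = m' * l" using z' by auto
      have "(z ^ m') ^ p = 1" using zm by (simp add: m power_mult[symmetric] mult.commute)
      moreover have "(z ^ m') ^ l = 1" using k by (simp add: l power_mult)
      ultimately have "p dvd l" using z(2) dvd_p by blast
      then show ?thesis by (auto simp: m l)
    qed
    moreover have "z ^ k = 1" if "m dvd k" for k
      using that zm by (auto simp: power_mult)
    ultimately show ?thesis by blast
  qed
qed

section \<open>Transcendence degree by counting monomials\<close>

lemma sum_fun_apply: "(\<Sum>a\<in>A. f a) v = (\<Sum>a\<in>A. f a v)"
  by (induction A rule: infinite_finite_induct) auto

text \<open>An indexed family may repeat a vector, which independence of its range does not notice;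
  hence the separate case with the coefficients 1 and -1.\<close>

lemma scale_fun_linear_relation:
  fixes w :: "nat \<Rightarrow> 's \<Rightarrow> 'k::field"
  assumes "finite S" "card S < m" "\<And>a. a < m \<Longrightarrow> w a \<in> scale_fun.span S"
  obtains c where "\<exists>a<m. c a \<noteq> 0" "\<And>v. (\<Sum>a<m. c a * w a v) = 0"
proof (cases "inj_on w {..<m}")
  case True
  have "scale_fun.dependent (w ` {..<m})"
  proof (rule ccontr)
    assume "\<not> ?thesis"
    then have "card (w ` {..<m}) \<le> card S"
      using scale_fun.independent_span_bound[OF assms(1), of "w ` {..<m}"] assms(3) by auto
    then show False using assms(2) card_image[OF True] by simp
  qed
  then obtain u where u: "\<exists>v\<in>w ` {..<m}. u v \<noteq> 0" "(\<Sum>v\<in>w ` {..<m}. scale_fun (u v) v) = 0"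
    using scale_fun.dependent_finite[of "w ` {..<m}"] by auto
  have "(\<Sum>a<m. scale_fun (u (w a)) (w a)) = 0"
    using u(2) by (simp add: sum.reindex[OF True])
  then have "(\<Sum>a<m. u (w a) * w a v) = 0" for v
    by (metis (mono_tags, lifting) sum_fun_apply scale_fun_def sum.cong zero_fun_apply)
  then show ?thesis using u(1) that[of "\<lambda>a. u (w a)"] by auto
next
  case False
  then obtain a b where ab: "a < m" "b < m" "a \<noteq> b" "w a = w b"
    by (auto simp: inj_on_def)
  let ?c = "\<lambda>x. if x = a then 1 else if x = b then - 1 else (0::'k)"
  have "(\<Sum>x<m. ?c x * w x v) = (\<Sum>x\<in>{a, b}. ?c x * w x v)" for v
    using ab by (intro sum.mono_neutral_right) auto
  then show ?thesis using ab by (intro that[of ?c]) auto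
qed

lemma prod_power_fun_upd_Suc:
  fixes f :: "'i \<Rightarrow> 'k::comm_monoid_mult"
  assumes "finite A" "i \<in> A"
  shows "(\<Prod>x\<in>A. f x ^ (g(i := Suc (g i))) x) = f i * (\<Prod>x\<in>A. f x ^ g x)"
proof -
  have "(\<Prod>x\<in>A. f x ^ (g(i := Suc (g i))) x) = f i ^ Suc (g i) * (\<Prod>x\<in>A - {i}. f x ^ (g(i := Suc (g i))) x)"
    using assms by (simp add: prod.remove[of A i])
  also have "(\<Prod>x\<in>A - {i}. f x ^ (g(i := Suc (g i))) x) = (\<Prod>x\<in>A - {i}. f x ^ g x)"
    by (intro prod.cong) auto
  finally show ?thesis
    using assms by (simp add: prod.remove[of A i] mult.assoc)
qed

text \<open>Each \<open>a l\<close> satisfies an equation of degree \<open>e l\<close> over the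
  functions \<open>b\<close>. The leading term is isolated, with signs absorbed into the other
  coefficients, so that \<open>rel\<close> rewrites the top power of \<open>a l\<close> into lower
  ones at the cost of the leading coefficient.\<close>

locale algebraic_relations =
  fixes V :: "'q set" and j :: nat and b :: "nat \<Rightarrow> 'q \<Rightarrow> 'k::field_char_0"
    and s :: nat and a :: "nat \<Rightarrow> 'q \<Rightarrow> 'k" and e :: "nat \<Rightarrow> nat"
    and p :: "nat \<Rightarrow> nat \<Rightarrow> 'k vec \<Rightarrow> 'k"
  assumes e_pos: "l < s \<Longrightarrow> 0 < e l"
    and p_poly: "l < s \<Longrightarrow> p l i \<in> polyfun j"
    and rel: "l < s \<Longrightarrow> v \<in> V \<Longrightarrow> p l (e l) (Matrix.vec j (\<lambda>i. b i v)) * a l v ^ e l =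
      (\<Sum>i<e l. p l i (Matrix.vec j (\<lambda>i. b i v)) * a l v ^ i)"
begin

definition B where "B v = Matrix.vec j (\<lambda>i. b i v)"

text \<open>The relations hold on \<open>V\<close> only, while the linear algebra takes place among
  total functions; extension by 0 makes equality on \<open>V\<close> equality of vectors.\<close>

definition gen where
  "gen \<gamma> \<beta> = (\<lambda>v. if v \<in> V then (\<Prod>i<j. b i v ^ \<gamma> i) * (\<Prod>l<s. a l v ^ \<beta> l) else 0)"

text \<open>Each \<open>a l\<close> occurs only below the degree of its equation, so up to a
  constant factor the number of generators is \<open>D ^ j\<close>, whatever \<open>s\<close>
  is.\<close>

definition Gen where "Gen D = {gen \<gamma> \<beta> | \<gamma> \<beta>. (\<forall>i<j. \<gamma> i < D) \<and> (\<forall>l<s. \<beta> l < e l)}"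

definition Sp where "Sp D = scale_fun.span (Gen D)"

text \<open>Multiplication by \<open>F\<close> raises the level of the filtration \<open>Sp\<close>
  by at most \<open>d\<close>. Such bounds add up under products, which makes growth linear in the
  exponents.\<close>

definition stable where "stable F d \<longleftrightarrow> (\<forall>D. \<forall>h\<in>Sp D. (\<lambda>v. F v * h v) \<in> Sp (D + d))"

text \<open>A common denominator: lowering a power of any single \<open>a l\<close> uses up one
  leading coefficient.\<close>

definition lead where "lead v = (\<Prod>l<s. p l (e l) (B v))"

lemma Sp_mono: "D \<le> D' \<Longrightarrow> Sp D \<subseteq> Sp D'"
  unfolding Sp_def Gen_def by (rule scale_fun.span_mono) force

lemma Sp_add: "h \<in> Sp D \<Longrightarrow> h' \<in> Sp D \<Longrightarrow> (\<lambda>v. h v + h' v) \<in> Sp D"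
  unfolding Sp_def using scale_fun.span_add[of h "Gen D" h'] by (simp add: plus_fun_def)

lemma Sp_scale: "h \<in> Sp D \<Longrightarrow> (\<lambda>v. c * h v) \<in> Sp D"
  unfolding Sp_def using scale_fun.span_scale[of h "Gen D" c] by (simp add: scale_fun_def)

lemma Sp_zero: "(\<lambda>v. 0) \<in> Sp D"
  unfolding Sp_def using scale_fun.span_zero[of "Gen D"] by (simp add: zero_fun_def)

lemma Sp_sum: "(\<And>i. i \<in> I \<Longrightarrow> h i \<in> Sp D) \<Longrightarrow> (\<lambda>v. \<Sum>i\<in>I. h i v) \<in> Sp D"
  by (induction I rule: infinite_finite_induct) (auto intro: Sp_add Sp_zero)

lemma Sp_outside: "h \<in> Sp D \<Longrightarrow> v \<notin> V \<Longrightarrow> h v = 0"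
  unfolding Sp_def
proof (induction rule: scale_fun.span_induct_alt)
  case base
  then show ?case by simp
next
  case (step c x y)
  then show ?case by (auto simp: Gen_def gen_def scale_fun_def)
qed

lemma gen_in_Sp: "(\<And>i. i < j \<Longrightarrow> \<gamma> i < D) \<Longrightarrow> (\<And>l. l < s \<Longrightarrow> \<beta> l < e l) \<Longrightarrow> gen \<gamma> \<beta> \<in> Sp D"
  unfolding Sp_def Gen_def by (rule scale_fun.span_base) blast

lemma stableI:
  assumes "\<And>D \<gamma> \<beta>. (\<And>i. i < j \<Longrightarrow> \<gamma> i < D) \<Longrightarrow> (\<And>l. l < s \<Longrightarrow> \<beta> l < e l) \<Longrightarrow>
    (\<lambda>v. F v * gen \<gamma> \<beta> v) \<in> Sp (D + d)"
  shows "stable F d"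
  unfolding stable_def
proof (intro allI ballI)
  fix D h assume "h \<in> Sp D"
  then show "(\<lambda>v. F v * h v) \<in> Sp (D + d)"
    unfolding Sp_def[of D]
  proof (induction rule: scale_fun.span_induct_alt)
    case base
    then show ?case using Sp_zero by simp
  next
    case (step c x y)
    then have "(\<lambda>v. F v * x v) \<in> Sp (D + d)" using assms unfolding Gen_def by auto
    then have "(\<lambda>v. c * (F v * x v) + F v * y v) \<in> Sp (D + d)"
      using step by (intro Sp_add Sp_scale) auto
    then show ?case by (simp add: scale_fun_def algebra_simps)
  qed
qed

lemma stable_mono: "stable F d \<Longrightarrow> d \<le> d' \<Longrightarrow> stable F d'"
  unfolding stable_def using Sp_mono[OF add_left_mono] by blast

lemma stable_const: "stable (\<lambda>_. c) 0"
  unfolding stable_def using Sp_scale by simp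

lemma stable_add: "stable F d \<Longrightarrow> stable F' d \<Longrightarrow> stable (\<lambda>v. F v + F' v) d"
  unfolding stable_def using Sp_add by (simp add: distrib_right)

lemma stable_mult: "stable F d \<Longrightarrow> stable F' d' \<Longrightarrow> stable (\<lambda>v. F v * F' v) (d + d')"
  unfolding stable_def
proof (intro allI ballI)
  assume F: "\<forall>D. \<forall>h\<in>Sp D. (\<lambda>v. F v * h v) \<in> Sp (D + d)" "\<forall>D. \<forall>h\<in>Sp D. (\<lambda>v. F' v * h v) \<in> Sp (D + d')"
  fix D h assume "h \<in> Sp D"
  then have "(\<lambda>v. F' v * h v) \<in> Sp (D + d')" using F(2) by blast
  then have "(\<lambda>v. F v * (F' v * h v)) \<in> Sp (D + d' + d)" by (rule F(1)[rule_format])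
  then show "(\<lambda>v. F v * F' v * h v) \<in> Sp (D + (d + d'))" by (simp add: ac_simps)
qed

lemma stable_power: "stable F d \<Longrightarrow> stable (\<lambda>v. F v ^ m) (m * d)"
proof (induction m)
  case 0
  then show ?case using stable_const[of 1] by simp
next
  case (Suc m)
  then show ?case using stable_mult[of F d "\<lambda>v. F v ^ m" "m * d"] by simp
qed

lemma stable_prod: "(\<And>i. i < n \<Longrightarrow> stable (F i) d) \<Longrightarrow> stable (\<lambda>v. \<Prod>i<n. F i v) (n * d)"
proof (induction n)
  case 0
  then show ?case using stable_const[of 1] by simp
next
  case (Suc n)
  then have "stable (\<lambda>v. (\<Prod>i<n. F i v) * F n v) (n * d + d)"
    by (intro stable_mult) auto
  then show ?case by (simp add: add.commute)
qed

lemma stable_cong: "(\<And>v. v \<in> V \<Longrightarrow> F v = F' v) \<Longrightarrow> stable F d \<Longrightarrow> stable F' d"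
proof -
  assume *: "\<And>v. v \<in> V \<Longrightarrow> F v = F' v" and "stable F d"
  then show "stable F' d"
    unfolding stable_def
  proof (intro allI ballI)
    fix D h assume *: "\<And>v. v \<in> V \<Longrightarrow> F v = F' v" "h \<in> Sp D"
      "\<forall>D. \<forall>h\<in>Sp D. (\<lambda>v. F v * h v) \<in> Sp (D + d)"
    have "(\<lambda>v. F v * h v) = (\<lambda>v. F' v * h v)"
    proof
      show "F v * h v = F' v * h v" for v
        using *(1)[of v] Sp_outside[OF *(2), of v] by (cases "v \<in> V") auto
    qed
    then show "(\<lambda>v. F' v * h v) \<in> Sp (D + d)" using *(3)[rule_format, OF *(2)] by simp
  qed
qed

lemma stable_base: assumes "i < j" shows "stable (b i) 1"
proof (rule stableI)
  fix D :: nat and \<gamma> \<beta> :: "nat \<Rightarrow> nat" assume *: "\<And>i. i < j \<Longrightarrow> \<gamma> i < D" "\<And>l. l < s \<Longrightarrow> \<beta> l < e l"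
  have "(\<lambda>v. b i v * gen \<gamma> \<beta> v) = gen (\<gamma>(i := Suc (\<gamma> i))) \<beta>"
    unfolding gen_def using prod_power_fun_upd_Suc[OF finite_lessThan, of i j "\<lambda>x. b x v" \<gamma> for v] assms
    by (intro ext) (simp del: fun_upd_apply)
  moreover have "gen (\<gamma>(i := Suc (\<gamma> i))) \<beta> \<in> Sp (D + 1)"
    using * by (intro gen_in_Sp) (auto intro: less_SucI)
  ultimately show "(\<lambda>v. b i v * gen \<gamma> \<beta> v) \<in> Sp (D + 1)" by simp
qed

lemma stable_polyfun: "q \<in> polyfun j \<Longrightarrow> \<exists>d. stable (\<lambda>v. q (B v)) d"
proof (induction rule: polyfun.induct)
  case (const c)
  then show ?case using stable_const by blast
next
  case (coord i)
  then show ?case using stable_base by (auto simp: B_def)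
next
  case (add P Q)
  then obtain d d' where "stable (\<lambda>v. P (B v)) d" "stable (\<lambda>v. Q (B v)) d'" by blast
  then have "stable (\<lambda>v. P (B v)) (d + d')" "stable (\<lambda>v. Q (B v)) (d + d')"
    by (auto elim: stable_mono)
  then show ?case using stable_add by blast
next
  case (mult P Q)
  then show ?case using stable_mult by blast
qed

lemma stable_lead_power: "\<exists>d. stable (\<lambda>v. lead v ^ m) d"
  unfolding lead_def using p_poly
  by (intro stable_polyfun[of "\<lambda>v. (\<Prod>l<s. p l (e l) v) ^ m"] polyfun_power polyfun_prod) auto

text \<open>Multiplication by \<open>a l\<close> leaves the reduced monomials only if its exponent
  reaches \<open>e l\<close>. Then the factor \<open>p l (e l)\<close> of \<open>lead\<close>
  permits the reduction, and the remaining leading coefficients, collected in \<open>q\<close>, are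
  polynomials in \<open>b\<close>.\<close>

lemma stable_lead_mult: assumes l: "l < s" shows "\<exists>d. stable (\<lambda>v. lead v * a l v) d"
proof -
  define q where "q = (\<lambda>x. \<Prod>l'\<in>{..<s}-{l}. p l' (e l') x)"
  have q: "q \<in> polyfun j" unfolding q_def using p_poly by (intro polyfun_prod) auto
  obtain d0 where "stable (\<lambda>v. lead v ^ 1) d0" using stable_lead_power by blast
  then have d0: "stable lead d0" by simp
  have "\<forall>i. \<exists>d. stable (\<lambda>v. q (B v) * p l i (B v)) d"
    using polyfun.mult[OF q p_poly[OF l]] stable_polyfun by fastforce
  then obtain d where d: "\<And>i. stable (\<lambda>v. q (B v) * p l i (B v)) (d i)" by metis
  \<comment> \<open>The bound serves both cases: \<open>d0\<close> pays for \<open>lead\<close> when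
    no reduction takes place, and \<open>d i\<close> for the coefficient of the i-th lower power
    when it does.\<close>
  have "stable (\<lambda>v. lead v * a l v) (d0 + (\<Sum>i<e l. d i))"
  proof (rule stableI)
    fix D :: nat and \<gamma> \<beta> :: "nat \<Rightarrow> nat" assume *: "\<And>i. i < j \<Longrightarrow> \<gamma> i < D" "\<And>l. l < s \<Longrightarrow> \<beta> l < e l"
    show "(\<lambda>v. lead v * a l v * gen \<gamma> \<beta> v) \<in> Sp (D + (d0 + (\<Sum>i<e l. d i)))"
    proof (cases "Suc (\<beta> l) < e l")
      case True
      have "(\<lambda>v. lead v * a l v * gen \<gamma> \<beta> v) = (\<lambda>v. lead v * gen \<gamma> (\<beta>(l := Suc (\<beta> l))) v)"
        unfolding gen_def using l prod_power_fun_upd_Suc[OF finite_lessThan, of l s "\<lambda>x. a x v" \<beta> for v]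
        by (intro ext) (simp del: fun_upd_apply)
      moreover have "gen \<gamma> (\<beta>(l := Suc (\<beta> l))) \<in> Sp D"
        using * True by (intro gen_in_Sp) auto
      moreover have "stable lead (d0 + (\<Sum>i<e l. d i))"
        using d0 by (rule stable_mono) simp
      ultimately show ?thesis unfolding stable_def by auto
    next
      case False
      then have e: "e l = Suc (\<beta> l)" using *(2)[OF l] by simp
      have "lead v * a l v * gen \<gamma> \<beta> v = (\<Sum>i<e l. q (B v) * p l i (B v) * gen \<gamma> (\<beta>(l := i)) v)" for v
      proof (cases "v \<in> V")
        case True
        let ?r = "(\<Prod>i<j. b i v ^ \<gamma> i) * (\<Prod>l\<in>{..<s}-{l}. a l v ^ \<beta> l)"
        have g: "gen \<gamma> (\<beta>(l := i)) v = a l v ^ i * ?r" for i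
        proof -
          have "(\<Prod>x<s. a x v ^ (\<beta>(l := i)) x) = a l v ^ i * (\<Prod>x\<in>{..<s}-{l}. a x v ^ (\<beta>(l := i)) x)"
            using l by (simp add: prod.remove[of "{..<s}" l])
          also have "(\<Prod>x\<in>{..<s}-{l}. a x v ^ (\<beta>(l := i)) x) = (\<Prod>x\<in>{..<s}-{l}. a x v ^ \<beta> x)"
            by (intro prod.cong) auto
          finally show ?thesis using True by (simp add: gen_def)
        qed
        have "lead v = p l (e l) (B v) * q (B v)"
          unfolding lead_def q_def using l by (simp add: prod.remove[of "{..<s}" l])
        then have "lead v * a l v * gen \<gamma> \<beta> v = q (B v) * (p l (e l) (B v) * a l v ^ e l) * ?r"
          using g[of "\<beta> l"] by (simp add: e)
        also have "\<dots> = q (B v) * (\<Sum>i<e l. p l i (B v) * a l v ^ i) * ?r"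
          using rel[OF l True] by (simp add: B_def)
        also have "\<dots> = (\<Sum>i<e l. q (B v) * p l i (B v) * gen \<gamma> (\<beta>(l := i)) v)"
          unfolding g by (simp add: sum_distrib_left sum_distrib_right mult.assoc)
        finally show ?thesis .
      next
        case False
        then show ?thesis by (simp add: gen_def)
      qed
      moreover have "(\<lambda>v. \<Sum>i<e l. q (B v) * p l i (B v) * gen \<gamma> (\<beta>(l := i)) v) \<in> Sp (D + (d0 + (\<Sum>i<e l. d i)))"
      proof (rule Sp_sum)
        fix i assume i: "i \<in> {..<e l}"
        have "stable (\<lambda>v. q (B v) * p l i (B v)) (d0 + (\<Sum>i<e l. d i))"
          using d[of i] by (rule stable_mono) (use i in \<open>auto intro: trans_le_add2 member_le_sum\<close>)
        moreover have "gen \<gamma> (\<beta>(l := i)) \<in> Sp D"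
          using * i by (intro gen_in_Sp) auto
        ultimately show "(\<lambda>v. q (B v) * p l i (B v) * gen \<gamma> (\<beta>(l := i)) v) \<in> Sp (D + (d0 + (\<Sum>i<e l. d i)))"
          unfolding stable_def by blast
      qed
      ultimately show ?thesis by simp
    qed
  qed
  then show ?thesis by blast
qed

text \<open>The functions that become stable after multiplication by some power of
  \<open>lead\<close> form a ring, since powers of \<open>lead\<close> are themselves stable; this
  ring contains every \<open>a l\<close>.\<close>

lemma stable_lead_polyfun:
  assumes "P \<in> polyfun s"
  shows "\<exists>m d. stable (\<lambda>v. lead v ^ m * P (Matrix.vec s (\<lambda>l. a l v))) d"
proof -
  define good where "good = {F. \<exists>m d. stable (\<lambda>v. lead v ^ m * F v) d}"
  have "(\<lambda>v. P (Matrix.vec s (\<lambda>l. a l v))) \<in> good"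
    using assms
  proof (rule polyfun_subst_closed)
    show "(\<lambda>_. c) \<in> good" for c
      using stable_const[of c] unfolding good_def by (auto intro!: exI[of _ 0])
    show "(\<lambda>x. f x + g x) \<in> good" if "f \<in> good" "g \<in> good" for f g
    proof -
      from that obtain m d m' d' where *: "stable (\<lambda>v. lead v ^ m * f v) d" "stable (\<lambda>v. lead v ^ m' * g v) d'"
        unfolding good_def by blast
      obtain k k' where k: "stable (\<lambda>v. lead v ^ m) k" "stable (\<lambda>v. lead v ^ m') k'"
        using stable_lead_power by meson
      have "stable (\<lambda>v. lead v ^ m' * (lead v ^ m * f v)) (k' + d + (k + d'))"
        "stable (\<lambda>v. lead v ^ m * (lead v ^ m' * g v)) (k' + d + (k + d'))"
        using stable_mult[OF k(2) *(1)] stable_mult[OF k(1) *(2)] by (auto elim: stable_mono)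
      then have "stable (\<lambda>v. lead v ^ m' * (lead v ^ m * f v) + lead v ^ m * (lead v ^ m' * g v)) (k' + d + (k + d'))"
        by (rule stable_add)
      then have "stable (\<lambda>v. lead v ^ (m + m') * (f v + g v)) (k' + d + (k + d'))"
        by (simp add: power_add algebra_simps)
      then show ?thesis unfolding good_def by blast
    qed
    show "(\<lambda>x. f x * g x) \<in> good" if "f \<in> good" "g \<in> good" for f g
    proof -
      from that obtain m d m' d' where *: "stable (\<lambda>v. lead v ^ m * f v) d" "stable (\<lambda>v. lead v ^ m' * g v) d'"
        unfolding good_def by blast
      from stable_mult[OF this] have "stable (\<lambda>v. lead v ^ (m + m') * (f v * g v)) (d + d')"
        by (simp add: power_add algebra_simps)
      then show ?thesis unfolding good_def by blast
    qed
    show "a l \<in> good" if l: "l < s" for l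
    proof -
      obtain d where "stable (\<lambda>v. lead v * a l v) d" using stable_lead_mult[OF l] by blast
      then have "stable (\<lambda>v. lead v ^ 1 * a l v) d" by simp
      then show ?thesis unfolding good_def by blast
    qed
  qed
  then show ?thesis unfolding good_def by blast
qed

text \<open>A uniform exponent and degree for the whole family are needed, because monomials of
  unbounded degree in the \<open>P i\<close> will be compared. Stability of
  \<open>lead v ^ m\<close> alone allows them to be homogenized.\<close>

lemma stable_lead_family:
  "(\<And>i. i < n \<Longrightarrow> P i \<in> polyfun s) \<Longrightarrow>
    \<exists>m d. (\<forall>i<n. stable (\<lambda>v. lead v ^ m * P i (Matrix.vec s (\<lambda>l. a l v))) d) \<and> stable (\<lambda>v. lead v ^ m) d"
  for n :: nat
proof (induction n)
  case 0
  then show ?case using stable_lead_power by auto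
next
  case (Suc n)
  have "\<exists>m d. (\<forall>i<n. stable (\<lambda>v. lead v ^ m * P i (Matrix.vec s (\<lambda>l. a l v))) d) \<and> stable (\<lambda>v. lead v ^ m) d"
    by (rule Suc.IH) (use Suc.prems in auto)
  then obtain m d where
    IH: "\<forall>i<n. stable (\<lambda>v. lead v ^ m * P i (Matrix.vec s (\<lambda>l. a l v))) d" "stable (\<lambda>v. lead v ^ m) d"
    by (elim exE conjE)
  obtain m' d' where n: "stable (\<lambda>v. lead v ^ m' * P n (Matrix.vec s (\<lambda>l. a l v))) d'"
    using stable_lead_polyfun Suc.prems by blast
  obtain k where k: "stable (\<lambda>v. lead v ^ m') k"
    using stable_lead_power by meson
  have "stable (\<lambda>v. lead v ^ (m + m') * P i (Matrix.vec s (\<lambda>l. a l v))) (k + d + d')" if "i < Suc n" for i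
  proof (cases "i = n")
    case True
    show ?thesis
      by (rule stable_cong[OF _ stable_mono[OF stable_mult[OF IH(2) n]]]) (simp_all add: True power_add mult.assoc)
  next
    case False
    then have i: "stable (\<lambda>v. lead v ^ m * P i (Matrix.vec s (\<lambda>l. a l v))) d" using IH that by auto
    show ?thesis
      by (rule stable_cong[OF _ stable_mono[OF stable_mult[OF k i]]]) (simp_all add: power_add ac_simps)
  qed
  moreover have "stable (\<lambda>v. lead v ^ (m + m')) (k + d + d')"
    by (rule stable_cong[OF _ stable_mono[OF stable_mult[OF IH(2) k]]]) (simp_all add: power_add ac_simps)
  ultimately show ?case by blast
qed

lemma Gen_card: "finite (Gen D)" "card (Gen D) \<le> D ^ j * (\<Prod>l<s. e l)"
proof -
  let ?A = "({..<j} \<rightarrow>\<^sub>E {..<D}) \<times> (\<Pi>\<^sub>E l\<in>{..<s}. {..<e l})"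
  have fin: "finite ?A" by (intro finite_cartesian_product finite_PiE) auto
  have sub: "Gen D \<subseteq> (\<lambda>(\<gamma>, \<beta>). gen \<gamma> \<beta>) ` ?A"
  proof
    fix x assume "x \<in> Gen D"
    then obtain \<gamma> \<beta> where x: "x = gen \<gamma> \<beta>" "\<forall>i<j. \<gamma> i < D" "\<forall>l<s. \<beta> l < e l"
      unfolding Gen_def by blast
    have "x = gen (restrict \<gamma> {..<j}) (restrict \<beta> {..<s})"
    proof -
      have "(\<Prod>i<j. b i v ^ restrict \<gamma> {..<j} i) = (\<Prod>i<j. b i v ^ \<gamma> i)"
        "(\<Prod>l<s. a l v ^ restrict \<beta> {..<s} l) = (\<Prod>l<s. a l v ^ \<beta> l)" for v
        by (rule prod.cong; simp)+
      then show ?thesis unfolding x(1) gen_def by (simp only:)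
    qed
    moreover have "(restrict \<gamma> {..<j}, restrict \<beta> {..<s}) \<in> ?A"
      using x by auto
    ultimately show "x \<in> (\<lambda>(\<gamma>, \<beta>). gen \<gamma> \<beta>) ` ?A"
      by (intro image_eqI[of _ _ "(restrict \<gamma> {..<j}, restrict \<beta> {..<s})"]) simp_all
  qed
  show "finite (Gen D)" using finite_surj[OF fin sub] .
  have "card (Gen D) \<le> card ?A"
    using surj_card_le[OF fin sub] .
  also have "\<dots> = D ^ j * (\<Prod>l<s. e l)"
    by (simp add: card_cartesian_product card_PiE)
  finally show "card (Gen D) \<le> D ^ j * (\<Prod>l<s. e l)" .
qed

text \<open>The counting argument: more monomials in \<open>n\<close> functions than there are
  generators of the space that contains them force a linear relation, which is the polynomial
  \<open>Q\<close>. The power of \<open>lead\<close> remains as an uncancelled common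
  denominator.\<close>

lemma polyfun_relation:
  assumes P: "\<And>i. i < n \<Longrightarrow> P i \<in> polyfun s" and n: "j < n"
  shows "\<exists>Q K. Q \<in> polyfun n \<and> (\<exists>v\<in>carrier_vec n. Q v \<noteq> 0) \<and>
    (\<forall>v\<in>V. lead v ^ K * Q (Matrix.vec n (\<lambda>i. P i (Matrix.vec s (\<lambda>l. a l v)))) = 0)"
proof -
  define f where "f i v = P i (Matrix.vec s (\<lambda>l. a l v))" for i v
  have "\<exists>m d. (\<forall>i<n. stable (\<lambda>v. lead v ^ m * P i (Matrix.vec s (\<lambda>l. a l v))) d) \<and> stable (\<lambda>v. lead v ^ m) d"
    by (rule stable_lead_family) (rule P)
  then obtain m d where md0: "\<forall>i<n. stable (\<lambda>v. lead v ^ m * P i (Matrix.vec s (\<lambda>l. a l v))) d"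
    and md2: "stable (\<lambda>v. lead v ^ m) d"
    by (elim exE conjE)
  have md1: "stable (\<lambda>v. lead v ^ m * f i v) d" if "i < n" for i
    using md0 that by (simp add: f_def)
  define E where "E = (\<Prod>l<s. e l)"
  \<comment> \<open>With this choice the number of generators is at most \<open>M ^ j\<close> times
    a constant smaller than \<open>M\<close>, hence less than \<open>M ^ Suc j\<close> and so less
    than \<open>M ^ n\<close>.\<close>
  define M where "M = Suc ((1 + n * d) ^ j * E)"
  have digit_le: "x div M ^ i mod M \<le> M" for x i
    by (intro less_imp_le mod_less_divisor) (simp add: M_def)
  \<comment> \<open>The monomial with the base-\<open>M\<close> digits of \<open>x\<close> as
    exponents, each factor filled up with \<open>lead v ^ m\<close> to total exponent
    \<open>M\<close>, so that all monomials carry the same power of \<open>lead\<close>. The last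
    factor is the indicator function of \<open>V\<close>.\<close>
  define w where "w x = (\<lambda>v. (\<Prod>i<n. (lead v ^ m * f i v) ^ (x div M ^ i mod M) * (lead v ^ m) ^ (M - x div M ^ i mod M)) * gen (\<lambda>_. 0) (\<lambda>_. 0) v)" for x
  have "w x \<in> Sp (1 + n * (M * d))" for x
  proof -
    have "stable (\<lambda>v. \<Prod>i<n. (lead v ^ m * f i v) ^ (x div M ^ i mod M) * (lead v ^ m) ^ (M - x div M ^ i mod M)) (n * (M * d))"
    proof (rule stable_prod)
      fix i assume i: "i < n"
      let ?x = "x div M ^ i mod M"
      have "?x + (M - ?x) = M" using digit_le[of x i] by simp
      then have "M * d = ?x * d + (M - ?x) * d"
        by (metis add_mult_distrib)
      then show "stable (\<lambda>v. (lead v ^ m * f i v) ^ ?x * (lead v ^ m) ^ (M - ?x)) (M * d)"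
        using stable_mult[OF stable_power[OF md1[OF i], of ?x] stable_power[OF md2, of "M - ?x"]] by simp
    qed
    note st = this
    have "gen (\<lambda>_. 0) (\<lambda>_. 0) \<in> Sp 1" using e_pos by (intro gen_in_Sp) auto
    from st[unfolded stable_def, rule_format, OF this] show ?thesis unfolding w_def .
  qed
  then have wS: "w x \<in> scale_fun.span (Gen (1 + n * (M * d)))" for x unfolding Sp_def .
  have "card (Gen (1 + n * (M * d))) \<le> (1 + n * (M * d)) ^ j * E"
    unfolding E_def by (rule Gen_card)
  also have "\<dots> \<le> (M * (1 + n * d)) ^ j * E"
  proof (intro mult_right_mono power_mono)
    have "1 \<le> M" by (simp add: M_def)
    then show "1 + n * (M * d) \<le> M * (1 + n * d)" by (simp add: algebra_simps)
  qed auto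
  also have "\<dots> = M ^ j * ((1 + n * d) ^ j * E)"
    unfolding power_mult_distrib by (simp only: mult.assoc)
  also have "\<dots> < M ^ j * M"
    by (simp add: M_def)
  also have "\<dots> = M ^ Suc j" by simp
  also have "\<dots> \<le> M ^ n"
    using n by (intro power_increasing) (auto simp: M_def)
  finally have card: "card (Gen (1 + n * (M * d))) < M ^ n" .
  obtain c where c: "\<exists>x<M ^ n. c x \<noteq> 0" "\<And>v. (\<Sum>x<M ^ n. c x * w x v) = 0"
  proof (rule scale_fun_linear_relation[OF Gen_card(1) card, of w])
    show "w x \<in> scale_fun.span (Gen (1 + n * (M * d)))" for x by (rule wS)
  qed (rule that)
  define Q where "Q = (\<lambda>u::'k vec. \<Sum>x<M ^ n. c x * (\<Prod>i<n. u $ i ^ (x div M ^ i mod M)))"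
  show ?thesis
  proof (intro exI[of _ Q] exI[of _ "m * M * n"] conjI ballI)
    show "Q \<in> polyfun n"
      unfolding Q_def by (intro polyfun_sum polyfun.mult polyfun.const polyfun_prod polyfun_power polyfun.coord) auto
    show "\<exists>v\<in>carrier_vec n. Q v \<noteq> 0"
    proof (rule ccontr)
      assume "\<not> ?thesis"
      then have "(\<Sum>x<M ^ n. c x * (\<Prod>i<n. u $ i ^ (x div M ^ i mod M))) = 0" if "u \<in> carrier_vec n" for u
        using that by (auto simp: Q_def)
      then have "c x = 0" if "x < M ^ n" for x
        using that by (rule digit_monomials_independent)
      then show False using c(1) by auto
    qed
    fix v assume v: "v \<in> V"
    have w: "w x v = lead v ^ (m * M * n) * (\<Prod>i<n. f i v ^ (x div M ^ i mod M))" for x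
    proof -
      have "(lead v ^ m * f i v) ^ (x div M ^ i mod M) * (lead v ^ m) ^ (M - x div M ^ i mod M)
        = lead v ^ (m * M) * f i v ^ (x div M ^ i mod M)" for i
      proof -
        have "(lead v ^ m) ^ (x div M ^ i mod M) * (lead v ^ m) ^ (M - x div M ^ i mod M) = (lead v ^ m) ^ M"
          using digit_le[of x i] by (simp add: power_add[symmetric])
        moreover have "(lead v ^ m * f i v) ^ (x div M ^ i mod M) * (lead v ^ m) ^ (M - x div M ^ i mod M)
          = ((lead v ^ m) ^ (x div M ^ i mod M) * (lead v ^ m) ^ (M - x div M ^ i mod M)) * f i v ^ (x div M ^ i mod M)"
          by (simp only: power_mult_distrib ac_simps)
        ultimately show ?thesis by (simp only: power_mult)
      qed
      moreover have "gen (\<lambda>_. 0) (\<lambda>_. 0) v = 1" using v by (simp add: gen_def)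
      ultimately show ?thesis
        unfolding w_def by (simp add: prod.distrib power_mult)
    qed
    have "lead v ^ (m * M * n) * Q (Matrix.vec n (\<lambda>i. f i v)) = (\<Sum>x<M ^ n. c x * w x v)"
      unfolding w Q_def by (simp add: sum_distrib_left mult.left_commute)
    then show "lead v ^ (m * M * n) * Q (Matrix.vec n (\<lambda>i. P i (Matrix.vec s (\<lambda>l. a l v)))) = 0"
      using c(2) by (simp add: f_def)
  qed
qed

end

text \<open>A ring of functions whose restrictions to \<open>V\<close> form an integral domain. It
  takes the place of the function field: denominators are cleared instead of inverted, and vanishing
  always means vanishing on \<open>V\<close>.\<close>

locale function_domain =
  fixes V :: "'q set" and R :: "('q \<Rightarrow> 'k::field_char_0) set"
  assumes nonempty: "V \<noteq> {}"
    and R_const: "(\<lambda>_. c) \<in> R"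
    and R_add: "f \<in> R \<Longrightarrow> g \<in> R \<Longrightarrow> (\<lambda>x. f x + g x) \<in> R"
    and R_mult: "f \<in> R \<Longrightarrow> g \<in> R \<Longrightarrow> (\<lambda>x. f x * g x) \<in> R"
    and no_zero_divisors: "f \<in> R \<Longrightarrow> g \<in> R \<Longrightarrow> \<exists>v\<in>V. f v \<noteq> 0 \<Longrightarrow> \<exists>v\<in>V. g v \<noteq> 0 \<Longrightarrow>
      \<exists>v\<in>V. f v * g v \<noteq> 0"
begin

definition indep :: "nat \<Rightarrow> (nat \<Rightarrow> 'q \<Rightarrow> 'k) \<Rightarrow> bool" where
  "indep d f \<longleftrightarrow> (\<forall>P\<in>polyfun d. (\<forall>x\<in>V. P (Matrix.vec d (\<lambda>i. f i x)) = 0) \<longrightarrow> (\<forall>v\<in>carrier_vec d. P v = 0))"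

text \<open>The equation is nontrivial in the sense that some coefficient, after substitution of
  \<open>b\<close>, is not identically 0 on \<open>V\<close>. Nonzero polynomial functions as
  coefficients would not be enough if \<open>b\<close> were dependent.\<close>

definition algebraic :: "nat \<Rightarrow> (nat \<Rightarrow> 'q \<Rightarrow> 'k) \<Rightarrow> ('q \<Rightarrow> 'k) \<Rightarrow> bool" where
  "algebraic j b a \<longleftrightarrow> (\<exists>p e. (\<forall>i. p i \<in> polyfun j) \<and>
    (\<exists>i\<le>e. \<exists>v\<in>V. p i (Matrix.vec j (\<lambda>i. b i v)) \<noteq> 0) \<and>
    (\<forall>v\<in>V. (\<Sum>i\<le>e. p i (Matrix.vec j (\<lambda>i. b i v)) * a v ^ i) = 0))"

lemma algebraicI:
  assumes "\<And>i. p i \<in> polyfun j" "i \<le> e" "v \<in> V" "p i (Matrix.vec j (\<lambda>i. b i v)) \<noteq> 0"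
    "\<And>v. v \<in> V \<Longrightarrow> (\<Sum>i\<le>e. p i (Matrix.vec j (\<lambda>i. b i v)) * a v ^ i) = 0"
  shows "algebraic j b a"
  unfolding algebraic_def
  by (rule exI[of _ p], rule exI[of _ e]) (use assms in auto)

lemma algebraicE:
  assumes "algebraic j b a"
  obtains p i e v where "\<And>i. p i \<in> polyfun j" "i \<le> e" "v \<in> V" "p i (Matrix.vec j (\<lambda>i. b i v)) \<noteq> 0"
    "\<And>v. v \<in> V \<Longrightarrow> (\<Sum>i\<le>e. p i (Matrix.vec j (\<lambda>i. b i v)) * a v ^ i) = 0"
proof -
  from assms obtain p e where *: "(\<forall>i. p i \<in> polyfun j) \<and>
    (\<exists>i\<le>e. \<exists>v\<in>V. p i (Matrix.vec j (\<lambda>i. b i v)) \<noteq> 0) \<and>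
    (\<forall>v\<in>V. (\<Sum>i\<le>e. p i (Matrix.vec j (\<lambda>i. b i v)) * a v ^ i) = 0)"
    unfolding algebraic_def by (elim exE)
  then obtain i v where "i \<le> e" "v \<in> V" "p i (Matrix.vec j (\<lambda>i. b i v)) \<noteq> 0" by auto
  then show ?thesis using * by (intro that[of p i e v]) auto
qed

lemma R_polyfun: "P \<in> polyfun n \<Longrightarrow> (\<And>i. i < n \<Longrightarrow> f i \<in> R) \<Longrightarrow> (\<lambda>v. P (Matrix.vec n (\<lambda>i. f i v))) \<in> R"
  by (rule polyfun_subst_closed) (auto intro: R_const R_add R_mult)

lemma R_power: "f \<in> R \<Longrightarrow> (\<lambda>v. f v ^ m) \<in> R"
  by (induction m) (auto intro: R_const R_mult)

lemma nonzero_prod: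
  "(\<And>l. l < s \<Longrightarrow> f l \<in> R \<and> (\<exists>v\<in>V. f l v \<noteq> 0)) \<Longrightarrow> (\<lambda>v. \<Prod>l<s. f l v) \<in> R \<and> (\<exists>v\<in>V. (\<Prod>l<s. f l v) \<noteq> 0)"
  for s :: nat
proof (induction s)
  case 0
  then show ?case using R_const nonempty by auto
next
  case (Suc s)
  then have IH: "(\<lambda>v. \<Prod>l<s. f l v) \<in> R" "\<exists>v\<in>V. (\<Prod>l<s. f l v) \<noteq> 0" and f: "f s \<in> R" "\<exists>v\<in>V. f s v \<noteq> 0"
    by auto
  show ?case
    using R_mult[OF IH(1) f(1)] no_zero_divisors[OF IH(1) f(1) IH(2) f(2)] by simp
qed

text \<open>The leading coefficient is the last one that is not identically 0 on \<open>V\<close>.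
  Its index is positive, since otherwise the equation itself would say that this coefficient
  vanishes.\<close>

lemma algebraic_leading:
  assumes b: "\<And>i. i < j \<Longrightarrow> b i \<in> R" and "algebraic j b a"
  shows "\<exists>e p. 0 < e \<and> (\<forall>i. p i \<in> polyfun j) \<and> (\<exists>v\<in>V. p e (Matrix.vec j (\<lambda>i. b i v)) \<noteq> 0) \<and>
    (\<forall>v\<in>V. p e (Matrix.vec j (\<lambda>i. b i v)) * a v ^ e = (\<Sum>i<e. p i (Matrix.vec j (\<lambda>i. b i v)) * a v ^ i))"
proof -
  from assms(2) obtain e p i0 v0 where p: "\<And>i. p i \<in> polyfun j" and
    i0: "i0 \<le> e" "v0 \<in> V" "p i0 (Matrix.vec j (\<lambda>i. b i v0)) \<noteq> 0" and
    rel: "\<And>v. v \<in> V \<Longrightarrow> (\<Sum>i\<le>e. p i (Matrix.vec j (\<lambda>i. b i v)) * a v ^ i) = 0"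
    by (rule algebraicE) blast
  define B where "B v = Matrix.vec j (\<lambda>i. b i v)" for v
  define I where "I = {i. i \<le> e \<and> (\<exists>v\<in>V. p i (B v) \<noteq> 0)}"
  define d where "d = Max I"
  have I: "finite I" "i0 \<in> I" unfolding I_def using i0 by (auto simp: B_def)
  then have "d \<in> I" unfolding d_def by (intro Max_in) auto
  then have d: "d \<le> e" "\<exists>v\<in>V. p d (B v) \<noteq> 0" by (auto simp: I_def)
  have above: "p i (B v) = 0" if "d < i" "i \<le> e" "v \<in> V" for i v
  proof (rule ccontr)
    assume "p i (B v) \<noteq> 0"
    then have "i \<in> I" using that by (auto simp: I_def)
    then have "i \<le> d" unfolding d_def using I(1) by simp
    then show False using that by simp
  qed
  have rel': "p d (B v) * a v ^ d + (\<Sum>i<d. p i (B v) * a v ^ i) = 0" if "v \<in> V" for v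
  proof -
    have "(\<Sum>i\<le>e. p i (B v) * a v ^ i) = (\<Sum>i\<le>d. p i (B v) * a v ^ i)"
      using d above that by (intro sum.mono_neutral_right) auto
    also have "\<dots> = p d (B v) * a v ^ d + (\<Sum>i<d. p i (B v) * a v ^ i)"
      by (simp add: lessThan_Suc_atMost[symmetric] add.commute)
    finally show ?thesis using rel[OF that] by (simp add: B_def)
  qed
  have "0 < d"
  proof (rule ccontr)
    assume "\<not> 0 < d"
    then have "p d (B v) = 0" if "v \<in> V" for v using rel'[OF that] by simp
    then show False using d(2) by blast
  qed
  show ?thesis
  proof (intro exI[of _ d] exI[of _ "\<lambda>i x. if i = d then p i x else - p i x"] conjI allI ballI)

    show "(\<lambda>x. if i = d then p i x else - p i x) \<in> polyfun j" for i
      using p polyfun_uminus[OF p[of i]] by (cases "i = d") auto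
    show "\<exists>v\<in>V. (if d = d then p d (Matrix.vec j (\<lambda>i. b i v)) else - p d (Matrix.vec j (\<lambda>i. b i v))) \<noteq> 0"
      using d(2) by (simp add: B_def)
    show "(if d = d then p d (Matrix.vec j (\<lambda>i. b i v)) else - p d (Matrix.vec j (\<lambda>i. b i v))) * a v ^ d =
         (\<Sum>i<d. (if i = d then p i (Matrix.vec j (\<lambda>i. b i v)) else - p i (Matrix.vec j (\<lambda>i. b i v))) * a v ^ i)"
      if "v \<in> V" for v
      using rel'[OF that] by (simp add: B_def sum_negf eq_neg_iff_add_eq_0)
  qed (rule \<open>0 < d\<close>)
qed

text \<open>The substitute for Steinitz exchange. The functions \<open>f\<close> are polynomials in
  algebraic elements \<open>a\<close>, which avoids any proof that sums and products of algebraic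
  elements are algebraic.\<close>

lemma indep_card_le:
  assumes b: "\<And>i. i < j \<Longrightarrow> b i \<in> R" and a: "\<And>l. l < s \<Longrightarrow> a l \<in> R"
    and alg: "\<And>l. l < s \<Longrightarrow> algebraic j b (a l)"
    and P: "\<And>i. i < n \<Longrightarrow> P i \<in> polyfun s"
    and f: "\<And>i v. i < n \<Longrightarrow> v \<in> V \<Longrightarrow> f i v = P i (Matrix.vec s (\<lambda>l. a l v))"
    and indep: "indep n f"
  shows "n \<le> j"
proof (rule ccontr)
  assume "\<not> n \<le> j"
  then have "j < n" by simp
  have "\<exists>e p. 0 < e \<and> (\<forall>i. p i \<in> polyfun j) \<and> (\<exists>v\<in>V. p e (Matrix.vec j (\<lambda>i. b i v)) \<noteq> 0) \<and>
    (\<forall>v\<in>V. p e (Matrix.vec j (\<lambda>i. b i v)) * a l v ^ e = (\<Sum>i<e. p i (Matrix.vec j (\<lambda>i. b i v)) * a l v ^ i))"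
    if l: "l < s" for l
    by (rule algebraic_leading) (use b alg l in auto)
  then have "\<forall>l\<in>{..<s}. \<exists>e p. 0 < e \<and> (\<forall>i. p i \<in> polyfun j) \<and> (\<exists>v\<in>V. p e (Matrix.vec j (\<lambda>i. b i v)) \<noteq> 0) \<and>
    (\<forall>v\<in>V. p e (Matrix.vec j (\<lambda>i. b i v)) * a l v ^ e = (\<Sum>i<e. p i (Matrix.vec j (\<lambda>i. b i v)) * a l v ^ i))"
    by simp
  from bchoice[OF this] obtain e where "\<forall>l\<in>{..<s}. \<exists>p. 0 < e l \<and> (\<forall>i. p i \<in> polyfun j) \<and> (\<exists>v\<in>V. p (e l) (Matrix.vec j (\<lambda>i. b i v)) \<noteq> 0) \<and>
    (\<forall>v\<in>V. p (e l) (Matrix.vec j (\<lambda>i. b i v)) * a l v ^ e l = (\<Sum>i<e l. p i (Matrix.vec j (\<lambda>i. b i v)) * a l v ^ i))" ..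
  from bchoice[OF this] obtain p where p: "\<forall>l\<in>{..<s}. 0 < e l \<and> (\<forall>i. p l i \<in> polyfun j) \<and> (\<exists>v\<in>V. p l (e l) (Matrix.vec j (\<lambda>i. b i v)) \<noteq> 0) \<and>
    (\<forall>v\<in>V. p l (e l) (Matrix.vec j (\<lambda>i. b i v)) * a l v ^ e l = (\<Sum>i<e l. p l i (Matrix.vec j (\<lambda>i. b i v)) * a l v ^ i))" ..
  interpret algebraic_relations V j b s a e p
    by unfold_locales (use p in auto)
  have "\<exists>Q K. Q \<in> polyfun n \<and> (\<exists>v\<in>carrier_vec n. Q v \<noteq> 0) \<and>
    (\<forall>v\<in>V. lead v ^ K * Q (Matrix.vec n (\<lambda>i. P i (Matrix.vec s (\<lambda>l. a l v)))) = 0)"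
    by (rule polyfun_relation) (use P \<open>j < n\<close> in auto)
  then obtain Q K where Q: "Q \<in> polyfun n" "\<exists>v\<in>carrier_vec n. Q v \<noteq> 0"
    "\<forall>v\<in>V. lead v ^ K * Q (Matrix.vec n (\<lambda>i. P i (Matrix.vec s (\<lambda>l. a l v)))) = 0"
    by (elim exE conjE)
  have lead: "lead \<in> R \<and> (\<exists>v\<in>V. lead v \<noteq> 0)"
    unfolding lead_def B_def
    by (rule nonzero_prod) (use p in \<open>auto intro: R_polyfun b\<close>)
  have "(\<lambda>v. Q (Matrix.vec n (\<lambda>i. P i (Matrix.vec s (\<lambda>l. a l v))))) \<in> R"
    using Q(1) P a by (intro R_polyfun) auto
  \<comment> \<open>\<open>lead\<close> is a product of functions that do not vanish identically, so
    in a domain its powers can be cancelled from the relation.\<close>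
  from no_zero_divisors[OF R_power this, of lead K] lead Q(3)
  have "\<forall>v\<in>V. Q (Matrix.vec n (\<lambda>i. P i (Matrix.vec s (\<lambda>l. a l v)))) = 0"
    by auto
  moreover have "Q (Matrix.vec n (\<lambda>i. f i v)) = Q (Matrix.vec n (\<lambda>i. P i (Matrix.vec s (\<lambda>l. a l v))))" if "v \<in> V" for v
    using Q(1) by (rule polyfun_vec_cong) (use f that in auto)
  ultimately have "\<forall>v\<in>V. Q (Matrix.vec n (\<lambda>i. f i v)) = 0" by simp
  then show False using indep Q(1,2) unfolding indep_def by blast
qed

text \<open>Substitute the N-th power of the variable into the equation: the coefficients move to
  the multiples of \<open>N\<close>.\<close>

lemma algebraic_root:
  assumes "algebraic j b (\<lambda>v. f v ^ N)" "N > 0"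
  shows "algebraic j b f"
proof -
  from assms(1) obtain e p i0 v0 where p: "\<And>i. p i \<in> polyfun j" and
    i0: "i0 \<le> e" "v0 \<in> V" "p i0 (Matrix.vec j (\<lambda>i. b i v0)) \<noteq> 0" and
    rel: "\<And>v. v \<in> V \<Longrightarrow> (\<Sum>i\<le>e. p i (Matrix.vec j (\<lambda>i. b i v)) * (f v ^ N) ^ i) = 0"
    by (rule algebraicE) blast
  let ?p = "\<lambda>i x. if N dvd i then p (i div N) x else 0"
  show ?thesis
  proof (rule algebraicI[of ?p])
    show "?p i \<in> polyfun j" for i
      using p polyfun.const[of 0 j] by (cases "N dvd i") auto
    show "N * i0 \<le> N * e" "v0 \<in> V" "?p (N * i0) (Matrix.vec j (\<lambda>i. b i v0)) \<noteq> 0"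
      using i0 assms(2) by auto
    fix v assume "v \<in> V"
    let ?B = "Matrix.vec j (\<lambda>i. b i v)"
    have "(\<Sum>i\<le>N * e. ?p i ?B * f v ^ i) = (\<Sum>i\<in>(*) N ` {..e}. ?p i ?B * f v ^ i)"
      using assms(2) by (intro sum.mono_neutral_right) (auto elim!: dvdE)
    also have "\<dots> = (\<Sum>i\<le>e. p i ?B * (f v ^ N) ^ i)"
      using assms(2) by (subst sum.reindex) (auto simp: inj_on_def power_mult intro!: sum.cong)
    also have "\<dots> = 0" by (rule rel[OF \<open>v \<in> V\<close>])
    finally show "(\<Sum>i\<le>N * e. ?p i ?B * f v ^ i) = 0" .
  qed
qed

text \<open>The reversed polynomial, obtained by multiplying the equation by the inverse of
  \<open>u\<close> to the power \<open>e\<close>.\<close>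

lemma algebraic_inverse:
  assumes "algebraic j b u" "\<And>v. v \<in> V \<Longrightarrow> u v \<noteq> 0"
  shows "algebraic j b (\<lambda>v. inverse (u v))"
proof -
  from assms(1) obtain e p i0 v0 where p: "\<And>i. p i \<in> polyfun j" and
    i0: "i0 \<le> e" "v0 \<in> V" "p i0 (Matrix.vec j (\<lambda>i. b i v0)) \<noteq> 0" and
    rel: "\<And>v. v \<in> V \<Longrightarrow> (\<Sum>i\<le>e. p i (Matrix.vec j (\<lambda>i. b i v)) * u v ^ i) = 0"
    by (rule algebraicE) blast
  show ?thesis
  proof (rule algebraicI[of "\<lambda>i. p (e - i)"])
    show "p (e - i) \<in> polyfun j" for i by (rule p)
    show "e - i0 \<le> e" "v0 \<in> V" "p (e - (e - i0)) (Matrix.vec j (\<lambda>i. b i v0)) \<noteq> 0"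
      using i0 by auto
    fix v assume v: "v \<in> V"
    let ?B = "Matrix.vec j (\<lambda>i. b i v)"
    have "(\<Sum>i\<le>e. p (e - i) ?B * inverse (u v) ^ i) = (\<Sum>i\<le>e. p i ?B * inverse (u v) ^ (e - i))"
      by (rule sum.reindex_bij_witness[of _ "\<lambda>i. e - i" "\<lambda>i. e - i"]) auto
    also have "\<dots> = (\<Sum>i\<le>e. inverse (u v) ^ e * (p i ?B * u v ^ i))"
    proof (rule sum.cong[OF refl])
      fix i assume "i \<in> {..e}"
      then have "inverse (u v) ^ e = inverse (u v) ^ (e - i) * inverse (u v) ^ i"
        by (simp add: power_add[symmetric])
      then show "p i ?B * inverse (u v) ^ (e - i) = inverse (u v) ^ e * (p i ?B * u v ^ i)"
        using assms(2)[OF v] by (simp add: power_inverse)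
    qed
    also have "\<dots> = 0" using rel[OF v] by (simp add: sum_distrib_left[symmetric])
    finally show "(\<Sum>i\<le>e. p (e - i) ?B * inverse (u v) ^ i) = 0" .
  qed
qed

text \<open>Read a relation as an equation for \<open>a\<close>. Its coefficients vanish on
  \<open>V\<close> because \<open>a\<close> is not algebraic, and then vanish as polynomials because
  \<open>b\<close> is independent.\<close>

lemma indep_extend:
  assumes "indep j b" "\<not> algebraic j b a"
  shows "indep (Suc j) (b(j := a))"
  unfolding indep_def
proof (intro ballI impI)
  fix P and w :: "'k vec" assume P: "P \<in> polyfun (Suc j)" "\<forall>x\<in>V. P (Matrix.vec (Suc j) (\<lambda>i. (b(j := a)) i x)) = 0"
    and w: "w \<in> carrier_vec (Suc j)"
  from P(1) obtain e p where p: "\<And>i. p i \<in> polyfun j"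
    "\<And>w. P (Matrix.vec (Suc j) w) = (\<Sum>i\<le>e. p i (Matrix.vec j w) * w j ^ i)"
    by (rule polyfun_last_variable) blast
  have vec: "Matrix.vec j (\<lambda>i. (b(j := a)) i x) = Matrix.vec j (\<lambda>i. b i x)" for x by auto
  have "(\<Sum>i\<le>e. p i (Matrix.vec j (\<lambda>i. b i x)) * a x ^ i) = 0" if "x \<in> V" for x
    using P(2) that unfolding p(2) vec by simp
  then have "p i (Matrix.vec j (\<lambda>i. b i x)) = 0" if "i \<le> e" "x \<in> V" for i x
    using assms(2) algebraicI[of p j i e x b a, OF p(1) that] by blast
  then have "p i x = 0" if "i \<le> e" "x \<in> carrier_vec j" for i x
    using assms(1) p(1)[of i] that unfolding indep_def by blast
  then have "P (Matrix.vec (Suc j) (\<lambda>i. w $ i)) = 0"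
    unfolding p(2) by (intro sum.neutral) auto
  moreover have "Matrix.vec (Suc j) (\<lambda>i. w $ i) = w" using w by auto
  ultimately show "P w = 0" by simp
qed

text \<open>A greedy choice. The pool \<open>E k\<close> may depend on the position, as the k-th
  eigenfunction must have the k-th prescribed character.\<close>

lemma ex_indep_family:
  assumes step: "\<And>j b. j < n \<Longrightarrow> (\<And>k. k < j \<Longrightarrow> b k \<in> E k) \<Longrightarrow> indep j b \<Longrightarrow> \<exists>a\<in>E j. \<not> algebraic j b a"
  obtains b where "\<And>k. k < n \<Longrightarrow> b k \<in> E k" "indep n b"
proof -
  have "\<exists>b. (\<forall>k<m. b k \<in> E k) \<and> indep m b" if "m \<le> n" for m
    using that
  proof (induction m)
    case 0
    have "P w = 0" if "P \<in> polyfun 0" "\<forall>x\<in>V. P (Matrix.vec 0 (\<lambda>i. undefined i x)) = 0" "w \<in> carrier_vec 0"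
      for P and w :: "'k vec"
    proof -
      obtain x where "x \<in> V" using nonempty by blast
      moreover have "P w = P (Matrix.vec 0 (\<lambda>i. undefined i x))"
        using that(1) by (rule polyfun_vec_cong) simp
      ultimately show ?thesis using that(2) by simp
    qed
    then have "indep 0 undefined" unfolding indep_def by blast
    then show ?case by blast
  next
    case (Suc m)
    then obtain b where b: "\<forall>k<m. b k \<in> E k" "indep m b" by auto
    then obtain a where a: "a \<in> E m" "\<not> algebraic m b a"
      using step[of m b] Suc.prems by auto
    have "\<forall>k<Suc m. (b(m := a)) k \<in> E k" using a(1) b(1) by (simp add: less_Suc_eq)
    then show ?case using indep_extend[OF b(2) a(2)] by blast
  qed
  then show ?thesis using that by blast
qed

text \<open>If all powers \<open>g i c v ^ N\<close> were algebraic over \<open>j < n\<close>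
  functions, so would be their roots \<open>g i c\<close>, and the \<open>n\<close> independent
  functions \<open>f i\<close>, being sums of these, would contradict \<open>indep_card_le\<close>.
  In the application the \<open>g i c\<close> are eigencomponents and the powers are
  invariants.\<close>

lemma ex_indep_powers:
  fixes n q N :: nat
  assumes g: "\<And>i c. i < n \<Longrightarrow> c < q \<Longrightarrow> g i c \<in> R" and N: "N > 0"
    and f: "\<And>i v. i < n \<Longrightarrow> v \<in> V \<Longrightarrow> f i v = (\<Sum>c<q. g i c v)" and "indep n f"
  obtains b where "\<And>k. k < n \<Longrightarrow> \<exists>i<n. \<exists>c<q. b k = (\<lambda>v. g i c v ^ N)" "indep n b"
proof -
  let ?E = "{\<lambda>v. g i c v ^ N | i c. i < n \<and> c < q}"
  obtain b where b: "\<And>k. k < n \<Longrightarrow> b k \<in> ?E" "indep n b"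
  proof (rule ex_indep_family[of n "\<lambda>_. ?E"])
    fix j b assume j: "j < n" "\<And>k. k < j \<Longrightarrow> b k \<in> ?E" "indep j b"
    show "\<exists>a\<in>?E. \<not> algebraic j b a"
    proof (rule ccontr)
      assume *: "\<not> ?thesis"
      \<comment> \<open>Lists the doubly indexed family in one row, \<open>g i c\<close> standing at
        position \<open>i * q + c\<close>.\<close>
      define a where "a l = g (l div q) (l mod q)" for l
      have alg: "algebraic j b (a l) \<and> a l \<in> R" if "l < n * q" for l
      proof -
        have "0 < q" using that by (cases q) auto
        then have lq: "l div q < n" "l mod q < q" using that by (auto simp: less_mult_imp_div_less)
        then have "algebraic j b (\<lambda>v. a l v ^ N)" using * unfolding a_def by blast
        then show ?thesis using algebraic_root N g lq unfolding a_def by blast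
      qed
      have "n \<le> j"
      proof (rule indep_card_le[where b = b and a = a and s = "n * q" and f = f])
        show "b i \<in> R" if "i < j" for i
        proof -
          from j(2)[OF that] obtain i' c where "b i = (\<lambda>v. g i' c v ^ N)" "i' < n" "c < q" by blast
          then show ?thesis using R_power g by simp
        qed
        show "a l \<in> R" "algebraic j b (a l)" if "l < n * q" for l using alg[OF that] by auto
        have less: "i * q + c < n * q" if "i < n" "c < q" for i c
        proof -
          have "i * q + c < Suc i * q" using that by simp
          also have "\<dots> \<le> n * q" using that by (intro mult_right_mono) auto
          finally show ?thesis .
        qed
        show "(\<lambda>w. \<Sum>c<q. w $ (i * q + c)) \<in> polyfun (n * q)" if "i < n" for i
          using less that by (intro polyfun_sum polyfun.coord) auto
        show "f i v = (\<Sum>c<q. Matrix.vec (n * q) (\<lambda>l. a l v) $ (i * q + c))" if "i < n" "v \<in> V" for i v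
          unfolding f[OF that] using less that by (intro sum.cong) (auto simp: a_def)
      qed (rule assms(4))
      then show False using j(1) by simp
    qed
  qed blast
  show ?thesis
  proof (rule that[of b])
    show "\<exists>i<n. \<exists>c<q. b k = (\<lambda>v. g i c v ^ N)" if "k < n" for k
      using b(1)[OF that] by blast
  qed (rule b(2))
qed

text \<open>If \<open>u j\<close> and all products of \<open>u j\<close> with the \<open>f i\<close>
  were algebraic over the functions chosen before, then so would be the inverse of
  \<open>u j\<close>, and each \<open>f i\<close> is a product of two of these elements.\<close>

lemma ex_indep_multiples:
  assumes u: "\<And>j. j < n \<Longrightarrow> u j \<in> R" "\<And>j. j < n \<Longrightarrow> (\<lambda>v. inverse (u j v)) \<in> R"
    "\<And>j v. j < n \<Longrightarrow> v \<in> V \<Longrightarrow> u j v \<noteq> 0"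
    and f: "\<And>i. i < n \<Longrightarrow> f i \<in> R" and "indep n f"
  obtains b where "\<And>k. k < n \<Longrightarrow> b k = u k \<or> (\<exists>i<n. b k = (\<lambda>v. u k v * f i v))" "indep n b"
proof -
  let ?E = "\<lambda>k. insert (u k) {\<lambda>v. u k v * f i v | i. i < n}"
  obtain b where b: "\<And>k. k < n \<Longrightarrow> b k \<in> ?E k" "indep n b"
  proof (rule ex_indep_family[of n ?E])
    fix j b assume j: "j < n" "\<And>k. k < j \<Longrightarrow> b k \<in> ?E k" "indep j b"
    show "\<exists>a\<in>?E j. \<not> algebraic j b a"
    proof (rule ccontr)
      assume *: "\<not> ?thesis"
      \<comment> \<open>Position 0 holds the inverse and position \<open>Suc i\<close> the product
        with \<open>f i\<close>, so that \<open>f i\<close> is the polynomial coordinate 0 times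
        coordinate \<open>Suc i\<close>.\<close>
      define a where "a l = (if l = 0 then (\<lambda>v. inverse (u j v)) else (\<lambda>v. u j v * f (l - 1) v))" for l
      have "n \<le> j"
      proof (rule indep_card_le[where b = b and a = a and s = "Suc n" and f = f])
        show "b i \<in> R" if "i < j" for i
        proof -
          have "b i = u i \<or> (\<exists>i'<n. b i = (\<lambda>v. u i v * f i' v))" using j(2)[OF that] by blast
          then show ?thesis using u(1)[of i] f R_mult that j(1) by auto
        qed
        show "a l \<in> R" if "l < Suc n" for l
          using u(1,2)[OF j(1)] f[of "l - 1"] that R_mult[of "u j" "f (l - 1)"] unfolding a_def
          by (cases "l = 0") auto
        show "algebraic j b (a l)" if "l < Suc n" for l
        proof (cases "l = 0")
          case True
          have "algebraic j b (u j)" using * by blast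
          then show ?thesis using algebraic_inverse[of j b "u j"] u(3)[OF j(1)] True by (simp add: a_def)
        next
          case False
          then have "l - 1 < n" using that by simp
          then have "algebraic j b (\<lambda>v. u j v * f (l - 1) v)" using * by blast
          then show ?thesis using False by (simp add: a_def)
        qed
        show "(\<lambda>w. w $ 0 * w $ Suc i) \<in> polyfun (Suc n)" if "i < n" for i
          using that by (intro polyfun.mult polyfun.coord) auto
        show "f i v = Matrix.vec (Suc n) (\<lambda>l. a l v) $ 0 * Matrix.vec (Suc n) (\<lambda>l. a l v) $ Suc i" if "i < n" "v \<in> V" for i v
          using that u(3)[OF j(1)] by (simp add: a_def)
      qed (rule assms(5))
      then show False using j(1) by simp
    qed
  qed blast
  show ?thesis
  proof (rule that[of b])
    show "b k = u k \<or> (\<exists>i<n. b k = (\<lambda>v. u k v * f i v))" if "k < n" for k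
      using b(1)[OF that] by blast
  qed (rule b(2))
qed

text \<open>Substituting the q-th power of the first variable into a polynomial is injective because
  every element of the field has a q-th root.\<close>

lemma indep_power_0:
  assumes "indep n f" "q > 0" and root: "\<And>x::'k. \<exists>y. y ^ q = x"
  shows "indep n (f(0 := \<lambda>v. f 0 v ^ q))"
  unfolding indep_def
proof (intro ballI impI)
  fix P and w :: "'k vec" assume P: "P \<in> polyfun n" "\<forall>x\<in>V. P (Matrix.vec n (\<lambda>i. (f(0 := \<lambda>v. f 0 v ^ q)) i x)) = 0"
    and w: "w \<in> carrier_vec n"
  let ?Q = "\<lambda>w. P (Matrix.vec n (\<lambda>i. if i = 0 then w $ i ^ q else w $ i))"
  have Q: "?Q \<in> polyfun n"
    using P(1)
  proof (rule polyfun_comp)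
    show "(\<lambda>w. if i = 0 then w $ i ^ q else w $ i) \<in> polyfun n" if "i < n" for i
      using polyfun_power[OF polyfun.coord[OF that]] polyfun.coord[OF that] by (cases "i = 0") auto
  qed
  have "?Q (Matrix.vec n (\<lambda>i. f i x)) = 0" if "x \<in> V" for x
  proof -
    have "?Q (Matrix.vec n (\<lambda>i. f i x)) = P (Matrix.vec n (\<lambda>i. (f(0 := \<lambda>v. f 0 v ^ q)) i x))"
      using P(1) by (rule polyfun_vec_cong) simp
    then show ?thesis using P(2) that by simp
  qed
  then have "\<forall>x\<in>V. ?Q (Matrix.vec n (\<lambda>i. f i x)) = 0" ..
  with bspec[OF assms(1)[unfolded indep_def] Q] have Q0: "\<forall>w\<in>carrier_vec n. ?Q w = 0"
    by (rule mp)
  obtain y where y: "y ^ q = w $ 0" using root by blast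
  have "P w = ?Q (Matrix.vec n (\<lambda>i. if i = 0 then y else w $ i))"
    using P(1) by (rule polyfun_vec_cong) (simp add: y)
  also have "\<dots> = 0" by (rule Q0[rule_format]) simp
  finally show "P w = 0" .
qed

end

section \<open>Spaces with functions that behave like varieties\<close>

lemma
  assumes "space_with_functions X"
  shows regf_const: "openin (zar X) U \<Longrightarrow> (\<lambda>_. c) \<in> regf X U"
    and regf_add: "openin (zar X) U \<Longrightarrow> f \<in> regf X U \<Longrightarrow> g \<in> regf X U \<Longrightarrow> (\<lambda>x. f x + g x) \<in> regf X U"
    and regf_mult: "openin (zar X) U \<Longrightarrow> f \<in> regf X U \<Longrightarrow> g \<in> regf X U \<Longrightarrow> (\<lambda>x. f x * g x) \<in> regf X U"
    and regf_subset: "openin (zar X) U \<Longrightarrow> openin (zar X) V \<Longrightarrow> V \<subseteq> U \<Longrightarrow> f \<in> regf X U \<Longrightarrow> f \<in> regf X V"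
    and regf_Union: "(\<And>U. U \<in> \<U> \<Longrightarrow> openin (zar X) U \<and> f \<in> regf X U) \<Longrightarrow> f \<in> regf X (\<Union>\<U>)"
    and regf_cong: "openin (zar X) U \<Longrightarrow> f \<in> regf X U \<Longrightarrow> (\<And>x. x \<in> U \<Longrightarrow> f x = g x) \<Longrightarrow> g \<in> regf X U"
proof -
  note D = assms[unfolded space_with_functions_def]
  note D1 = conjunct1[OF D, THEN spec, THEN mp] and D2 = conjunct2[OF D]
  show "(\<lambda>_. c) \<in> regf X U" if "openin (zar X) U"
    by (rule D1[OF that, THEN conjunct1, THEN spec])
  show "(\<lambda>x. f x + g x) \<in> regf X U" if "openin (zar X) U" "f \<in> regf X U" "g \<in> regf X U"
    by (rule D1[OF that(1), THEN conjunct2, THEN bspec, OF that(2), THEN bspec, OF that(3), THEN conjunct1])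
  show "(\<lambda>x. f x * g x) \<in> regf X U" if "openin (zar X) U" "f \<in> regf X U" "g \<in> regf X U"
    by (rule D1[OF that(1), THEN conjunct2, THEN bspec, OF that(2), THEN bspec, OF that(3), THEN conjunct2])
  show "f \<in> regf X V" if "openin (zar X) U" "openin (zar X) V" "V \<subseteq> U" "f \<in> regf X U"
    by (rule conjunct1[OF D2, THEN spec, THEN spec, THEN spec, THEN mp, of U V f]) (intro conjI that)
  show "f \<in> regf X (\<Union>\<U>)" if "\<And>U. U \<in> \<U> \<Longrightarrow> openin (zar X) U \<and> f \<in> regf X U"
    by (rule conjunct1[OF conjunct2[OF D2], THEN spec, THEN spec, THEN mp]) (intro ballI that)
  show "g \<in> regf X U" if "openin (zar X) U" "f \<in> regf X U" "\<And>x. x \<in> U \<Longrightarrow> f x = g x"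
    by (rule conjunct2[OF conjunct2[OF D2], THEN spec, THEN spec, THEN spec, THEN mp, of U f g])
      (intro conjI ballI that)
qed

lemma regf_local:
  assumes "space_with_functions X"
    and "\<And>x. x \<in> U \<Longrightarrow> \<exists>V. openin (zar X) V \<and> x \<in> V \<and> V \<subseteq> U \<and> f \<in> regf X V"
  shows "f \<in> regf X U"
proof -
  have "f \<in> regf X (\<Union>{V. openin (zar X) V \<and> V \<subseteq> U \<and> f \<in> regf X V})"
    using assms(1) by (rule regf_Union) auto
  moreover have "\<Union>{V. openin (zar X) V \<and> V \<subseteq> U \<and> f \<in> regf X V} = U"
  proof (intro equalityI subsetI)
    fix x assume "x \<in> U"
    from assms(2)[OF this] show "x \<in> \<Union>{V. openin (zar X) V \<and> V \<subseteq> U \<and> f \<in> regf X V}" by blast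
  qed blast
  ultimately show ?thesis by simp
qed

lemma regf_polyfun:
  assumes "space_with_functions X" "openin (zar X) U" "P \<in> polyfun n" "\<And>i. i < n \<Longrightarrow> h i \<in> regf X U"
  shows "(\<lambda>x. P (Matrix.vec n (\<lambda>i. h i x))) \<in> regf X U"
  using assms(3) by (rule polyfun_subst_closed) (intro regf_const regf_add regf_mult assms; assumption)+

text \<open>The part of local affineness on which the arguments about rational maps rest. It is
  available for prevarieties and for affine space alike, so both can be treated at once.\<close>

definition regular_space :: "('p, 'k::field) fspace \<Rightarrow> bool" where
  "regular_space X \<longleftrightarrow> space_with_functions X \<and>
    (\<forall>U f. openin (zar X) U \<and> f \<in> regf X U \<longrightarrow>
      openin (zar X) {x \<in> U. f x \<noteq> 0} \<and> (\<lambda>x. inverse (f x)) \<in> regf X {x \<in> U. f x \<noteq> 0})"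

lemma morphism_comp: "morphism X Y f \<Longrightarrow> openin (zar Y) V \<Longrightarrow> h \<in> regf Y V \<Longrightarrow>
  h \<circ> f \<in> regf X {x \<in> points X. f x \<in> V}"
  by (simp add: morphism_def)

lemma openin_nonvanishing: "P \<in> polyfun n \<Longrightarrow> openin (zariski_topology n) {v \<in> carrier_vec n. P v \<noteq> 0}"
  unfolding openin_zariski by (rule exI[of _ "{P}"]) auto

lemma openin_embedded_nonvanishing:
  assumes "openin (subtopology (zariski_topology n) S) V" "P \<in> polyfun n"
  shows "openin (subtopology (zariski_topology n) S) {v \<in> V. P v \<noteq> 0}"
proof -
  have V: "V \<subseteq> carrier_vec n" "V \<subseteq> S"
    using openin_subset[OF assms(1)] by (auto simp: topspace_zariski)
  have "openin (subtopology (zariski_topology n) S) (V \<inter> ({v \<in> carrier_vec n. P v \<noteq> 0} \<inter> S))"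
    using assms(1) openin_nonvanishing[OF assms(2)] by (intro openin_Int openin_subtopology_Int)
  moreover have "V \<inter> ({v \<in> carrier_vec n. P v \<noteq> 0} \<inter> S) = {v \<in> V. P v \<noteq> 0}"
    using V by auto
  ultimately show ?thesis by simp
qed

lemma zar_embedded: "zar (embedded_space n S) = subtopology (zariski_topology n) S"
  by (simp add: embedded_space_def)

lemma regf_embedded_iff: "f \<in> regf (embedded_space n S) U \<longleftrightarrow>
  (\<forall>x\<in>U. \<exists>V. openin (zar (embedded_space n S)) V \<and> x \<in> V \<and> V \<subseteq> U \<and>
    (\<exists>P\<in>polyfun n. \<exists>Q\<in>polyfun n. \<forall>y\<in>V. Q y \<noteq> 0 \<and> f y = P y / Q y))"
  by (simp add: embedded_space_def)

lemma regf_embeddedI: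
  assumes "\<And>x. x \<in> U \<Longrightarrow> \<exists>V P Q. openin (zar (embedded_space n S)) V \<and> x \<in> V \<and> V \<subseteq> U \<and>
    P \<in> polyfun n \<and> Q \<in> polyfun n \<and> (\<forall>y\<in>V. Q y \<noteq> 0 \<and> f y = P y / Q y)"
  shows "f \<in> regf (embedded_space n S) U"
  unfolding regf_embedded_iff
proof
  fix x assume "x \<in> U"
  from assms[OF this] obtain V P Q where V: "openin (zar (embedded_space n S)) V" "x \<in> V" "V \<subseteq> U"
    "P \<in> polyfun n" "Q \<in> polyfun n" "\<forall>y\<in>V. Q y \<noteq> 0 \<and> f y = P y / Q y"
    by (elim exE conjE)
  show "\<exists>V. openin (zar (embedded_space n S)) V \<and> x \<in> V \<and> V \<subseteq> U \<and>
    (\<exists>P\<in>polyfun n. \<exists>Q\<in>polyfun n. \<forall>y\<in>V. Q y \<noteq> 0 \<and> f y = P y / Q y)"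
    by (rule exI[of _ V], intro conjI bexI[of _ P] bexI[of _ Q]) (use V in simp_all)
qed

lemma regf_embeddedD:
  assumes "f \<in> regf (embedded_space n S) U" "x \<in> U"
  shows "\<exists>V P Q. openin (zar (embedded_space n S)) V \<and> x \<in> V \<and> V \<subseteq> U \<and>
    P \<in> polyfun n \<and> Q \<in> polyfun n \<and> (\<forall>y\<in>V. Q y \<noteq> 0 \<and> f y = P y / Q y)"
proof -
  from bspec[OF assms(1)[unfolded regf_embedded_iff] assms(2)]
  obtain V P Q where V: "openin (zar (embedded_space n S)) V" "x \<in> V" "V \<subseteq> U"
    "P \<in> polyfun n" "Q \<in> polyfun n" "\<forall>y\<in>V. Q y \<noteq> 0 \<and> f y = P y / Q y"
    by (elim exE conjE bexE)
  show ?thesis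
    by (intro exI[of _ V] exI[of _ P] exI[of _ Q] conjI) (use V in simp_all)
qed

lemma space_with_functions_embedded:
  fixes S :: "'k::field vec set"
  shows "space_with_functions (embedded_space n S)"
  unfolding space_with_functions_def
proof (intro conjI allI impI ballI)
  let ?E = "embedded_space n S"
  fix U :: "'k vec set" and c assume "openin (zar ?E) U"
  then show "(\<lambda>_. c) \<in> regf ?E U"
    by (intro regf_embeddedI exI[of _ U] exI[of _ "\<lambda>_. c"] exI[of _ "\<lambda>_. 1"]) (auto intro: polyfun.const)
next
  let ?E = "embedded_space n S"
  fix U :: "'k vec set" and f g assume U: "openin (zar ?E) U" and f: "f \<in> regf ?E U" and g: "g \<in> regf ?E U"
  have *: "\<exists>V P Q P' Q'. openin (zar ?E) V \<and> x \<in> V \<and> V \<subseteq> U \<and> P \<in> polyfun n \<and> Q \<in> polyfun n \<and>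
     P' \<in> polyfun n \<and> Q' \<in> polyfun n \<and> (\<forall>y\<in>V. Q y \<noteq> 0 \<and> Q' y \<noteq> 0 \<and> f y = P y / Q y \<and> g y = P' y / Q' y)"
    if x: "x \<in> U" for x
  proof -
    obtain V P Q where 1: "openin (zar ?E) V" "x \<in> V" "V \<subseteq> U"
      "P \<in> polyfun n" "Q \<in> polyfun n" "\<forall>y\<in>V. Q y \<noteq> 0 \<and> f y = P y / Q y"
      using regf_embeddedD[OF f x] by (elim exE conjE)
    obtain V' P' Q' where 2: "openin (zar ?E) V'" "x \<in> V'" "V' \<subseteq> U"
      "P' \<in> polyfun n" "Q' \<in> polyfun n" "\<forall>y\<in>V'. Q' y \<noteq> 0 \<and> g y = P' y / Q' y"
      using regf_embeddedD[OF g x] by (elim exE conjE)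
    have "V \<inter> V' \<subseteq> U" using 1(3) by blast
    moreover have "\<forall>y\<in>V \<inter> V'. Q y \<noteq> 0 \<and> Q' y \<noteq> 0 \<and> f y = P y / Q y \<and> g y = P' y / Q' y"
      using 1(6) 2(6) by blast
    ultimately show ?thesis
      using openin_Int[OF 1(1) 2(1)] 1(2,4,5) 2(2,4,5)
      by (intro exI[of _ "V \<inter> V'"] exI[of _ P] exI[of _ Q] exI[of _ P'] exI[of _ Q'] conjI) simp_all
  qed
  show "(\<lambda>x. f x + g x) \<in> regf ?E U"
  proof (rule regf_embeddedI)
    fix x assume "x \<in> U"
    from *[OF this] obtain V P Q P' Q' where "openin (zar ?E) V" "x \<in> V" "V \<subseteq> U" "P \<in> polyfun n" "Q \<in> polyfun n"
     "P' \<in> polyfun n" "Q' \<in> polyfun n" "\<forall>y\<in>V. Q y \<noteq> 0 \<and> Q' y \<noteq> 0 \<and> f y = P y / Q y \<and> g y = P' y / Q' y"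
      by (elim exE conjE)
    then show "\<exists>V P Q. openin (zar ?E) V \<and> x \<in> V \<and> V \<subseteq> U \<and> P \<in> polyfun n \<and> Q \<in> polyfun n \<and>
        (\<forall>y\<in>V. Q y \<noteq> 0 \<and> f y + g y = P y / Q y)"
      by (intro exI[of _ V] exI[of _ "\<lambda>v. P v * Q' v + P' v * Q v"] exI[of _ "\<lambda>v. Q v * Q' v"] conjI ballI)
        (simp_all add: polyfun.add polyfun.mult add_frac_eq)
  qed
  show "(\<lambda>x. f x * g x) \<in> regf ?E U"
  proof (rule regf_embeddedI)
    fix x assume "x \<in> U"
    from *[OF this] obtain V P Q P' Q' where "openin (zar ?E) V" "x \<in> V" "V \<subseteq> U" "P \<in> polyfun n" "Q \<in> polyfun n"
     "P' \<in> polyfun n" "Q' \<in> polyfun n" "\<forall>y\<in>V. Q y \<noteq> 0 \<and> Q' y \<noteq> 0 \<and> f y = P y / Q y \<and> g y = P' y / Q' y"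
      by (elim exE conjE)
    then show "\<exists>V P Q. openin (zar ?E) V \<and> x \<in> V \<and> V \<subseteq> U \<and> P \<in> polyfun n \<and> Q \<in> polyfun n \<and>
        (\<forall>y\<in>V. Q y \<noteq> 0 \<and> f y * g y = P y / Q y)"
      by (intro exI[of _ V] exI[of _ "\<lambda>v. P v * P' v"] exI[of _ "\<lambda>v. Q v * Q' v"] conjI ballI)
        (simp_all add: polyfun.mult)
  qed
next
  let ?E = "embedded_space n S"
  fix U V :: "'k vec set" and f assume *: "openin (zar ?E) U \<and> openin (zar ?E) V \<and> V \<subseteq> U \<and> f \<in> regf ?E U"
  show "f \<in> regf ?E V"
  proof (rule regf_embeddedI)
    fix x assume x: "x \<in> V"
    then have "x \<in> U" using * by blast
    from regf_embeddedD[OF conjunct2[OF conjunct2[OF conjunct2[OF *]]] this] obtain W P Q where "openin (zar ?E) W" "x \<in> W" "W \<subseteq> U"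
      "P \<in> polyfun n" "Q \<in> polyfun n" "\<forall>y\<in>W. Q y \<noteq> 0 \<and> f y = P y / Q y"
      by (elim exE conjE)
    then show "\<exists>V' P Q. openin (zar ?E) V' \<and> x \<in> V' \<and> V' \<subseteq> V \<and> P \<in> polyfun n \<and> Q \<in> polyfun n \<and>
        (\<forall>y\<in>V'. Q y \<noteq> 0 \<and> f y = P y / Q y)"
      using x * by (intro exI[of _ "W \<inter> V"] exI[of _ P] exI[of _ Q]) (simp add: openin_Int)
  qed
next
  let ?E = "embedded_space n S"
  fix \<U> :: "'k vec set set" and f assume *: "\<forall>U\<in>\<U>. openin (zar ?E) U \<and> f \<in> regf ?E U"
  show "f \<in> regf ?E (\<Union>\<U>)"
  proof (rule regf_embeddedI)
    fix x assume "x \<in> \<Union>\<U>"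
    then obtain U where U: "U \<in> \<U>" "x \<in> U" by blast
    then have "f \<in> regf ?E U" using * by blast
    from regf_embeddedD[OF this U(2)] obtain W P Q where "openin (zar ?E) W" "x \<in> W" "W \<subseteq> U"
      "P \<in> polyfun n" "Q \<in> polyfun n" "\<forall>y\<in>W. Q y \<noteq> 0 \<and> f y = P y / Q y"
      by (elim exE conjE)
    then show "\<exists>V P Q. openin (zar ?E) V \<and> x \<in> V \<and> V \<subseteq> \<Union>\<U> \<and> P \<in> polyfun n \<and> Q \<in> polyfun n \<and>
        (\<forall>y\<in>V. Q y \<noteq> 0 \<and> f y = P y / Q y)"
      using U(1) by (intro exI[of _ W] exI[of _ P] exI[of _ Q]) auto
  qed
next
  let ?E = "embedded_space n S"
  fix U :: "'k vec set" and f g assume *: "openin (zar ?E) U \<and> f \<in> regf ?E U \<and> (\<forall>x\<in>U. f x = g x)"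
  show "g \<in> regf ?E U"
  proof (rule regf_embeddedI)
    fix x assume x: "x \<in> U"
    from regf_embeddedD[OF conjunct1[OF conjunct2[OF *]] this] obtain W P Q where "openin (zar ?E) W" "x \<in> W" "W \<subseteq> U"
      "P \<in> polyfun n" "Q \<in> polyfun n" "\<forall>y\<in>W. Q y \<noteq> 0 \<and> f y = P y / Q y"
      by (elim exE conjE)
    moreover have "\<forall>y\<in>W. f y = g y" using * \<open>W \<subseteq> U\<close> by blast
    ultimately show "\<exists>V P Q. openin (zar ?E) V \<and> x \<in> V \<and> V \<subseteq> U \<and> P \<in> polyfun n \<and> Q \<in> polyfun n \<and>
        (\<forall>y\<in>V. Q y \<noteq> 0 \<and> g y = P y / Q y)"
      by (intro exI[of _ W] exI[of _ P] exI[of _ Q]) auto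
  qed
qed

text \<open>A chart identifies an open set with a closed subset of affine space; \<open>c\<close> are the
  pulled back coordinates.\<close>

definition chart :: "('p, 'k::field) fspace \<Rightarrow> 'p set \<Rightarrow> nat \<Rightarrow> (nat \<Rightarrow> 'p \<Rightarrow> 'k) \<Rightarrow> bool" where
  "chart X U N c \<longleftrightarrow> openin (zar X) U \<and>
    (\<forall>y\<in>U. \<forall>z\<in>U. (\<forall>i<N. c i y = c i z) \<longrightarrow> y = z) \<and>
    (\<forall>P\<in>polyfun N. openin (zar X) {y \<in> U. P (Matrix.vec N (\<lambda>i. c i y)) \<noteq> 0}) \<and>
    (\<forall>P\<in>polyfun N. \<forall>Q\<in>polyfun N. (\<lambda>y. P (Matrix.vec N (\<lambda>i. c i y)) / Q (Matrix.vec N (\<lambda>i. c i y)))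
       \<in> regf X {y \<in> U. Q (Matrix.vec N (\<lambda>i. c i y)) \<noteq> 0}) \<and>
    (\<forall>W f z. openin (zar X) W \<longrightarrow> W \<subseteq> U \<longrightarrow> z \<in> W \<longrightarrow> f \<in> regf X W \<longrightarrow>
      (\<exists>V P Q. openin (zar X) V \<and> z \<in> V \<and> V \<subseteq> W \<and> P \<in> polyfun N \<and> Q \<in> polyfun N \<and>
        (\<forall>y\<in>V. Q (Matrix.vec N (\<lambda>i. c i y)) \<noteq> 0 \<and>
          f y = P (Matrix.vec N (\<lambda>i. c i y)) / Q (Matrix.vec N (\<lambda>i. c i y)))))"

lemma chart_affine_variety:
  assumes U: "openin (zar X) U" and aff: "affine_variety (open_subspace X U)"
  shows "\<exists>N c. chart X U N c"
proof -
  from aff obtain n S \<alpha> \<beta> where S: "closedin (zariski_topology n) S"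
    and \<alpha>: "morphism (open_subspace X U) (embedded_space n S) \<alpha>"
    and \<beta>: "morphism (embedded_space n S) (open_subspace X U) \<beta>"
    and inv: "\<forall>x\<in>points (open_subspace X U). \<beta> (\<alpha> x) = x"
    unfolding affine_variety_def isomorphic_def by (elim exE conjE)
  let ?E = "embedded_space n S"
  have SE: "S \<subseteq> carrier_vec n" using closedin_subset[OF S] by (simp add: topspace_zariski)
  have ptsU: "points (open_subspace X U) = U"
    using openin_subset[OF U] by (auto simp: open_subspace_def)
  have ptsE: "points ?E = S"
    using SE by (auto simp: zar_embedded topspace_zariski)
  have zarU: "openin (zar (open_subspace X U)) W \<longleftrightarrow> openin (zar X) W \<and> W \<subseteq> U" for W
    using openin_open_subtopology[OF U] by (simp add: open_subspace_def)
  have regU: "regf (open_subspace X U) = regf X" by (simp add: open_subspace_def)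
  have cont: "continuous_map (zar (open_subspace X U)) (zar ?E) \<alpha>"
    using \<alpha> by (simp add: morphism_def)
  have \<alpha>S: "\<alpha> y \<in> S" if "y \<in> U" for y
    using continuous_map_image_subset_topspace[OF cont] that ptsU ptsE by auto
  have pre: "openin (zar X) {y \<in> U. \<alpha> y \<in> V}" if "openin (zar ?E) V" for V
    using openin_continuous_map_preimage[OF cont that] by (simp add: ptsU zarU)
  define c where "c = (\<lambda>i y. \<alpha> y $ i)"
  have vec: "Matrix.vec n (\<lambda>i. c i y) = \<alpha> y" if "y \<in> U" for y
    using \<alpha>S[OF that] SE by (intro eq_vecI) (auto simp: c_def)
  have nonv: "openin (zar ?E) {v \<in> S. P v \<noteq> 0}" if "P \<in> polyfun n" for P
    using openin_embedded_nonvanishing[of n S S P] that openin_topspace[of "zar ?E"]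
    by (simp add: zar_embedded[symmetric] ptsE)
  have set_eq: "{y \<in> U. P (Matrix.vec n (\<lambda>i. c i y)) \<noteq> 0} = {y \<in> U. \<alpha> y \<in> {v \<in> S. P v \<noteq> 0}}" for P
    using vec \<alpha>S by auto
  have "chart X U n c"
    unfolding chart_def
  proof (intro conjI ballI allI impI)
    show "openin (zar X) U" by (rule U)
    show "y = z" if "y \<in> U" "z \<in> U" "\<forall>i<n. c i y = c i z" for y z
    proof -
      have "\<alpha> y = \<alpha> z"
        unfolding vec[OF that(1), symmetric] vec[OF that(2), symmetric] using that(3) by (intro eq_vecI) auto
      then have "\<beta> (\<alpha> y) = \<beta> (\<alpha> z)" by simp
      then show ?thesis using inv that(1,2) by (simp add: ptsU)
    qed
    show "openin (zar X) {y \<in> U. P (Matrix.vec n (\<lambda>i. c i y)) \<noteq> 0}" if "P \<in> polyfun n" for P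
      unfolding set_eq by (rule pre[OF nonv[OF that]])
    show "(\<lambda>y. P (Matrix.vec n (\<lambda>i. c i y)) / Q (Matrix.vec n (\<lambda>i. c i y)))
       \<in> regf X {y \<in> U. Q (Matrix.vec n (\<lambda>i. c i y)) \<noteq> 0}" if P: "P \<in> polyfun n" and Q: "Q \<in> polyfun n" for P Q
    proof -
      have "(\<lambda>v. P v / Q v) \<in> regf ?E {v \<in> S. Q v \<noteq> 0}"
        using nonv[OF Q] P Q by (intro regf_embeddedI exI[of _ "{v \<in> S. Q v \<noteq> 0}"] exI[of _ P] exI[of _ Q]) auto
      then have "(\<lambda>v. P v / Q v) \<circ> \<alpha> \<in> regf X {y \<in> U. \<alpha> y \<in> {v \<in> S. Q v \<noteq> 0}}"
        using morphism_comp[OF \<alpha> nonv[OF Q]] unfolding ptsU regU by simp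
      moreover have "(\<lambda>v. P v / Q v) \<circ> \<alpha> = (\<lambda>y. P (Matrix.vec n (\<lambda>i. c i y)) / Q (Matrix.vec n (\<lambda>i. c i y)))"
      proof
        fix y
        have "P (\<alpha> y) = P (Matrix.vec n (\<lambda>i. c i y))" "Q (\<alpha> y) = Q (Matrix.vec n (\<lambda>i. c i y))"
          by (rule polyfun_vec_cong[OF P] polyfun_vec_cong[OF Q]; simp add: c_def)+
        then show "((\<lambda>v. P v / Q v) \<circ> \<alpha>) y = P (Matrix.vec n (\<lambda>i. c i y)) / Q (Matrix.vec n (\<lambda>i. c i y))"
          by simp
      qed
      ultimately show ?thesis unfolding set_eq by simp
    qed
    show "\<exists>V P Q. openin (zar X) V \<and> z \<in> V \<and> V \<subseteq> W \<and> P \<in> polyfun n \<and> Q \<in> polyfun n \<and>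
        (\<forall>y\<in>V. Q (Matrix.vec n (\<lambda>i. c i y)) \<noteq> 0 \<and>
          f y = P (Matrix.vec n (\<lambda>i. c i y)) / Q (Matrix.vec n (\<lambda>i. c i y)))"
      if W: "openin (zar X) W" "W \<subseteq> U" "z \<in> W" "f \<in> regf X W" for W f z
    proof -
      have "f \<circ> \<beta> \<in> regf ?E {v \<in> S. \<beta> v \<in> W}"
        using morphism_comp[OF \<beta>, of W f] W zarU unfolding ptsE regU by simp
      moreover have zU: "z \<in> U" using W by blast
      then have "\<alpha> z \<in> {v \<in> S. \<beta> v \<in> W}"
        using \<alpha>S inv W(3) ptsU by auto
      ultimately have "\<exists>V P Q. openin (zar ?E) V \<and> \<alpha> z \<in> V \<and> V \<subseteq> {v \<in> S. \<beta> v \<in> W} \<and>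
        P \<in> polyfun n \<and> Q \<in> polyfun n \<and> (\<forall>y\<in>V. Q y \<noteq> 0 \<and> (f \<circ> \<beta>) y = P y / Q y)"
        by (rule regf_embeddedD)
      then obtain V P Q where V: "openin (zar ?E) V" "\<alpha> z \<in> V" "V \<subseteq> {v \<in> S. \<beta> v \<in> W}"
        and PQ: "P \<in> polyfun n" "Q \<in> polyfun n" "\<forall>y\<in>V. Q y \<noteq> 0 \<and> (f \<circ> \<beta>) y = P y / Q y"
        by (elim exE conjE)
      have inv': "\<beta> (\<alpha> y) = y" if "y \<in> U" for y using inv that ptsU by blast
      have "{y \<in> U. \<alpha> y \<in> V} \<subseteq> W"
      proof
        fix y assume "y \<in> {y \<in> U. \<alpha> y \<in> V}"
        then have "y \<in> U" "\<beta> (\<alpha> y) \<in> W" using V(3) by auto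
        then show "y \<in> W" using inv' by simp
      qed
      moreover have "Q (Matrix.vec n (\<lambda>i. c i y)) \<noteq> 0 \<and> f y = P (Matrix.vec n (\<lambda>i. c i y)) / Q (Matrix.vec n (\<lambda>i. c i y))"
        if "y \<in> {y \<in> U. \<alpha> y \<in> V}" for y
        using bspec[OF PQ(3), of "\<alpha> y"] that vec[of y] inv'[of y] by simp
      ultimately show ?thesis
        using pre[OF V(1)] V(2) zU PQ(1,2)
        by (intro exI[of _ "{y \<in> U. \<alpha> y \<in> V}"] exI[of _ P] exI[of _ Q]) simp
    qed
  qed
  then show ?thesis by blast
qed

lemma prevariety_chart:
  assumes "prevariety X" "x \<in> points X"
  obtains U N c where "x \<in> U" "chart X U N c"
proof -
  from assms(1) obtain \<U> where \<U>: "\<Union>\<U> = points X" "\<forall>U\<in>\<U>. openin (zar X) U \<and> affine_variety (open_subspace X U)"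
    unfolding prevariety_def by (elim exE conjE)
  from \<U>(1) assms(2) obtain U where U: "U \<in> \<U>" "x \<in> U" by (metis UnionE)
  with \<U>(2) obtain N c where "chart X U N c" using chart_affine_variety[of X U] by auto
  then show ?thesis using that U(2) by blast
qed

lemma chart_open: "chart X U N c \<Longrightarrow> openin (zar X) U"
  by (simp add: chart_def)

lemma chart_separates: "chart X U N c \<Longrightarrow> y \<in> U \<Longrightarrow> z \<in> U \<Longrightarrow> (\<And>i. i < N \<Longrightarrow> c i y = c i z) \<Longrightarrow> y = z"
  by (simp add: chart_def)

lemma chart_nonvanishing: "chart X U N c \<Longrightarrow> P \<in> polyfun N \<Longrightarrow>
  openin (zar X) {y \<in> U. P (Matrix.vec N (\<lambda>i. c i y)) \<noteq> 0}"
  by (simp add: chart_def)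

lemma chart_quotient: "chart X U N c \<Longrightarrow> P \<in> polyfun N \<Longrightarrow> Q \<in> polyfun N \<Longrightarrow>
  (\<lambda>y. P (Matrix.vec N (\<lambda>i. c i y)) / Q (Matrix.vec N (\<lambda>i. c i y)))
     \<in> regf X {y \<in> U. Q (Matrix.vec N (\<lambda>i. c i y)) \<noteq> 0}"
  by (simp add: chart_def)

lemma chart_local:
  assumes "chart X U N c" "openin (zar X) W" "W \<subseteq> U" "z \<in> W" "f \<in> regf X W"
  shows "\<exists>V P Q. openin (zar X) V \<and> z \<in> V \<and> V \<subseteq> W \<and> P \<in> polyfun N \<and> Q \<in> polyfun N \<and>
        (\<forall>y\<in>V. Q (Matrix.vec N (\<lambda>i. c i y)) \<noteq> 0 \<and>
          f y = P (Matrix.vec N (\<lambda>i. c i y)) / Q (Matrix.vec N (\<lambda>i. c i y)))"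
  using assms unfolding chart_def by simp

lemma chart_coord:
  assumes "space_with_functions X" "chart X U N c" "i < N"
  shows "c i \<in> regf X U"
proof -
  have "(\<lambda>y. Matrix.vec N (\<lambda>i. c i y) $ i / 1) \<in> regf X {y \<in> U. (1::'b) \<noteq> 0}"
    using chart_quotient[OF assms(2) polyfun.coord[OF assms(3)] polyfun.const[of 1 N]] .
  then show ?thesis
    using assms(3) by simp
qed

text \<open>In a chart a regular function is locally a quotient P/Q, and where P does not vanish Q/P
  is regular.\<close>

lemma regular_space_prevariety:
  assumes X: "prevariety X"
  shows "regular_space X"
proof -
  have swf: "space_with_functions X" using X by (simp add: prevariety_def)
  have *: "\<exists>V. openin (zar X) V \<and> x \<in> V \<and> V \<subseteq> {x \<in> W. f x \<noteq> 0} \<and> (\<lambda>x. inverse (f x)) \<in> regf X V"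
    if W: "openin (zar X) W" "f \<in> regf X W" and x: "x \<in> W" "f x \<noteq> 0" for W f x
  proof -
    have "x \<in> points X" using openin_subset[OF W(1)] x(1) by blast
    then obtain U N c where U: "x \<in> U" "chart X U N c" by (rule prevariety_chart[OF X])
    have WU: "openin (zar X) (W \<inter> U)" using W(1) chart_open[OF U(2)] by (rule openin_Int)
    have "f \<in> regf X (W \<inter> U)" using regf_subset[OF swf W(1) WU _ W(2)] by blast
    from chart_local[OF U(2) WU _ _ this, of x] x(1) U(1)
    have "\<exists>V P Q. openin (zar X) V \<and> x \<in> V \<and> V \<subseteq> W \<inter> U \<and> P \<in> polyfun N \<and> Q \<in> polyfun N \<and>
        (\<forall>y\<in>V. Q (Matrix.vec N (\<lambda>i. c i y)) \<noteq> 0 \<and>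
          f y = P (Matrix.vec N (\<lambda>i. c i y)) / Q (Matrix.vec N (\<lambda>i. c i y)))"
      by simp
    then obtain V P Q where V: "openin (zar X) V" "x \<in> V" "V \<subseteq> W \<inter> U" "P \<in> polyfun N" "Q \<in> polyfun N"
      "\<forall>y\<in>V. Q (Matrix.vec N (\<lambda>i. c i y)) \<noteq> 0 \<and>
          f y = P (Matrix.vec N (\<lambda>i. c i y)) / Q (Matrix.vec N (\<lambda>i. c i y))"
      by (elim exE conjE)
    let ?V = "V \<inter> {y \<in> U. P (Matrix.vec N (\<lambda>i. c i y)) \<noteq> 0}"
    have op: "openin (zar X) ?V"
      using V(1) chart_nonvanishing[OF U(2) V(4)] by (rule openin_Int)
    have "(\<lambda>y. Q (Matrix.vec N (\<lambda>i. c i y)) / P (Matrix.vec N (\<lambda>i. c i y))) \<in> regf X ?V"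
      using chart_quotient[OF U(2) V(5) V(4)] by (rule regf_subset[OF swf chart_nonvanishing[OF U(2) V(4)] op, rotated]) blast
    then have "(\<lambda>x. inverse (f x)) \<in> regf X ?V"
      by (rule regf_cong[OF swf op]) (use V(6) in auto)
    moreover have "?V \<subseteq> {x \<in> W. f x \<noteq> 0}" using V(3,6) by auto
    moreover have "x \<in> ?V" using V(2,3,6) x by auto
    ultimately show ?thesis using op by blast
  qed
  show ?thesis
    unfolding regular_space_def
  proof (intro conjI allI impI swf)
    fix U f assume "openin (zar X) U \<and> f \<in> regf X U"
    note * = *[OF conjunct1[OF this] conjunct2[OF this]]
    show "openin (zar X) {x \<in> U. f x \<noteq> 0}"
      by (subst openin_subopen) (use * in blast)
    show "(\<lambda>x. inverse (f x)) \<in> regf X {x \<in> U. f x \<noteq> 0}"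
      by (rule regf_local[OF swf]) (use * in blast)
  qed
qed

lemma regular_space_embedded: "regular_space (embedded_space n S)"
proof -
  let ?E = "embedded_space n S"
  note swf = space_with_functions_embedded[of n S]
  have *: "\<exists>V P Q. openin (zar ?E) V \<and> x \<in> V \<and> V \<subseteq> {x \<in> U. f x \<noteq> 0} \<and> P \<in> polyfun n \<and> Q \<in> polyfun n \<and>
      (\<forall>y\<in>V. Q y \<noteq> 0 \<and> inverse (f y) = P y / Q y)"
    if U: "f \<in> regf ?E U" and x: "x \<in> U" "f x \<noteq> 0" for U f x
  proof -
    obtain V P Q where V: "openin (zar ?E) V" "x \<in> V" "V \<subseteq> U"
      "P \<in> polyfun n" "Q \<in> polyfun n" "\<forall>y\<in>V. Q y \<noteq> 0 \<and> f y = P y / Q y"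
      using regf_embeddedD[OF U x(1)] by (elim exE conjE)
    have "openin (zar ?E) {v \<in> V. P v \<noteq> 0}"
      using openin_embedded_nonvanishing V(1,4) unfolding zar_embedded by blast
    moreover have "x \<in> {v \<in> V. P v \<noteq> 0}" using V(2,6) x(2) by auto
    moreover have "{v \<in> V. P v \<noteq> 0} \<subseteq> {x \<in> U. f x \<noteq> 0}" using V(3,6) by auto
    ultimately show ?thesis
      using V(4,5,6) by (intro exI[of _ "{v \<in> V. P v \<noteq> 0}"] exI[of _ Q] exI[of _ P]) simp
  qed
  show ?thesis
    unfolding regular_space_def
  proof (intro conjI allI impI swf)
    fix U f assume "openin (zar ?E) U \<and> f \<in> regf ?E U"
    note * = *[OF conjunct2[OF this]]
    show "openin (zar ?E) {x \<in> U. f x \<noteq> 0}"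
    proof (subst openin_subopen, intro ballI)
      fix x assume "x \<in> {x \<in> U. f x \<noteq> 0}"
      then show "\<exists>T. openin (zar ?E) T \<and> x \<in> T \<and> T \<subseteq> {x \<in> U. f x \<noteq> 0}" using *[of x] by blast
    qed
    show "(\<lambda>x. inverse (f x)) \<in> regf ?E {x \<in> U. f x \<noteq> 0}"
      by (rule regf_embeddedI) (use * in simp)
  qed
qed

section \<open>Rational maps\<close>

text \<open>Irreducibility in the form in which it is applied: domains of finitely many
  representatives have a nonempty common part on which they can be compared.\<close>

locale irred_space =
  fixes X :: "('p, 'k::field) fspace"
  assumes regular: "regular_space X"
    and points_nonempty: "points X \<noteq> {}"
    and meet: "openin (zar X) U \<Longrightarrow> openin (zar X) V \<Longrightarrow> U \<noteq> {} \<Longrightarrow> V \<noteq> {} \<Longrightarrow> U \<inter> V \<noteq> {}"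

lemma irred_space_variety:
  assumes "irreducible_variety X"
  shows "irred_space X"
proof
  show "regular_space X"
    using assms regular_space_prevariety unfolding irreducible_variety_def variety_def by auto
  show "points X \<noteq> {}" using assms by (simp add: irreducible_variety_def)
  fix U V assume *: "openin (zar X) U" "openin (zar X) V" "U \<noteq> {}" "V \<noteq> {}"
  have sub: "U \<subseteq> points X" "V \<subseteq> points X" using * openin_subset by auto
  have irr: "\<forall>A B. closedin (zar X) A \<and> closedin (zar X) B \<and> A \<union> B = points X \<longrightarrow> A = points X \<or> B = points X"
    using assms by (simp add: irreducible_variety_def)
  show "U \<inter> V \<noteq> {}"
  proof
    assume "U \<inter> V = {}"
    then have "(points X - U) \<union> (points X - V) = points X" using sub by blast
    moreover have "closedin (zar X) (points X - U)" "closedin (zar X) (points X - V)"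
      using * by auto
    ultimately have "points X - U = points X \<or> points X - V = points X"
      using irr[THEN spec, THEN spec, of "points X - U" "points X - V"] by simp
    then show False using sub *(3,4) by blast
  qed
qed

lemma zar_affine: "zar (affine_space n) = zariski_topology n"
proof -
  have "subtopology (zariski_topology n) (topspace (zariski_topology n)) = zariski_topology n"
    by (rule subtopology_topspace)
  then show ?thesis by (simp add: affine_space_def zar_embedded topspace_zariski)
qed

lemma points_affine: "points (affine_space n) = carrier_vec n"
  by (simp add: zar_affine topspace_zariski)

lemma openin_affine_basic:
  assumes "openin (zariski_topology n) U" "v \<in> U"
  obtains P where "P \<in> polyfun n" "P v \<noteq> 0" "{w \<in> carrier_vec n. P w \<noteq> 0} \<subseteq> U"
proof -
  from assms(1) obtain F where F: "F \<subseteq> polyfun n" "U = {v \<in> carrier_vec n. \<exists>P\<in>F. P v \<noteq> 0}"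
    unfolding openin_zariski by (elim exE conjE)
  then obtain P where "P \<in> F" "P v \<noteq> 0" using assms(2) by blast
  then show ?thesis using F by (intro that[of P]) auto
qed

lemma irred_space_affine: "irred_space (affine_space n :: ('k::field_char_0 vec, 'k) fspace)"
proof
  show "regular_space (affine_space n :: ('k vec, 'k) fspace)"
    unfolding affine_space_def by (rule regular_space_embedded)
  show "points (affine_space n :: ('k vec, 'k) fspace) \<noteq> {}"
    using zero_carrier_vec[of n] by (auto simp: points_affine simp del: zero_carrier_vec)
  fix U V :: "'k vec set"
  assume *: "openin (zar (affine_space n)) U" "openin (zar (affine_space n)) V" "U \<noteq> {}" "V \<noteq> {}"
  then obtain a b where ab: "a \<in> U" "b \<in> V" by blast
  have sub: "U \<subseteq> carrier_vec n" "V \<subseteq> carrier_vec n"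
    using openin_subset[OF *(1)] openin_subset[OF *(2)] by (simp_all add: points_affine)
  obtain P where P: "P \<in> polyfun n" "P a \<noteq> 0" "{w \<in> carrier_vec n. P w \<noteq> 0} \<subseteq> U"
    using *(1) ab(1) unfolding zar_affine by (rule openin_affine_basic)
  obtain Q where Q: "Q \<in> polyfun n" "Q b \<noteq> 0" "{w \<in> carrier_vec n. Q w \<noteq> 0} \<subseteq> V"
    using *(2) ab(2) unfolding zar_affine by (rule openin_affine_basic)
  have "a \<in> carrier_vec n" "b \<in> carrier_vec n" using ab sub by auto
  then obtain c where "c \<in> carrier_vec n" "P c \<noteq> 0" "Q c \<noteq> 0"
    using polyfun_nonzero_mult[of P n a Q b] P(1,2) Q(1,2) by blast
  then show "U \<inter> V \<noteq> {}" using P(3) Q(3) by blast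
qed

section \<open>Rational maps through representatives\<close>

lemma rat_reps_iff: "(U, f) \<in> rat_reps X Y \<longleftrightarrow> openin (zar X) U \<and> U \<noteq> {} \<and>
  (\<forall>x\<in>U. f x \<in> points Y) \<and>
  (\<forall>V. openin (zar Y) V \<longrightarrow> openin (zar X) {x \<in> U. f x \<in> V}) \<and>
  (\<forall>V h. openin (zar Y) V \<longrightarrow> h \<in> regf Y V \<longrightarrow> h \<circ> f \<in> regf X {x \<in> U. f x \<in> V})"
proof -
  have "morphism (open_subspace X U) Y f \<longleftrightarrow> (\<forall>x\<in>U. f x \<in> points Y) \<and>
    (\<forall>V. openin (zar Y) V \<longrightarrow> openin (zar X) {x \<in> U. f x \<in> V}) \<and>
    (\<forall>V h. openin (zar Y) V \<longrightarrow> h \<in> regf Y V \<longrightarrow> h \<circ> f \<in> regf X {x \<in> U. f x \<in> V})"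
    if U: "openin (zar X) U"
  proof -
    have top: "points X \<inter> U = U" using openin_subset[OF U] by auto
    have sub: "{x \<in> U. f x \<in> V} \<subseteq> U" for V by blast
    show ?thesis
      unfolding morphism_def continuous_map_def open_subspace_def
      by (simp add: top openin_open_subtopology[OF U] sub Pi_iff imp_conjL)
  qed
  then show ?thesis unfolding rat_reps_def by auto
qed

lemma rat_reps_open: "(U, f) \<in> rat_reps X Y \<Longrightarrow> openin (zar X) U"
  and rat_reps_nonempty: "(U, f) \<in> rat_reps X Y \<Longrightarrow> U \<noteq> {}"
  and rat_reps_points: "(U, f) \<in> rat_reps X Y \<Longrightarrow> x \<in> U \<Longrightarrow> f x \<in> points Y"
  and rat_reps_preimage: "(U, f) \<in> rat_reps X Y \<Longrightarrow> openin (zar Y) V \<Longrightarrow> openin (zar X) {x \<in> U. f x \<in> V}"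
  and rat_reps_regf: "(U, f) \<in> rat_reps X Y \<Longrightarrow> openin (zar Y) V \<Longrightarrow> h \<in> regf Y V \<Longrightarrow>
    h \<circ> f \<in> regf X {x \<in> U. f x \<in> V}"
  unfolding rat_reps_iff by blast+

lemma rat_reps_comp:
  assumes f: "(U, f) \<in> rat_reps X Y" and g: "(V, g) \<in> rat_reps Y Z" and ne: "{x \<in> U. f x \<in> V} \<noteq> {}"
  shows "({x \<in> U. f x \<in> V}, g \<circ> f) \<in> rat_reps X Z"
  unfolding rat_reps_iff
proof (intro conjI ballI allI impI ne)
  show "openin (zar X) {x \<in> U. f x \<in> V}"
    using rat_reps_preimage[OF f rat_reps_open[OF g]] .
  show "(g \<circ> f) x \<in> points Z" if "x \<in> {x \<in> U. f x \<in> V}" for x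
    using that rat_reps_points[OF g] by simp
  have eq: "{x \<in> {x \<in> U. f x \<in> V}. (g \<circ> f) x \<in> W} = {x \<in> U. f x \<in> {y \<in> V. g y \<in> W}}" for W
    by auto
  show "openin (zar X) {x \<in> {x \<in> U. f x \<in> V}. (g \<circ> f) x \<in> W}" if "openin (zar Z) W" for W
    unfolding eq by (rule rat_reps_preimage[OF f rat_reps_preimage[OF g that]])
  show "h \<circ> (g \<circ> f) \<in> regf X {x \<in> {x \<in> U. f x \<in> V}. (g \<circ> f) x \<in> W}"
    if "openin (zar Z) W" "h \<in> regf Z W" for W h
    unfolding eq comp_assoc[symmetric]
    by (rule rat_reps_regf[OF f rat_reps_preimage[OF g that(1)] rat_reps_regf[OF g that]])
qed

context irred_space
begin

lemma swf: "space_with_functions X"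
  using regular by (simp add: regular_space_def)

lemma openin_nonzero: "openin (zar X) U \<Longrightarrow> f \<in> regf X U \<Longrightarrow> openin (zar X) {x \<in> U. f x \<noteq> 0}"
  and regf_inverse: "openin (zar X) U \<Longrightarrow> f \<in> regf X U \<Longrightarrow> (\<lambda>x. inverse (f x)) \<in> regf X {x \<in> U. f x \<noteq> 0}"
proof -
  have *: "\<forall>U f. openin (zar X) U \<and> f \<in> regf X U \<longrightarrow>
      openin (zar X) {x \<in> U. f x \<noteq> 0} \<and> (\<lambda>x. inverse (f x)) \<in> regf X {x \<in> U. f x \<noteq> 0}"
    using regular unfolding regular_space_def by (rule conjunct2)
  show "openin (zar X) U \<Longrightarrow> f \<in> regf X U \<Longrightarrow> openin (zar X) {x \<in> U. f x \<noteq> 0}"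
    "openin (zar X) U \<Longrightarrow> f \<in> regf X U \<Longrightarrow> (\<lambda>x. inverse (f x)) \<in> regf X {x \<in> U. f x \<noteq> 0}"
    using *[THEN spec, THEN spec, of U f] by simp_all
qed

text \<open>The identity principle: the open set where \<open>f\<close> is nonzero would have to
  meet \<open>W\<close>.\<close>

lemma zero_on_open:
  assumes "openin (zar X) U" "f \<in> regf X U" "openin (zar X) W" "W \<noteq> {}"
    and "\<And>x. x \<in> W \<Longrightarrow> x \<in> U \<Longrightarrow> f x = 0" "x \<in> U"
  shows "f x = 0"
proof (rule ccontr)
  assume "f x \<noteq> 0"
  then have "{x \<in> U. f x \<noteq> 0} \<noteq> {}" using assms(6) by blast
  then have "{x \<in> U. f x \<noteq> 0} \<inter> W \<noteq> {}"
    using meet[OF openin_nonzero[OF assms(1,2)] assms(3) _ assms(4)] by blast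
  then show False using assms(5) by blast
qed

lemma rat_reps_affine:
  assumes U: "openin (zar X) U" "U \<noteq> {}" and h: "\<And>i. i < n \<Longrightarrow> h i \<in> regf X U"
    and H: "\<And>x. x \<in> U \<Longrightarrow> H x = Matrix.vec n (\<lambda>i. h i x)"
  shows "(U, H) \<in> rat_reps X (affine_space n)"
  unfolding rat_reps_iff
proof (intro conjI ballI allI impI U)
  show "H x \<in> points (affine_space n)" if "x \<in> U" for x
    using H[OF that] by (simp add: points_affine)
  have poly: "(\<lambda>x. P (H x)) \<in> regf X U" if "P \<in> polyfun n" for P
    by (rule regf_cong[OF swf U(1) regf_polyfun[OF swf U(1) that h]]) (simp_all add: H)
  show pre: "openin (zar X) {x \<in> U. H x \<in> V}" if V: "openin (zar (affine_space n)) V" for V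
  proof (subst openin_subopen, intro ballI)
    fix x assume x: "x \<in> {x \<in> U. H x \<in> V}"
    then obtain P where P: "P \<in> polyfun n" "P (H x) \<noteq> 0" "{w \<in> carrier_vec n. P w \<noteq> 0} \<subseteq> V"
      using V unfolding zar_affine by (auto elim: openin_affine_basic)
    have "openin (zar X) {x \<in> U. P (H x) \<noteq> 0}"
      by (rule openin_nonzero[OF U(1) poly[OF P(1)]])
    moreover have "{x \<in> U. P (H x) \<noteq> 0} \<subseteq> {x \<in> U. H x \<in> V}"
      using P(3) H by auto
    ultimately show "\<exists>T. openin (zar X) T \<and> x \<in> T \<and> T \<subseteq> {x \<in> U. H x \<in> V}"
      using x P(2) by (intro exI[of _ "{x \<in> U. P (H x) \<noteq> 0}"]) simp
  qed
  show "g \<circ> H \<in> regf X {x \<in> U. H x \<in> V}"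
    if V: "openin (zar (affine_space n)) V" "g \<in> regf (affine_space n) V" for V g
  proof (rule regf_local[OF swf])
    fix x assume x: "x \<in> {x \<in> U. H x \<in> V}"
    then have "H x \<in> V" by simp
    from regf_embeddedD[OF V(2)[unfolded affine_space_def] this, folded affine_space_def]
    obtain W P Q where W: "openin (zar (affine_space n)) W" "H x \<in> W" "W \<subseteq> V"
      and PQ: "P \<in> polyfun n" "Q \<in> polyfun n" "\<forall>y\<in>W. Q y \<noteq> 0 \<and> g y = P y / Q y"
      by (elim exE conjE)
    let ?W = "{x \<in> U. H x \<in> W}"
    have op: "openin (zar X) ?W" by (rule pre[OF W(1)])
    have sub: "?W \<subseteq> U" by blast
    have nz: "{x \<in> U. Q (H x) \<noteq> 0} \<supseteq> ?W" using PQ(3) by auto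
    have "(\<lambda>x. inverse (Q (H x))) \<in> regf X ?W"
      by (rule regf_subset[OF swf openin_nonzero[OF U(1) poly[OF PQ(2)]] op nz regf_inverse[OF U(1) poly[OF PQ(2)]]])
    moreover have "(\<lambda>x. P (H x)) \<in> regf X ?W"
      by (rule regf_subset[OF swf U(1) op sub poly[OF PQ(1)]])
    ultimately have "(\<lambda>x. P (H x) * inverse (Q (H x))) \<in> regf X ?W"
      by (intro regf_mult[OF swf op])
    then have "g \<circ> H \<in> regf X ?W"
      by (rule regf_cong[OF swf op]) (use PQ(3) in \<open>auto simp: divide_inverse\<close>)
    then show "\<exists>T. openin (zar X) T \<and> x \<in> T \<and> T \<subseteq> {x \<in> U. H x \<in> V} \<and> g \<circ> H \<in> regf X T"
      using op x W(2,3) by (intro exI[of _ ?W]) auto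
  qed
qed

lemma rat_eq_iff: "((U, f), (V, g)) \<in> rat_eq X Y \<longleftrightarrow> (U, f) \<in> rat_reps X Y \<and> (V, g) \<in> rat_reps X Y \<and>
     (\<exists>W. openin (zar X) W \<and> W \<noteq> {} \<and> W \<subseteq> U \<inter> V \<and> (\<forall>x\<in>W. f x = g x))"
  unfolding rat_eq_def by (simp only: mem_Collect_eq case_prod_conv)

lemma equiv_rat_eq: "equiv (rat_reps X Y) (rat_eq X Y)"
proof (rule equivI)
  show "refl_on (rat_reps X Y) (rat_eq X Y)"
  proof (rule refl_onI)
    fix a assume a: "a \<in> rat_reps X Y"
    obtain U f where Uf: "a = (U, f)" by (rule prod.exhaust)
    then have "(U, f) \<in> rat_reps X Y" using a by simp
    then show "(a, a) \<in> rat_eq X Y"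
      unfolding Uf rat_eq_iff using rat_reps_open[of U f] rat_reps_nonempty[of U f]
      by (intro conjI exI[of _ U]) simp_all
  qed
  show "sym (rat_eq X Y)"
  proof (rule symI)
    fix a b assume ab: "(a, b) \<in> rat_eq X Y"
    obtain U f where Uf: "a = (U, f)" by (rule prod.exhaust)
    obtain V g where Vg: "b = (V, g)" by (rule prod.exhaust)
    from ab obtain W where W: "(U, f) \<in> rat_reps X Y" "(V, g) \<in> rat_reps X Y"
      "openin (zar X) W" "W \<noteq> {}" "W \<subseteq> U \<inter> V" "\<forall>x\<in>W. f x = g x"
      unfolding Uf Vg rat_eq_iff by (elim conjE exE)
    show "(b, a) \<in> rat_eq X Y"
      unfolding Uf Vg rat_eq_iff by (intro conjI exI[of _ W]) (use W in auto)
  qed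
  show "rat_eq X Y \<subseteq> rat_reps X Y \<times> rat_reps X Y"
  proof
    fix p assume p: "p \<in> rat_eq X Y"
    obtain U f V g where "p = ((U, f), (V, g))" by (metis surj_pair)
    then show "p \<in> rat_reps X Y \<times> rat_reps X Y" using p by (simp add: rat_eq_iff)
  qed
  show "trans (rat_eq X Y)"
  proof (rule transI)
    fix a b c assume ab: "(a, b) \<in> rat_eq X Y" and bc: "(b, c) \<in> rat_eq X Y"
    obtain U f where Uf: "a = (U, f)" by (rule prod.exhaust)
    obtain V g where Vg: "b = (V, g)" by (rule prod.exhaust)
    obtain W h where Wh: "c = (W, h)" by (rule prod.exhaust)
    from ab obtain A where A: "(U, f) \<in> rat_reps X Y"
      "openin (zar X) A" "A \<noteq> {}" "A \<subseteq> U \<inter> V" "\<forall>x\<in>A. f x = g x"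
      unfolding Uf Vg rat_eq_iff by (elim conjE exE)
    from bc obtain B where B: "(W, h) \<in> rat_reps X Y"
      "openin (zar X) B" "B \<noteq> {}" "B \<subseteq> V \<inter> W" "\<forall>x\<in>B. g x = h x"
      unfolding Vg Wh rat_eq_iff by (elim conjE exE)
    have "openin (zar X) (A \<inter> B)" "A \<inter> B \<noteq> {}"
      using meet[OF A(2) B(2) A(3) B(3)] openin_Int[OF A(2) B(2)] by simp_all
    moreover have "A \<inter> B \<subseteq> U \<inter> W" "\<forall>x\<in>A \<inter> B. f x = h x" using A(4,5) B(4,5) by auto
    ultimately show "(a, c) \<in> rat_eq X Y"
      unfolding Uf Wh rat_eq_iff by (intro conjI exI[of _ "A \<inter> B"] A(1) B(1))
  qed
qed

lemma rat_class_in: "(U, f) \<in> rat_reps X Y \<Longrightarrow> rat_eq X Y `` {(U, f)} \<in> rational_maps X Y"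
  unfolding rational_maps_def by (rule quotientI)

lemma rat_class_self: "(U, f) \<in> rat_reps X Y \<Longrightarrow> (U, f) \<in> rat_eq X Y `` {(U, f)}"
  by (rule equiv_class_self[OF equiv_rat_eq])

lemma rational_maps_rep:
  assumes "\<phi> \<in> rational_maps X Y" "(U, f) \<in> \<phi>"
  shows "(U, f) \<in> rat_reps X Y" "\<phi> = rat_eq X Y `` {(U, f)}"
proof -
  show "(U, f) \<in> rat_reps X Y"
    using in_quotient_imp_subset[OF equiv_rat_eq] assms unfolding rational_maps_def by blast
  from assms(1) obtain a where a: "\<phi> = rat_eq X Y `` {a}" "a \<in> rat_reps X Y"
    unfolding rational_maps_def by (rule quotientE)
  then have "(a, (U, f)) \<in> rat_eq X Y" using assms(2) by simp
  then show "\<phi> = rat_eq X Y `` {(U, f)}"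
    using equiv_class_eq[OF equiv_rat_eq] a(1) by blast
qed

lemma rational_maps_nonempty:
  assumes "\<phi> \<in> rational_maps X Y"
  obtains U f where "(U, f) \<in> \<phi>"
proof -
  have "\<phi> \<noteq> {}"
    using in_quotient_imp_non_empty[OF equiv_rat_eq] assms unfolding rational_maps_def by blast
  then show ?thesis using that by (metis ex_in_conv surj_pair)
qed

lemma rat_class_iff: "(V, g) \<in> rat_eq X Y `` {(U, f)} \<longleftrightarrow> (U, f) \<in> rat_reps X Y \<and> (V, g) \<in> rat_reps X Y \<and>
     (\<exists>W. openin (zar X) W \<and> W \<noteq> {} \<and> W \<subseteq> U \<inter> V \<and> (\<forall>x\<in>W. f x = g x))"
  by (simp add: rat_eq_iff)

lemma rational_maps_agree:
  assumes "\<phi> \<in> rational_maps X Y" "(U, f) \<in> \<phi>" "(V, g) \<in> \<phi>"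
  obtains W where "openin (zar X) W" "W \<noteq> {}" "W \<subseteq> U \<inter> V" "\<forall>x\<in>W. f x = g x"
proof -
  have "(V, g) \<in> rat_eq X Y `` {(U, f)}"
    using rational_maps_rep(2)[OF assms(1,2)] assms(3) by simp
  then show ?thesis unfolding rat_class_iff using that by (elim conjE exE)
qed

text \<open>Dominance is defined through one representative. Any other one agrees with it on a
  nonempty open set, which meets the nonempty open preimage by irreducibility.\<close>

lemma dominant_preimage:
  assumes "\<phi> \<in> rational_maps X Y" "dominant Y \<phi>" "(U, f) \<in> \<phi>" "openin (zar Y) V" "V \<noteq> {}"
  shows "openin (zar X) {x \<in> U. f x \<in> V}" "{x \<in> U. f x \<in> V} \<noteq> {}"
proof -
  show "openin (zar X) {x \<in> U. f x \<in> V}"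
    using rat_reps_preimage[OF rational_maps_rep(1)[OF assms(1,3)] assms(4)] .
  from assms(2) obtain U0 f0 where 0: "(U0, f0) \<in> \<phi>" "zar Y closure_of (f0 ` U0) = points Y"
    unfolding dominant_def by auto
  obtain y where "y \<in> V" using assms(5) by blast
  then have "y \<in> zar Y closure_of (f0 ` U0)" using 0(2) openin_subset[OF assms(4)] by blast
  then have "\<exists>z. z \<in> f0 ` U0 \<and> z \<in> V" using assms(4) \<open>y \<in> V\<close> unfolding in_closure_of by blast
  then have ne: "{x \<in> U0. f0 x \<in> V} \<noteq> {}" by blast
  have op: "openin (zar X) {x \<in> U0. f0 x \<in> V}"
    using rat_reps_preimage[OF rational_maps_rep(1)[OF assms(1) 0(1)] assms(4)] .
  obtain W where W: "openin (zar X) W" "W \<noteq> {}" "W \<subseteq> U0 \<inter> U" "\<forall>x\<in>W. f0 x = f x"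
    using assms(1) 0(1) assms(3) by (rule rational_maps_agree)
  have "{x \<in> U0. f0 x \<in> V} \<inter> W \<noteq> {}" by (rule meet[OF op W(1) ne W(2)])
  then show "{x \<in> U. f x \<in> V} \<noteq> {}" using W(3,4) by auto
qed

lemma rat_comp_mem: "(W, h) \<in> rat_comp X Z \<psi> \<phi> \<longleftrightarrow> (W, h) \<in> rat_reps X Z \<and> (\<exists>U f V g W'. (U, f) \<in> \<phi> \<and> (V, g) \<in> \<psi> \<and>
    openin (zar X) W' \<and> W' \<noteq> {} \<and> W' \<subseteq> W \<inter> U \<and> f ` W' \<subseteq> V \<and> (\<forall>x\<in>W'. h x = g (f x)))"
  unfolding rat_comp_def by (simp add: Bex_def split_paired_Ex)

text \<open>The definition of composition quantifies over all representatives; here they are fixed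
  in advance. Dominance is what makes this possible: the open set of \<open>Y\<close> on which two
  representatives of \<psi> agree has a nonempty preimage.\<close>

lemma rat_comp_iff:
  assumes \<phi>: "\<phi> \<in> rational_maps X Y" "dominant Y \<phi>" "(U, f) \<in> \<phi>"
    and Y: "irred_space Y" and \<psi>: "\<psi> \<in> rational_maps Y Z" "(V, g) \<in> \<psi>"
  shows "(W, h) \<in> rat_comp X Z \<psi> \<phi> \<longleftrightarrow> (W, h) \<in> rat_reps X Z \<and>
    (\<exists>W'. openin (zar X) W' \<and> W' \<noteq> {} \<and> W' \<subseteq> W \<inter> U \<and> f ` W' \<subseteq> V \<and> (\<forall>x\<in>W'. h x = g (f x)))"
proof
  assume "(W, h) \<in> rat_comp X Z \<psi> \<phi>"
  then obtain U' f' V' g' W' where *: "(W, h) \<in> rat_reps X Z" "(U', f') \<in> \<phi>" "(V', g') \<in> \<psi>"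
    "openin (zar X) W'" "W' \<noteq> {}" "W' \<subseteq> W \<inter> U'" "f' ` W' \<subseteq> V'" "\<forall>x\<in>W'. h x = g' (f' x)"
    unfolding rat_comp_mem by (elim conjE exE)
  obtain A where A: "openin (zar X) A" "A \<noteq> {}" "A \<subseteq> U \<inter> U'" "\<forall>x\<in>A. f x = f' x"
    using \<phi>(1,3) *(2) by (rule rational_maps_agree)
  obtain B where B: "openin (zar Y) B" "B \<noteq> {}" "B \<subseteq> V \<inter> V'" "\<forall>x\<in>B. g x = g' x"
    using \<psi> *(3) by (rule irred_space.rational_maps_agree[OF Y])
  note C = dominant_preimage[OF \<phi> B(1,2)]
  have AW: "openin (zar X) (A \<inter> W')" "A \<inter> W' \<noteq> {}"
    using openin_Int[OF A(1) *(4)] meet[OF A(1) *(4) A(2) *(5)] by auto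
  let ?W = "A \<inter> W' \<inter> {x \<in> U. f x \<in> B}"
  have "openin (zar X) ?W" using openin_Int[OF AW(1) C(1)] .
  moreover have "?W \<noteq> {}" using meet[OF AW(1) C(1) AW(2) C(2)] .
  moreover have "?W \<subseteq> W \<inter> U" using *(6) by auto
  moreover have "f ` ?W \<subseteq> V" using B(3) by auto
  moreover have "\<forall>x\<in>?W. h x = g (f x)" using *(8) A(4) B(4) by auto
  ultimately show "(W, h) \<in> rat_reps X Z \<and>
    (\<exists>W'. openin (zar X) W' \<and> W' \<noteq> {} \<and> W' \<subseteq> W \<inter> U \<and> f ` W' \<subseteq> V \<and> (\<forall>x\<in>W'. h x = g (f x)))"
    using *(1) by (intro conjI exI[of _ ?W])
next
  assume *: "(W, h) \<in> rat_reps X Z \<and>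
    (\<exists>W'. openin (zar X) W' \<and> W' \<noteq> {} \<and> W' \<subseteq> W \<inter> U \<and> f ` W' \<subseteq> V \<and> (\<forall>x\<in>W'. h x = g (f x)))"
  show "(W, h) \<in> rat_comp X Z \<psi> \<phi>"
    unfolding rat_comp_mem
    by (rule conjI[OF conjunct1[OF *]], rule exI[of _ U], rule exI[of _ f], rule exI[of _ V], rule exI[of _ g])
      (use conjunct2[OF *] \<phi>(3) \<psi>(2) in simp)
qed

lemma rat_of_id_rep: "(points X, \<lambda>x. x) \<in> rat_reps X X"
  unfolding rat_reps_iff
proof (intro conjI ballI allI impI)
  show "openin (zar X) (points X)" by simp
  show "points X \<noteq> {}" by (rule points_nonempty)
  show "x \<in> points X" if "x \<in> points X" for x using that .
  have eq: "{x \<in> points X. x \<in> V} = V" if "openin (zar X) V" for V using openin_subset[OF that] by auto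
  show "openin (zar X) {x \<in> points X. x \<in> V}" if "openin (zar X) V" for V using that eq[OF that] by simp
  show "h \<circ> (\<lambda>x. x) \<in> regf X {x \<in> points X. x \<in> V}" if "openin (zar X) V" "h \<in> regf X V" for V h
    using that(2) eq[OF that(1)] by (simp add: comp_def)
qed

lemma rat_of_morphism_rep:
  assumes "morphism X Y f"
  shows "(points X, f) \<in> rat_reps X Y"
  unfolding rat_reps_iff
proof (intro conjI ballI allI impI)
  have c: "continuous_map (zar X) (zar Y) f" using assms by (simp add: morphism_def)
  show "openin (zar X) (points X)" by simp
  show "points X \<noteq> {}" by (rule points_nonempty)
  show "f x \<in> points Y" if "x \<in> points X" for x
    using continuous_map_image_subset_topspace[OF c] that by auto
  show "openin (zar X) {x \<in> points X. f x \<in> V}" if "openin (zar Y) V" for V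
    by (rule openin_continuous_map_preimage[OF c that])
  show "h \<circ> f \<in> regf X {x \<in> points X. f x \<in> V}" if "openin (zar Y) V" "h \<in> regf Y V" for V h
    by (rule morphism_comp[OF assms that])
qed

end

lemma function_domain_regf:
  fixes X :: "('p, 'k::field_char_0) fspace"
  assumes "irred_space X" and V: "openin (zar X) V" "V \<noteq> {}"
  shows "function_domain V (regf X V)"
proof -
  interpret irred_space X by fact
  show ?thesis
  proof
    fix f g assume f: "f \<in> regf X V" "\<exists>v\<in>V. f v \<noteq> 0" and g: "g \<in> regf X V" "\<exists>v\<in>V. g v \<noteq> 0"
    have "{x \<in> V. f x \<noteq> 0} \<inter> {x \<in> V. g x \<noteq> 0} \<noteq> {}"
      by (rule meet[OF openin_nonzero[OF V(1) f(1)] openin_nonzero[OF V(1) g(1)]]) (use f(2) g(2) in auto)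
    then show "\<exists>v\<in>V. f v * g v \<noteq> 0" by auto
  qed (use V regf_const[OF swf V(1)] regf_add[OF swf V(1)] regf_mult[OF swf V(1)] in auto)
qed

text \<open>A birational map to affine space with first coordinate a proper power \<open>u ^ q\<close> would give
  \<open>P ^ q = x\<^sub>0 * Q ^ q\<close> for polynomials; the degrees in \<open>x\<^sub>0\<close> disagree modulo \<open>q\<close>.\<close>

lemma coordinate_not_power:
  fixes P Q :: "'k::field_char_0 vec \<Rightarrow> 'k"
  assumes n: "n \<ge> 1" and q: "q \<ge> 2" and P: "P \<in> polyfun n" and Q: "Q \<in> polyfun n"
    and V: "openin (zariski_topology n) V" "v0 \<in> V"
    and eq: "\<And>v. v \<in> V \<Longrightarrow> Q v \<noteq> 0 \<and> (P v / Q v) ^ q = v $ 0"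
  shows False
proof -
  obtain S where S: "S \<in> polyfun n" "S v0 \<noteq> 0" "{w \<in> carrier_vec n. S w \<noteq> 0} \<subseteq> V"
    using V by (rule openin_affine_basic)
  have v0: "v0 \<in> carrier_vec n" using openin_subset[OF V(1)] V(2) by (auto simp: topspace_zariski)
  \<comment> \<open>The line through \<open>v0\<close> in the direction of coordinate 0. The
    equation is known only where it runs inside \<open>V\<close>; the factor \<open>s\<close>
    vanishes at the other points and is cancelled afterwards.\<close>
  let ?q = "\<lambda>i. if i = 0 then [:v0 $ 0, 1:] else [:v0 $ i:]"
  let ?l = "\<lambda>t. Matrix.vec n (\<lambda>i. poly (?q i) t)"
  obtain p where p: "\<forall>t. P (?l t) = poly p t" using polyfun_poly_subst[OF P, of ?q] by (elim exE)
  obtain r where r: "\<forall>t. Q (?l t) = poly r t" using polyfun_poly_subst[OF Q, of ?q] by (elim exE)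
  obtain s where s: "\<forall>t. S (?l t) = poly s t" using polyfun_poly_subst[OF S(1), of ?q] by (elim exE)
  have l0: "?l 0 = v0" using v0 by (intro eq_vecI) auto
  have "poly (s * (p ^ q - [:v0 $ 0, 1:] * r ^ q)) t = 0" for t
  proof (cases "poly s t = 0")
    case False
    then have "?l t \<in> V" using S(3) s[THEN spec, of t] by auto
    from eq[OF this] have "poly r t \<noteq> 0" "(poly p t / poly r t) ^ q = poly [:v0 $ 0, 1:] t"
      using n by (simp_all add: p r)
    then have "poly p t ^ q = poly [:v0 $ 0, 1:] t * poly r t ^ q"
      by (simp add: power_divide divide_eq_eq)
    then show ?thesis by (simp add: poly_power distrib_right)
  qed simp
  then have "s * (p ^ q - [:v0 $ 0, 1:] * r ^ q) = 0"
    using poly_all_0_iff_0 by blast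
  moreover have "poly s 0 \<noteq> 0" using s[THEN spec, of 0] l0 S(2) by simp
  then have "s \<noteq> 0" by auto
  ultimately have pr: "p ^ q = [:v0 $ 0, 1:] * r ^ q" by simp
  have "poly r 0 \<noteq> 0" using r[THEN spec, of 0] l0 eq[OF V(2)] by simp
  then have "r ^ q \<noteq> 0" by auto
  moreover have "degree ([:v0 $ 0, 1:] * r ^ q) = degree [:v0 $ 0, 1:] + degree (r ^ q)"
    by (rule degree_mult_eq) (use \<open>r ^ q \<noteq> 0\<close> in auto)
  moreover have "degree [:v0 $ 0, 1:] = 1" by simp
  moreover have "degree (p ^ q) = q * degree p" "degree (r ^ q) = q * degree r"
  proof -
    have "p \<noteq> 0"
    proof
      assume "p = 0"
      then have "[:v0 $ 0, 1:] * r ^ q = 0" using pr q by (simp add: power_0_left)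
      then have "[:v0 $ 0, 1:] = 0" using \<open>r ^ q \<noteq> 0\<close> by (metis mult_eq_0_iff)
      then show False by simp
    qed
    moreover have "r \<noteq> 0" using \<open>poly r 0 \<noteq> 0\<close> by auto
    ultimately show "degree (p ^ q) = q * degree p" "degree (r ^ q) = q * degree r"
      by (simp_all add: degree_power_eq)
  qed
  ultimately have "q * degree p = 1 + q * degree r" using pr by metis
  then have "q dvd 1 + q * degree r" by (metis dvd_triv_left)
  then have "q dvd 1" by (metis dvd_add_left_iff dvd_triv_left)
  then show False using q by simp
qed

text \<open>Composing \<open>u\<close> with an inverse map gives a regular function on a nonempty
  open set of affine space whose q-th power is coordinate 0; locally it is a quotient of
  polynomials.\<close>

lemma not_birational_power:
  fixes X :: "('p, 'k::field_char_0) fspace"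
  assumes X: "irred_space X" and \<Phi>: "\<Phi> \<in> rational_maps X (affine_space n)" "(W, H) \<in> \<Phi>"
    and n: "n \<ge> 1" and q: "q \<ge> 2" and u: "u \<in> regf X W" "\<And>x. x \<in> W \<Longrightarrow> u x ^ q = H x $ 0"
  shows "\<not> birational_iso X (affine_space n) \<Phi>"
proof
  let ?A = "affine_space n :: ('k vec, 'k) fspace"
  interpret A: irred_space ?A by (rule irred_space_affine)
  assume "birational_iso X ?A \<Phi>"
  then obtain \<Psi> where \<Psi>: "\<Psi> \<in> rational_maps ?A X" "dominant X \<Psi>"
    and comp: "rat_comp ?A ?A \<Phi> \<Psi> = rat_of ?A ?A (\<lambda>y. y)"
    unfolding birational_iso_def by auto
  obtain B b where b: "(B, b) \<in> \<Psi>" using \<Psi>(1) by (rule A.rational_maps_nonempty)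
  have "(points ?A, \<lambda>y. y) \<in> rat_of ?A ?A (\<lambda>y. y)"
    unfolding rat_of_def by (rule A.rat_class_self[OF A.rat_of_id_rep])
  then have "(points ?A, \<lambda>y. y) \<in> rat_comp ?A ?A \<Phi> \<Psi>" using comp by simp
  then obtain W' where W': "openin (zar ?A) W'" "W' \<noteq> {}" "W' \<subseteq> points ?A \<inter> B" "b ` W' \<subseteq> W" "\<forall>x\<in>W'. x = H (b x)"
    unfolding A.rat_comp_iff[OF \<Psi> b X \<Phi>] by (elim conjE exE)
  have Wo: "openin (zar X) W"
    using rat_reps_open[OF irred_space.rational_maps_rep(1)[OF X \<Phi>]] .
  note rb = A.rational_maps_rep(1)[OF \<Psi>(1) b]
  have "u \<circ> b \<in> regf ?A {x \<in> B. b x \<in> W}"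
    by (rule rat_reps_regf[OF rb Wo u(1)])
  then have ub: "u \<circ> b \<in> regf ?A W'"
    by (rule regf_subset[OF A.swf rat_reps_preimage[OF rb Wo] W'(1), rotated]) (use W'(3,4) in auto)
  obtain v0 where v0: "v0 \<in> W'" using W'(2) by blast
  from regf_embeddedD[OF ub[unfolded affine_space_def] v0]
  obtain V P Q where V: "openin (zar ?A) V" "v0 \<in> V" "V \<subseteq> W'" "P \<in> polyfun n" "Q \<in> polyfun n"
    "\<forall>y\<in>V. Q y \<noteq> 0 \<and> (u \<circ> b) y = P y / Q y"
    unfolding affine_space_def[symmetric] by (elim exE conjE)
  have "Q v \<noteq> 0 \<and> (P v / Q v) ^ q = v $ 0" if "v \<in> V" for v
  proof -
    have v: "v \<in> W'" using that V(3) by blast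
    then have "H (b v) = v" "b v \<in> W" using W'(4,5) by auto
    then have "u (b v) ^ q = v $ 0" using u(2)[of "b v"] by simp
    then show ?thesis using bspec[OF V(6) that] by simp
  qed
  then show False
    by (rule coordinate_not_power[OF n q V(4,5) V(1)[unfolded zar_affine] V(2)])
qed

section \<open>Finite abelian groups and their characters\<close>

text \<open>An isomorphism with a product of cyclic groups, residues being written as natural
  numbers so that they can serve as exponents of the primitive roots \<zeta>. Characters are then
  explicit monomials.\<close>

locale abelian_coordinates = comm_group G for G :: "('g, 'a) monoid_scheme" (structure) +
  fixes r :: nat and m :: "nat \<Rightarrow> nat" and c :: "'g \<Rightarrow> nat \<Rightarrow> nat"
    and \<zeta> :: "nat \<Rightarrow> 'k::field_char_0"
  assumes fin: "finite (carrier G)"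
    and m_pos: "i < r \<Longrightarrow> m i > 0"
    and c_less: "g \<in> carrier G \<Longrightarrow> i < r \<Longrightarrow> c g i < m i"
    and c_mult: "g \<in> carrier G \<Longrightarrow> h \<in> carrier G \<Longrightarrow> i < r \<Longrightarrow> c (g \<otimes> h) i = (c g i + c h i) mod m i"
    and c_surj: "(\<And>i. i < r \<Longrightarrow> a i < m i) \<Longrightarrow> \<exists>g\<in>carrier G. \<forall>i<r. c g i = a i"
    and c_inj: "g \<in> carrier G \<Longrightarrow> h \<in> carrier G \<Longrightarrow> (\<And>i. i < r \<Longrightarrow> c g i = c h i) \<Longrightarrow> g = h"
    and primitive: "i < r \<Longrightarrow> \<zeta> i ^ k = 1 \<longleftrightarrow> m i dvd k"
begin

definition psi where "psi i g = \<zeta> i ^ c g i"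

definition chi where "chi a g = (\<Prod>i<r. psi i g ^ a i)"

text \<open>Exponent vectors that index the character group. They are extensional, so that the set
  is finite and sums over it factor as products of sums.\<close>

definition chars where "chars = (\<Pi>\<^sub>E i\<in>{..<r}. {..<m i})"

definition character :: "('g \<Rightarrow> 'k) \<Rightarrow> bool" where
  "character \<psi> \<longleftrightarrow> \<psi> \<one> = 1 \<and> (\<forall>g\<in>carrier G. \<forall>h\<in>carrier G. \<psi> (g \<otimes> h) = \<psi> g * \<psi> h)"

lemma root_mod: "i < r \<Longrightarrow> \<zeta> i ^ (x mod m i) = \<zeta> i ^ x"
proof -
  assume i: "i < r"
  have "\<zeta> i ^ x = \<zeta> i ^ (m i * (x div m i) + x mod m i)" by simp
  also have "\<dots> = (\<zeta> i ^ m i) ^ (x div m i) * \<zeta> i ^ (x mod m i)"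
    by (simp only: power_add power_mult)
  also have "\<zeta> i ^ m i = 1" using primitive[OF i] by simp
  finally show ?thesis by simp
qed

lemma root_nonzero: "i < r \<Longrightarrow> \<zeta> i \<noteq> 0"
  using primitive[of i "m i"] m_pos[of i] by (metis dvd_refl power_0_left less_numeral_extra(3) zero_neq_one)

lemma c_one: assumes i: "i < r" shows "c \<one> i = 0"
proof -
  have "c \<one> i = (c \<one> i + c \<one> i) mod m i"
    using c_mult[OF one_closed one_closed i] by simp
  then have "\<zeta> i ^ c \<one> i = \<zeta> i ^ (c \<one> i + c \<one> i)"
    using root_mod[OF i, of "c \<one> i + c \<one> i"] by simp
  then have "\<zeta> i ^ c \<one> i = 1"
    using root_nonzero[OF i] by (simp add: power_add)
  then have "m i dvd c \<one> i" using primitive[OF i] by simp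
  then show ?thesis using c_less[OF one_closed i] by (auto dest: dvd_imp_le)
qed

lemma character_psi: "i < r \<Longrightarrow> character (psi i)"
  unfolding character_def psi_def by (simp add: c_one c_mult root_mod power_add)

lemma character_one: "character (\<lambda>_. 1)"
  by (simp add: character_def)

lemma character_chi: "character (chi a)"
proof -
  have "psi i (g \<otimes> h) ^ a i = psi i g ^ a i * psi i h ^ a i"
    if "i < r" "g \<in> carrier G" "h \<in> carrier G" for i g h
    using character_psi[OF that(1)] that by (simp add: character_def power_mult_distrib)
  moreover have "psi i \<one> = 1" if "i < r" for i
    using character_psi[OF that] by (simp add: character_def)
  ultimately show ?thesis
    unfolding character_def chi_def by (simp add: prod.distrib)
qed

lemma psi_power: "i < r \<Longrightarrow> psi i g ^ m i = 1"
  using primitive[of i "c g i * m i"] by (simp add: psi_def power_mult[symmetric])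

lemma psi_eq_1:
  assumes "g \<in> carrier G" "\<And>i. i < r \<Longrightarrow> psi i g = 1"
  shows "g = \<one>"
proof (rule c_inj[OF assms(1) one_closed])
  fix i assume i: "i < r"
  have "m i dvd c g i" using assms(2)[OF i] primitive[OF i] by (simp add: psi_def)
  then show "c g i = c \<one> i" using c_less[OF assms(1) i] c_one[OF i] by (auto dest: dvd_imp_le)
qed

text \<open>Supplies the exponent that turns every eigenfunction into an invariant.\<close>

lemma chi_power: "chi a g ^ (\<Prod>i<r. m i) = 1"
proof -
  have "psi i g ^ (a i * (\<Prod>i<r. m i)) = 1" if "i < r" for i
  proof -
    have "(\<Prod>i<r. m i) = m i * (\<Prod>j\<in>{..<r}-{i}. m j)" using that by (simp add: prod.remove)
    then have e: "a i * (\<Prod>i<r. m i) = m i * (a i * (\<Prod>j\<in>{..<r}-{i}. m j))" by simp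
    show ?thesis unfolding e power_mult psi_power[OF that] by simp
  qed
  then show ?thesis
    by (simp add: chi_def prod_power_distrib power_mult[symmetric])
qed

lemma finite_chars: "finite chars"
  unfolding chars_def by (intro finite_PiE) auto

lemma card_chars: "card chars = (\<Prod>i<r. m i)"
  unfolding chars_def by (simp add: card_PiE)

lemma card_chars_pos: "card chars > 0"
  unfolding card_chars using m_pos by (simp add: prod_pos)

text \<open>Orthogonality of characters: the sum is a product of geometric sums, and for a
  nontrivial \<open>g\<close> some factor runs over all powers of a root of unity other than
  1.\<close>

lemma sum_chi:
  assumes g: "g \<in> carrier G"
  shows "(\<Sum>a\<in>chars. chi a g) = (if g = \<one> then of_nat (card chars) else 0)"
proof -
  have "(\<Sum>a\<in>chars. chi a g) = (\<Prod>i<r. \<Sum>b<m i. psi i g ^ b)"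
    unfolding chars_def chi_def by (rule prod_sum_PiE[symmetric]) auto
  also have "\<dots> = (if g = \<one> then of_nat (card chars) else 0)"
  proof (cases "g = \<one>")
    case True
    have "psi i \<one> = 1" if "i < r" for i
      using character_psi[OF that] by (simp add: character_def)
    then show ?thesis using True by (simp add: card_chars)
  next
    case False
    then obtain i where i: "i < r" "psi i g \<noteq> 1" using psi_eq_1[OF g] by blast
    have "(psi i g - 1) * (\<Sum>b<m i. psi i g ^ b) = 0"
      using power_diff_1_eq[of "psi i g" "m i"] psi_power[OF i(1), of g] by simp
    then have "(\<Sum>b<m i. psi i g ^ b) = 0" using i(2) by simp
    then show ?thesis using False i(1) by (auto intro: prod_zero)
  qed
  finally show ?thesis .
qed

end

section \<open>Eigenfunctions\<close>

text \<open>Faithfulness is required on every nonempty open set, which is what injectivity into the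
  group of birational maps provides and what lets a generic point have a free orbit.\<close>

locale abelian_action = abelian_coordinates G r m c \<zeta> + irred_space Y + group_action G "points Y" \<sigma>
  for G :: "('g, 'a) monoid_scheme" (structure)
    and r :: nat and m :: "nat \<Rightarrow> nat" and c :: "'g \<Rightarrow> nat \<Rightarrow> nat" and \<zeta> :: "nat \<Rightarrow> 'k::field_char_0"
    and Y :: "('q, 'k) fspace" and \<sigma> :: "'g \<Rightarrow> 'q \<Rightarrow> 'q" +
  assumes act: "g \<in> carrier G \<Longrightarrow> morphism Y Y (\<sigma> g)"
    and prevar: "prevariety Y"
    and faithful: "g \<in> carrier G \<Longrightarrow> g \<noteq> \<one> \<Longrightarrow> openin (zar Y) W \<Longrightarrow> W \<noteq> {} \<Longrightarrow> \<exists>v\<in>W. \<sigma> g v \<noteq> v"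
begin

lemma act_one: "v \<in> points Y \<Longrightarrow> \<sigma> \<one> v = v"
  using id_eq_one by (metis restrict_apply')

lemma act_points: "g \<in> carrier G \<Longrightarrow> v \<in> points Y \<Longrightarrow> \<sigma> g v \<in> points Y"
  using element_image by blast

lemma act_mult: "g \<in> carrier G \<Longrightarrow> h \<in> carrier G \<Longrightarrow> v \<in> points Y \<Longrightarrow> \<sigma> (g \<otimes> h) v = \<sigma> g (\<sigma> h v)"
  using composition_rule by blast

lemma act_inv: "g \<in> carrier G \<Longrightarrow> v \<in> points Y \<Longrightarrow> \<sigma> g (\<sigma> (inv g) v) = v"
  using act_mult[of g "inv g" v] act_one by simp

lemma act_open: "g \<in> carrier G \<Longrightarrow> openin (zar Y) U \<Longrightarrow> openin (zar Y) {v \<in> points Y. \<sigma> g v \<in> U}"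
  using openin_continuous_map_preimage act unfolding morphism_def by blast

lemma act_regf: "g \<in> carrier G \<Longrightarrow> openin (zar Y) U \<Longrightarrow> f \<in> regf Y U \<Longrightarrow>
    (\<lambda>v. f (\<sigma> g v)) \<in> regf Y {v \<in> points Y. \<sigma> g v \<in> U}"
  using morphism_comp[OF act] by (simp add: comp_def)

text \<open>The largest stable subset of \<open>U\<close>, open because \<open>G\<close> is finite.
  Averages over the group of functions on \<open>U\<close> are regular there.\<close>

definition invariant_core :: "'q set \<Rightarrow> 'q set" where
  "invariant_core U = {v \<in> points Y. \<forall>g\<in>carrier G. \<sigma> g v \<in> U}"

lemma finite_meet:
  assumes "finite I" "\<And>i. i \<in> I \<Longrightarrow> openin (zar Y) (A i) \<and> A i \<noteq> {}"
  shows "openin (zar Y) {v \<in> points Y. \<forall>i\<in>I. v \<in> A i} \<and> {v \<in> points Y. \<forall>i\<in>I. v \<in> A i} \<noteq> {}"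
  using assms
proof (induction I rule: finite_induct)
  case empty
  then show ?case using points_nonempty by simp
next
  case (insert i I)
  have eq: "{v \<in> points Y. \<forall>j\<in>insert i I. v \<in> A j} = {v \<in> points Y. \<forall>j\<in>I. v \<in> A j} \<inter> A i"
    by auto
  have IH: "openin (zar Y) {v \<in> points Y. \<forall>i\<in>I. v \<in> A i} \<and> {v \<in> points Y. \<forall>i\<in>I. v \<in> A i} \<noteq> {}"
    using insert by simp
  have i: "openin (zar Y) (A i) \<and> A i \<noteq> {}" using insert by simp
  show ?case
    unfolding eq using openin_Int[OF conjunct1[OF IH] conjunct1[OF i]]
      meet[OF conjunct1[OF IH] conjunct1[OF i] conjunct2[OF IH] conjunct2[OF i]] by simp
qed

lemma open_invariant_core:
  assumes U: "openin (zar Y) U"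
  shows "openin (zar Y) (invariant_core U)"
proof -
  have "finite J \<Longrightarrow> J \<subseteq> carrier G \<Longrightarrow> openin (zar Y) {v \<in> points Y. \<forall>g\<in>J. \<sigma> g v \<in> U}" for J
  proof (induction J rule: finite_induct)
    case (insert g J)
    have "{v \<in> points Y. \<forall>h\<in>insert g J. \<sigma> h v \<in> U} =
      {v \<in> points Y. \<forall>h\<in>J. \<sigma> h v \<in> U} \<inter> {v \<in> points Y. \<sigma> g v \<in> U}" by auto
    then show ?case using insert act_open[OF _ U, of g] by (simp add: openin_Int)
  qed simp
  then show ?thesis unfolding invariant_core_def using fin by blast
qed

lemma nonempty_preimage:
  assumes "g \<in> carrier G" "U \<noteq> {}" "openin (zar Y) U"
  shows "{v \<in> points Y. \<sigma> g v \<in> U} \<noteq> {}"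
proof -
  obtain u where u: "u \<in> U" using assms(2) by blast
  then have "u \<in> points Y" using openin_subset[OF assms(3)] by blast
  then have "\<sigma> g (\<sigma> (inv g) u) = u" "\<sigma> (inv g) u \<in> points Y"
    using act_inv[OF assms(1)] act_points[OF inv_closed[OF assms(1)]] by auto
  then show ?thesis using u by (intro notI) auto
qed

lemma nonempty_invariant_core:
  assumes U: "openin (zar Y) U" "U \<noteq> {}"
  shows "invariant_core U \<noteq> {}"
proof -
  have "{v \<in> points Y. \<forall>g\<in>carrier G. v \<in> {v \<in> points Y. \<sigma> g v \<in> U}} \<noteq> {}"
    by (rule conjunct2[OF finite_meet[OF fin]]) (use act_open[OF _ U(1)] nonempty_preimage[OF _ U(2,1)] in blast)
  then show ?thesis unfolding invariant_core_def by auto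
qed

lemma invariant_core_subset: "openin (zar Y) U \<Longrightarrow> invariant_core U \<subseteq> U"
  unfolding invariant_core_def using act_one one_closed by force

text \<open>The condition is imposed at all points, even where \<open>f\<close> is not regular;
  \<open>proj\<close> is defined by a sum that satisfies it everywhere. Domains of regularity may
  therefore be shrunk without remaining stable.\<close>

definition eigen :: "('g \<Rightarrow> 'k) \<Rightarrow> ('q \<Rightarrow> 'k) \<Rightarrow> bool" where
  "eigen \<psi> f \<longleftrightarrow> (\<forall>g\<in>carrier G. \<forall>v\<in>points Y. f (\<sigma> g v) = \<psi> g * f v)"

text \<open>The isotypic projector without its normalizing factor, which \<open>proj_sum\<close>
  identifies as the inverse of \<open>card chars\<close>.\<close>

definition proj :: "('g \<Rightarrow> 'k) \<Rightarrow> ('q \<Rightarrow> 'k) \<Rightarrow> 'q \<Rightarrow> 'k" where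
  "proj \<psi> f v = (\<Sum>g\<in>carrier G. \<psi> (inv g) * f (\<sigma> g v))"

lemma proj_eigen:
  assumes \<psi>: "character \<psi>"
  shows "eigen \<psi> (proj \<psi> f)"
  unfolding eigen_def
proof (intro ballI)
  fix h v assume h: "h \<in> carrier G" and v: "v \<in> points Y"
  have "proj \<psi> f (\<sigma> h v) = (\<Sum>g\<in>carrier G. \<psi> (inv g) * f (\<sigma> (g \<otimes> h) v))"
    unfolding proj_def using act_mult[OF _ h v] by (intro sum.cong) auto
  also have "\<dots> = (\<Sum>g\<in>carrier G. \<psi> (inv (g \<otimes> inv h)) * f (\<sigma> g v))"
    by (rule sum.reindex_bij_witness[of _ "\<lambda>g. g \<otimes> inv h" "\<lambda>g. g \<otimes> h"])
      (use h in \<open>auto simp: m_assoc\<close>)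
  also have "\<dots> = (\<Sum>g\<in>carrier G. \<psi> h * (\<psi> (inv g) * f (\<sigma> g v)))"
  proof (rule sum.cong[OF refl])
    fix g assume g: "g \<in> carrier G"
    then have "inv (g \<otimes> inv h) = h \<otimes> inv g" using h by (simp add: inv_mult_group)
    then show "\<psi> (inv (g \<otimes> inv h)) * f (\<sigma> g v) = \<psi> h * (\<psi> (inv g) * f (\<sigma> g v))"
      using \<psi> g h by (simp add: character_def)
  qed
  also have "\<dots> = \<psi> h * proj \<psi> f v" unfolding proj_def by (simp only: sum_distrib_left)
  finally show "proj \<psi> f (\<sigma> h v) = \<psi> h * proj \<psi> f v" .
qed

lemma proj_sum:
  assumes v: "v \<in> points Y"
  shows "(\<Sum>a\<in>chars. proj (chi a) f v) = of_nat (card chars) * f v"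
proof -
  have "(\<Sum>a\<in>chars. proj (chi a) f v) = (\<Sum>g\<in>carrier G. \<Sum>a\<in>chars. chi a (inv g) * f (\<sigma> g v))"
    unfolding proj_def by (rule sum.swap)
  also have "\<dots> = (\<Sum>g\<in>carrier G. (if inv g = \<one> then of_nat (card chars) else 0) * f (\<sigma> g v))"
    by (intro sum.cong refl) (simp only: sum_distrib_right[symmetric] sum_chi[OF inv_closed])
  also have "\<dots> = (\<Sum>g\<in>{\<one>}. (if inv g = \<one> then of_nat (card chars) else 0) * f (\<sigma> g v))"
    using fin by (intro sum.mono_neutral_right) (auto simp: inv_eq_1_iff)
  also have "\<dots> = of_nat (card chars) * f v" using act_one[OF v] by simp
  finally show ?thesis .
qed

lemma regf_sum: "openin (zar Y) U \<Longrightarrow> (\<And>i. i \<in> I \<Longrightarrow> f i \<in> regf Y U) \<Longrightarrow> (\<lambda>v. \<Sum>i\<in>I. f i v) \<in> regf Y U"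
  by (induction I rule: infinite_finite_induct) (simp_all add: regf_const[OF swf] regf_add[OF swf])

lemma regf_prod: "openin (zar Y) U \<Longrightarrow> (\<And>i. i \<in> I \<Longrightarrow> f i \<in> regf Y U) \<Longrightarrow> (\<lambda>v. \<Prod>i\<in>I. f i v) \<in> regf Y U"
  by (induction I rule: infinite_finite_induct) (simp_all add: regf_const[OF swf] regf_mult[OF swf])

lemma regf_act_core:
  assumes "openin (zar Y) U" "f \<in> regf Y U" "g \<in> carrier G"
  shows "(\<lambda>v. f (\<sigma> g v)) \<in> regf Y (invariant_core U)"
proof (rule regf_subset[OF swf act_open[OF assms(3,1)] open_invariant_core[OF assms(1)]])
  show "invariant_core U \<subseteq> {v \<in> points Y. \<sigma> g v \<in> U}"
    unfolding invariant_core_def using assms(3) by blast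
  show "(\<lambda>v. f (\<sigma> g v)) \<in> regf Y {v \<in> points Y. \<sigma> g v \<in> U}"
    by (rule act_regf[OF assms(3,1,2)])
qed

lemma regf_proj:
  assumes "openin (zar Y) U" "f \<in> regf Y U"
  shows "proj \<psi> f \<in> regf Y (invariant_core U)"
proof -
  note op = open_invariant_core[OF assms(1)]
  have "(\<lambda>v. \<Sum>g\<in>carrier G. \<psi> (inv g) * f (\<sigma> g v)) \<in> regf Y (invariant_core U)"
    by (intro regf_sum[OF op] regf_mult[OF swf op] regf_const[OF swf op] regf_act_core[OF assms])
  then show ?thesis by (simp add: proj_def[abs_def])
qed

text \<open>A function that vanishes at all but one point of a free orbit has a nonzero projection to
  every character.\<close>

lemma ex_eigenfunction:
  assumes \<psi>: "character \<psi>"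
  shows "\<exists>V u. openin (zar Y) V \<and> V \<noteq> {} \<and> u \<in> regf Y V \<and> (\<forall>v\<in>V. u v \<noteq> 0) \<and> eigen \<psi> u"
proof -
  obtain x0 where "x0 \<in> points Y" using points_nonempty by blast
  then obtain U N x where U: "x0 \<in> U" "chart Y U N x" by (rule prevariety_chart[OF prevar])
  have Uo: "openin (zar Y) U" "U \<noteq> {}" using U chart_open by auto
  have xreg: "x j \<in> regf Y U" if "j < N" for j using chart_coord[OF swf U(2) that] .
  \<comment> \<open>Where some chart coordinate distinguishes a point from its translate by
    \<open>g\<close>. A common point \<open>w\<close> of all these sets for nontrivial
    \<open>g\<close> has a free orbit, and by the choice of the core the whole orbit lies in the
    chart.\<close>
  define D where "D = (\<lambda>g. \<Union>j\<in>{..<N}. {v \<in> invariant_core U. x j (\<sigma> g v) - x j v \<noteq> 0})"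
  note op = open_invariant_core[OF Uo(1)]
  have xcore: "x j \<in> regf Y (invariant_core U)" if "j < N" for j
    using regf_subset[OF swf Uo(1) op invariant_core_subset[OF Uo(1)] xreg[OF that]] .
  have D: "openin (zar Y) (D g) \<and> D g \<noteq> {}" if g: "g \<in> carrier G - {\<one>}" for g
  proof
    have gG: "g \<in> carrier G" using g by simp
    have "(\<lambda>v. x j (\<sigma> g v) - x j v) \<in> regf Y (invariant_core U)" if "j < N" for j
    proof -
      have "(\<lambda>v. x j (\<sigma> g v) + (-1) * x j v) \<in> regf Y (invariant_core U)"
        by (intro regf_add[OF swf op] regf_mult[OF swf op] regf_const[OF swf op] regf_act_core Uo xreg xcore gG that)
      then show ?thesis by simp
    qed
    then show "openin (zar Y) (D g)"
      unfolding D_def by (intro openin_Union ballI) (elim imageE, simp only: lessThan_iff, rule openin_nonzero[OF op], blast)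
    obtain v where v: "v \<in> invariant_core U" "\<sigma> g v \<noteq> v"
      using faithful[OF gG _ op nonempty_invariant_core[OF Uo]] g by blast
    then have "v \<in> U" "\<sigma> g v \<in> U"
      using invariant_core_subset[OF Uo(1)] gG by (auto simp: invariant_core_def)
    then have "\<exists>j<N. x j (\<sigma> g v) \<noteq> x j v" using chart_separates[OF U(2)] v(2) by blast
    then show "D g \<noteq> {}" using v(1) unfolding D_def by auto
  qed
  have "{v \<in> points Y. \<forall>g\<in>carrier G - {\<one>}. v \<in> D g} \<inter> invariant_core U \<noteq> {}"
    using finite_meet[of "carrier G - {\<one>}" D] fin D meet[OF _ op _ nonempty_invariant_core[OF Uo]] by simp
  then obtain w where w: "w \<in> points Y" "w \<in> invariant_core U" "\<And>g. g \<in> carrier G - {\<one>} \<Longrightarrow> w \<in> D g"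
    by blast
  have "\<forall>g\<in>carrier G - {\<one>}. \<exists>j. j < N \<and> x j (\<sigma> g w) \<noteq> x j w"
    using w(3) unfolding D_def by auto
  from bchoice[OF this] obtain j where j: "\<forall>g\<in>carrier G - {\<one>}. j g < N \<and> x (j g) (\<sigma> g w) \<noteq> x (j g) w" ..
  \<comment> \<open>The factor for \<open>g\<close> vanishes at the translate of \<open>w\<close> by
    \<open>g\<close>, but not at \<open>w\<close> itself by the choice of
    \<open>j g\<close>.\<close>
  define f where "f = (\<lambda>v. \<Prod>g\<in>carrier G - {\<one>}. x (j g) v + (- x (j g) (\<sigma> g w)))"
  have freg: "f \<in> regf Y U"
    unfolding f_def by (intro regf_prod regf_add[OF swf] regf_const[OF swf] Uo xreg) (use j in auto)
  have f0: "f (\<sigma> g w) = 0" if "g \<in> carrier G - {\<one>}" for g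
    unfolding f_def using that fin by (intro prod_zero) auto
  have f1: "f w \<noteq> 0"
  proof
    assume "f w = 0"
    then obtain g where g: "g \<in> carrier G - {\<one>}" "x (j g) w + (- x (j g) (\<sigma> g w)) = 0"
      unfolding f_def using fin by (auto simp: prod_zero_iff)
    then have "x (j g) (\<sigma> g w) = x (j g) w" by (simp add: add_eq_0_iff)
    then show False using bspec[OF j g(1)] by simp
  qed
  have "proj \<psi> f w = (\<Sum>g\<in>{\<one>}. \<psi> (inv g) * f (\<sigma> g w))"
    unfolding proj_def using f0 fin by (intro sum.mono_neutral_right) auto
  also have "\<dots> = f w" using \<psi> act_one[OF w(1)] by (simp add: character_def)
  finally have pw: "proj \<psi> f w \<noteq> 0" using f1 by simp
  let ?V = "{v \<in> invariant_core U. proj \<psi> f v \<noteq> 0}"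
  have V: "openin (zar Y) ?V" by (rule openin_nonzero[OF op regf_proj[OF Uo(1) freg]])
  have "proj \<psi> f \<in> regf Y ?V"
    by (rule regf_subset[OF swf op V _ regf_proj[OF Uo(1) freg]]) blast
  then show ?thesis
    using V pw w(2) proj_eigen[OF \<psi>] by (intro exI[of _ ?V] exI[of _ "proj \<psi> f"]) auto
qed

text \<open>The eigenfunctions \<open>u\<close> have the right characters but may be dependent;
  multiplication by invariants corrects this without changing the characters, provided there are
  \<open>n\<close> independent invariants.\<close>

lemma ex_independent_eigenfunctions:
  assumes \<psi>: "\<And>i. i < n \<Longrightarrow> character (\<psi> i)"
    and U: "openin (zar Y) U" "U \<noteq> {}" and f: "\<And>i. i < n \<Longrightarrow> f i \<in> regf Y U" "alg_independent Y U n f"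
  shows "\<exists>V h. openin (zar Y) V \<and> V \<noteq> {} \<and> (\<forall>i<n. h i \<in> regf Y V \<and> eigen (\<psi> i) (h i)) \<and> alg_independent Y V n h"
proof -
  have "\<forall>i\<in>{..<n}. \<exists>V u. openin (zar Y) V \<and> V \<noteq> {} \<and> u \<in> regf Y V \<and> (\<forall>v\<in>V. u v \<noteq> 0) \<and> eigen (\<psi> i) u"
    using ex_eigenfunction[OF \<psi>] by simp
  from bchoice[OF this] obtain A where
    "\<forall>i\<in>{..<n}. \<exists>u. openin (zar Y) (A i) \<and> A i \<noteq> {} \<and> u \<in> regf Y (A i) \<and> (\<forall>v\<in>A i. u v \<noteq> 0) \<and> eigen (\<psi> i) u" ..
  from bchoice[OF this] obtain u where
    A: "\<forall>i\<in>{..<n}. openin (zar Y) (A i) \<and> A i \<noteq> {} \<and> u i \<in> regf Y (A i) \<and> (\<forall>v\<in>A i. u i v \<noteq> 0) \<and> eigen (\<psi> i) (u i)" ..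
  let ?B = "{v \<in> points Y. \<forall>i\<in>{..<n}. v \<in> A i}"
  have B: "openin (zar Y) ?B \<and> ?B \<noteq> {}" by (rule finite_meet) (use A in auto)
  define V where "V = ?B \<inter> invariant_core U"
  note op = open_invariant_core[OF U(1)]
  have V: "openin (zar Y) V" "V \<noteq> {}"
    unfolding V_def using B op meet[of ?B "invariant_core U"] nonempty_invariant_core[OF U] by (simp_all add: openin_Int)
  have VU: "V \<subseteq> U" unfolding V_def using invariant_core_subset[OF U(1)] by blast
  have VY: "V \<subseteq> points Y" using openin_subset[OF V(1)] .
  interpret D: function_domain V "regf Y V"
    by (rule function_domain_regf[OF _ V]) unfold_locales
  have u: "u i \<in> regf Y V" "\<And>v. v \<in> V \<Longrightarrow> u i v \<noteq> 0" "eigen (\<psi> i) (u i)" if i: "i < n" for i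
  proof -
    have Ai: "openin (zar Y) (A i)" "u i \<in> regf Y (A i)" "\<forall>v\<in>A i. u i v \<noteq> 0" "eigen (\<psi> i) (u i)"
      using A i by auto
    have sub: "V \<subseteq> A i" unfolding V_def using i by auto
    show "u i \<in> regf Y V" by (rule regf_subset[OF swf Ai(1) V(1) sub Ai(2)])
    show "u i v \<noteq> 0" if "v \<in> V" for v using Ai(3) sub that by blast
    show "eigen (\<psi> i) (u i)" by (rule Ai(4))
  qed
  have uinv: "(\<lambda>v. inverse (u i v)) \<in> regf Y V" if i: "i < n" for i
  proof -
    have "{v \<in> V. u i v \<noteq> 0} = V" using u(2)[OF i] by auto
    then show ?thesis using regf_inverse[OF V(1) u(1)[OF i]] by simp
  qed
  \<comment> \<open>A relation on the smaller set \<open>V\<close> extends to \<open>U\<close> by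
    the identity principle.\<close>
  have indep: "D.indep n f"
    unfolding D.indep_def
  proof (intro ballI impI)
    fix P and w :: "'k vec" assume P: "P \<in> polyfun n" "\<forall>x\<in>V. P (Matrix.vec n (\<lambda>i. f i x)) = 0" and w: "w \<in> carrier_vec n"
    have "P (Matrix.vec n (\<lambda>i. f i x)) = 0" if "x \<in> U" for x
      by (rule zero_on_open[OF U(1) regf_polyfun[OF swf U(1) P(1) f(1)] V]) (use P(2) that in auto)
    then show "P w = 0" using f(2) P(1) w unfolding alg_independent_def by blast
  qed
  define q where "q = card chars"
  obtain e where e: "bij_betw e {..<q} chars"
    using ex_bij_betw_nat_finite[OF finite_chars] unfolding q_def atLeast0LessThan by blast
  \<comment> \<open>The eigencomponents of \<open>f i\<close>, one for each character, normalized so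
    that they add up to \<open>f i\<close>.\<close>
  define g where "g i k = (\<lambda>v. inverse (of_nat q) * proj (chi (e k)) (f i) v)" for i k
  have q: "of_nat q \<noteq> (0::'k)" using card_chars_pos by (simp add: q_def)
  have core_V: "V \<subseteq> invariant_core U" unfolding V_def by blast
  have greg: "g i k \<in> regf Y V" if "i < n" for i k
    unfolding g_def
    by (intro regf_mult[OF swf V(1)] regf_const[OF swf V(1)] regf_subset[OF swf op V(1) core_V regf_proj[OF U(1) f(1)[OF that]]])
  have gsum: "f i v = (\<Sum>k<q. g i k v)" if "v \<in> V" for i v
  proof -
    have "(\<Sum>k<q. g i k v) = inverse (of_nat q) * (\<Sum>k<q. proj (chi (e k)) (f i) v)"
      unfolding g_def by (simp add: sum_distrib_left)
    also have "(\<Sum>k<q. proj (chi (e k)) (f i) v) = (\<Sum>a\<in>chars. proj (chi a) (f i) v)"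
      by (rule sum.reindex_bij_betw[OF e])
    also have "\<dots> = of_nat q * f i v" unfolding q_def using proj_sum that VY by blast
    finally show ?thesis using q by simp
  qed
  have ginv: "g i k (\<sigma> h v) ^ q = g i k v ^ q" if "h \<in> carrier G" "v \<in> points Y" for i k h v
  proof -
    have "proj (chi (e k)) (f i) (\<sigma> h v) = chi (e k) h * proj (chi (e k)) (f i) v"
      using proj_eigen[OF character_chi] that unfolding eigen_def by blast
    then show ?thesis
      unfolding g_def by (simp add: power_mult_distrib q_def card_chars chi_power)
  qed
  obtain b where b: "\<And>k. k < n \<Longrightarrow> \<exists>i<n. \<exists>k'<q. b k = (\<lambda>v. g i k' v ^ q)" "D.indep n b"
  proof (rule D.ex_indep_powers[of n q g q f])
    show "0 < q" using card_chars_pos by (simp add: q_def)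
  qed (use greg gsum indep in blast)+
  have breg: "b k \<in> regf Y V" if k: "k < n" for k
  proof -
    obtain i k' where "i < n" "b k = (\<lambda>v. g i k' v ^ q)" using b(1)[OF k] by blast
    then show ?thesis using D.R_power[OF greg] by simp
  qed
  have binv: "b k (\<sigma> h v) = b k v" if k: "k < n" and hv: "h \<in> carrier G" "v \<in> points Y" for k h v
  proof -
    obtain i k' where "b k = (\<lambda>v. g i k' v ^ q)" using b(1)[OF k] by blast
    then show ?thesis using ginv[OF hv] by simp
  qed
  obtain h where h: "\<And>k. k < n \<Longrightarrow> h k = u k \<or> (\<exists>i<n. h k = (\<lambda>v. u k v * b i v))" "D.indep n h"
  proof (rule D.ex_indep_multiples[of n u b])
  qed (use u(1,2) uinv breg b(2) in blast)+
  have "h k \<in> regf Y V \<and> eigen (\<psi> k) (h k)" if k: "k < n" for k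
  proof (cases "h k = u k")
    case True
    then show ?thesis using u[OF k] by simp
  next
    case False
    then obtain i where i: "i < n" "h k = (\<lambda>v. u k v * b i v)" using h(1)[OF k] by blast
    have "h k \<in> regf Y V" unfolding i(2) by (rule regf_mult[OF swf V(1) u(1)[OF k] breg[OF i(1)]])
    moreover have "eigen (\<psi> k) (h k)"
      using u(3)[OF k] binv[OF i(1)] unfolding eigen_def i(2) by simp
    ultimately show ?thesis ..
  qed
  moreover have "alg_independent Y V n h"
    using h(2) unfolding D.indep_def alg_independent_def .
  ultimately show ?thesis using V by (intro exI[of _ V] exI[of _ h]) simp
qed

end

section \<open>The local ring at a fixed point\<close>

locale action_fixed_point = abelian_action G r m c \<zeta> Y \<sigma>
  for G :: "('g, 'a) monoid_scheme" (structure)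
    and r :: nat and m :: "nat \<Rightarrow> nat" and c :: "'g \<Rightarrow> nat \<Rightarrow> nat" and \<zeta> :: "nat \<Rightarrow> 'k::field_char_0"
    and Y :: "('q, 'k) fspace" and \<sigma> :: "'g \<Rightarrow> 'q \<Rightarrow> 'q" +
  fixes y :: 'q
  assumes y_point: "y \<in> points Y" and y_fixed: "g \<in> carrier G \<Longrightarrow> \<sigma> g y = y"
begin

text \<open>Equality of germs at \<open>y\<close>, kept as a relation between total functions
  instead of passing to a quotient; \<open>loc\<close> is accordingly the local ring before
  identification.\<close>

definition near :: "('q \<Rightarrow> 'k) \<Rightarrow> ('q \<Rightarrow> 'k) \<Rightarrow> bool" where
  "near a b \<longleftrightarrow> eventually (\<lambda>v. a v = b v) (nhdsin (zar Y) y)"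

definition loc :: "('q \<Rightarrow> 'k) set" where
  "loc = {a. \<exists>U. openin (zar Y) U \<and> y \<in> U \<and> a \<in> regf Y U}"

definition maxid :: "('q \<Rightarrow> 'k) set" where
  "maxid = {a \<in> loc. a y = 0}"

lemma eventually_near: "eventually P (nhdsin (zar Y) y) \<longleftrightarrow> (\<exists>S. openin (zar Y) S \<and> y \<in> S \<and> (\<forall>x\<in>S. P x))"
  using y_point by (simp add: eventually_nhdsin)

lemma eventually_points: "eventually (\<lambda>v. v \<in> points Y) (nhdsin (zar Y) y)"
  unfolding eventually_near using y_point by (intro exI[of _ "points Y"]) simp

lemma eventually_act:
  assumes "eventually P (nhdsin (zar Y) y)" "g \<in> carrier G"
  shows "eventually (\<lambda>v. P (\<sigma> g v)) (nhdsin (zar Y) y)"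
proof -
  from assms(1) obtain S where S: "openin (zar Y) S" "y \<in> S" "\<forall>x\<in>S. P x"
    unfolding eventually_near by (elim exE conjE)
  show ?thesis
    unfolding eventually_near
    by (rule exI[of _ "{v \<in> points Y. \<sigma> g v \<in> S}"])
      (use S act_open[OF assms(2) S(1)] y_point y_fixed[OF assms(2)] in simp)
qed

lemma near_refl: "near a a" by (simp add: near_def)

lemma near_eqI: "(\<And>v. v \<in> points Y \<Longrightarrow> a v = b v) \<Longrightarrow> near a b"
  unfolding near_def using eventually_points by (rule eventually_mono) simp

lemma near_at: "near a b \<Longrightarrow> a y = b y"
  unfolding near_def eventually_near by blast

lemma near_trans: assumes "near a b" "near b d" shows "near a d"
  using assms unfolding near_def by eventually_elim simp

lemma near_add: assumes "near a b" "near a' b'" shows "near (\<lambda>v. a v + a' v) (\<lambda>v. b v + b' v)"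
  using assms unfolding near_def by eventually_elim simp

lemma near_mult: assumes "near a b" "near a' b'" shows "near (\<lambda>v. a v * a' v) (\<lambda>v. b v * b' v)"
  using assms unfolding near_def by eventually_elim simp

lemma near_act: "near a b \<Longrightarrow> g \<in> carrier G \<Longrightarrow> near (\<lambda>v. a (\<sigma> g v)) (\<lambda>v. b (\<sigma> g v))"
  unfolding near_def by (rule eventually_act)

lemma locI: "openin (zar Y) U \<Longrightarrow> y \<in> U \<Longrightarrow> a \<in> regf Y U \<Longrightarrow> a \<in> loc"
  unfolding loc_def by blast

lemma locE:
  assumes "a \<in> loc"
  obtains U where "openin (zar Y) U" "y \<in> U" "a \<in> regf Y U"
  using assms unfolding loc_def by blast

lemma loc_const: "(\<lambda>_. k) \<in> loc"
  by (rule locI[of "points Y"]) (auto intro: y_point regf_const[OF swf])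

lemma loc2:
  assumes "a \<in> loc" "b \<in> loc"
  obtains U where "openin (zar Y) U" "y \<in> U" "a \<in> regf Y U" "b \<in> regf Y U"
proof -
  obtain U where U: "openin (zar Y) U" "y \<in> U" "a \<in> regf Y U" using assms(1) by (rule locE)
  obtain V where V: "openin (zar Y) V" "y \<in> V" "b \<in> regf Y V" using assms(2) by (rule locE)
  note op = openin_Int[OF U(1) V(1)]
  show ?thesis
    using U(2) V(2) regf_subset[OF swf U(1) op _ U(3)] regf_subset[OF swf V(1) op _ V(3)]
    by (intro that[OF op]) auto
qed

lemma loc_add: assumes "a \<in> loc" "b \<in> loc" shows "(\<lambda>v. a v + b v) \<in> loc"
proof -
  obtain U where U: "openin (zar Y) U" "y \<in> U" "a \<in> regf Y U" "b \<in> regf Y U" using assms by (rule loc2)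
  show ?thesis by (rule locI[OF U(1,2) regf_add[OF swf U(1,3,4)]])
qed

lemma loc_mult: assumes "a \<in> loc" "b \<in> loc" shows "(\<lambda>v. a v * b v) \<in> loc"
proof -
  obtain U where U: "openin (zar Y) U" "y \<in> U" "a \<in> regf Y U" "b \<in> regf Y U" using assms by (rule loc2)
  show ?thesis by (rule locI[OF U(1,2) regf_mult[OF swf U(1,3,4)]])
qed

lemma loc_diff: assumes "a \<in> loc" "b \<in> loc" shows "(\<lambda>v. a v - b v) \<in> loc"
  using loc_add[OF assms(1) loc_mult[OF loc_const[of "-1"] assms(2)]] by simp

lemma loc_inverse:
  assumes "a \<in> loc" "a y \<noteq> 0"
  shows "(\<lambda>v. inverse (a v)) \<in> loc" "eventually (\<lambda>v. a v \<noteq> 0) (nhdsin (zar Y) y)"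
proof -
  obtain U where U: "openin (zar Y) U" "y \<in> U" "a \<in> regf Y U" using assms(1) by (rule locE)
  note op = openin_nonzero[OF U(1,3)]
  show "(\<lambda>v. inverse (a v)) \<in> loc"
    by (rule locI[OF op _ regf_inverse[OF U(1,3)]]) (use U(2) assms(2) in simp)
  show "eventually (\<lambda>v. a v \<noteq> 0) (nhdsin (zar Y) y)"
    unfolding eventually_near by (rule exI[of _ "{x \<in> U. a x \<noteq> 0}"]) (use op U(2) assms(2) in simp)
qed

lemma loc_act: assumes "a \<in> loc" "g \<in> carrier G" shows "(\<lambda>v. a (\<sigma> g v)) \<in> loc"
proof -
  obtain U where U: "openin (zar Y) U" "y \<in> U" "a \<in> regf Y U" using assms(1) by (rule locE)
  show ?thesis
    by (rule locI[OF act_open[OF assms(2) U(1)] _ act_regf[OF assms(2) U(1,3)]])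
      (use U(2) y_point y_fixed[OF assms(2)] in simp)
qed

lemma maxid_loc: "a \<in> maxid \<Longrightarrow> a \<in> loc" and maxid_zero: "a \<in> maxid \<Longrightarrow> a y = 0"
  by (simp_all add: maxid_def)

lemma maxidI: "a \<in> loc \<Longrightarrow> a y = 0 \<Longrightarrow> a \<in> maxid"
  by (simp add: maxid_def)

lemma maxid_mult: "a \<in> maxid \<Longrightarrow> b \<in> loc \<Longrightarrow> (\<lambda>v. a v * b v) \<in> maxid"
  by (simp add: maxid_def loc_mult)

lemma maxid_mult': "b \<in> loc \<Longrightarrow> a \<in> maxid \<Longrightarrow> (\<lambda>v. b v * a v) \<in> maxid"
  by (simp add: maxid_def loc_mult)

lemma maxid_act: "a \<in> maxid \<Longrightarrow> g \<in> carrier G \<Longrightarrow> (\<lambda>v. a (\<sigma> g v)) \<in> maxid"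
  by (simp add: maxid_def loc_act y_fixed)

text \<open>The ideal of germs generated by \<open>S\<close>. Adding one multiple at a time, up to
  agreement near \<open>y\<close>, allows proofs by induction without finite families of
  coefficients.\<close>

inductive_set gideal :: "('q \<Rightarrow> 'k) set \<Rightarrow> ('q \<Rightarrow> 'k) set" for S where
  zero: "near a (\<lambda>_. 0) \<Longrightarrow> a \<in> gideal S"
| step: "a \<in> gideal S \<Longrightarrow> s \<in> S \<Longrightarrow> k \<in> loc \<Longrightarrow> near b (\<lambda>v. a v + k v * s v) \<Longrightarrow> b \<in> gideal S"

lemma gideal_near: "a \<in> gideal S \<Longrightarrow> near b a \<Longrightarrow> b \<in> gideal S"
proof (induction arbitrary: b rule: gideal.induct)
  case (zero a)
  show ?case by (rule gideal.zero[OF near_trans[OF zero.prems zero.hyps]])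
next
  case (step a s k b')
  show ?case by (rule gideal.step[OF step.hyps(1,2,3) near_trans[OF step.prems step.hyps(4)]])
qed

lemma gideal_zero: "(\<lambda>_. 0) \<in> gideal S"
  by (rule gideal.zero[OF near_refl])

lemma gideal_scaled: "s \<in> S \<Longrightarrow> k \<in> loc \<Longrightarrow> (\<lambda>v. k v * s v) \<in> gideal S"
  using gideal.step[OF gideal_zero, of s S k "\<lambda>v. k v * s v"] near_refl by simp

lemma gideal_base: "s \<in> S \<Longrightarrow> s \<in> gideal S"
  using gideal_scaled[of s S "\<lambda>_. 1"] loc_const by simp

lemma gideal_add: "a \<in> gideal S \<Longrightarrow> b \<in> gideal S \<Longrightarrow> (\<lambda>v. b v + a v) \<in> gideal S"
proof (induction rule: gideal.induct)
  case (zero a)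
  have "near (\<lambda>v. b v + a v) (\<lambda>v. b v + 0)" by (rule near_add[OF near_refl zero(1)])
  then show ?case using gideal_near zero(2) by simp
next
  case (step a s k d)
  have "near (\<lambda>v. b v + d v) (\<lambda>v. b v + (a v + k v * s v))"
    by (rule near_add[OF near_refl step.hyps(4)])
  then have "near (\<lambda>v. b v + d v) (\<lambda>v. (b v + a v) + k v * s v)"
    by (simp add: add.assoc)
  then show ?case using gideal.step[OF step.IH[OF step.prems] step.hyps(2,3)] by blast
qed

lemma gideal_mult: "a \<in> gideal S \<Longrightarrow> d \<in> loc \<Longrightarrow> (\<lambda>v. d v * a v) \<in> gideal S"
proof (induction rule: gideal.induct)
  case (zero a)
  have "near (\<lambda>v. d v * a v) (\<lambda>v. d v * 0)" by (rule near_mult[OF near_refl zero(1)])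
  then show ?case by (intro gideal.zero) simp
next
  case (step a s k b)
  have "near (\<lambda>v. d v * b v) (\<lambda>v. d v * (a v + k v * s v))"
    by (rule near_mult[OF near_refl step.hyps(4)])
  then have "near (\<lambda>v. d v * b v) (\<lambda>v. d v * a v + (d v * k v) * s v)"
    by (simp add: distrib_left mult.assoc)
  then show ?case
    using gideal.step[OF step.IH[OF step.prems] step.hyps(2) loc_mult[OF step.prems step.hyps(3)]] by blast
qed

lemma gideal_uminus: "a \<in> gideal S \<Longrightarrow> (\<lambda>v. - a v) \<in> gideal S"
  using gideal_mult[OF _ loc_const[of "-1"]] by simp

lemma gideal_diff: "a \<in> gideal S \<Longrightarrow> b \<in> gideal S \<Longrightarrow> (\<lambda>v. a v - b v) \<in> gideal S"
  using gideal_add[OF gideal_uminus] by fastforce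

lemma gideal_sum: "(\<And>i. i \<in> I \<Longrightarrow> a i \<in> gideal S) \<Longrightarrow> (\<lambda>v. \<Sum>i\<in>I. a i v) \<in> gideal S"
  by (induction I rule: infinite_finite_induct) (simp_all add: gideal_zero gideal_add)

lemma gideal_act:
  assumes "a \<in> gideal S" "g \<in> carrier G" "\<And>s. s \<in> S \<Longrightarrow> (\<lambda>v. s (\<sigma> g v)) \<in> gideal T"
  shows "(\<lambda>v. a (\<sigma> g v)) \<in> gideal T"
  using assms(1)
proof (induction rule: gideal.induct)
  case (zero a)
  then show ?case using near_act[OF _ assms(2)] by (intro gideal.zero) blast
next
  case (step a s k b)
  have "(\<lambda>v. a (\<sigma> g v) + k (\<sigma> g v) * s (\<sigma> g v)) \<in> gideal T"
    by (rule gideal_add[OF gideal_mult[OF assms(3)[OF step.hyps(2)] loc_act[OF step.hyps(3) assms(2)]] step.IH])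
  then show ?case using near_act[OF step.hyps(4) assms(2)] by (rule gideal_near)
qed

lemma gideal_near_zero:
  assumes "a \<in> gideal S" "\<And>s. s \<in> S \<Longrightarrow> near s (\<lambda>_. 0)"
  shows "near a (\<lambda>_. 0)"
  using assms(1)
proof (induction rule: gideal.induct)
  case (zero a)
  then show ?case .
next
  case (step a s k b)
  have "near (\<lambda>v. a v + k v * s v) (\<lambda>v. 0 + k v * 0)"
    by (rule near_add[OF step.IH near_mult[OF near_refl assms(2)[OF step.hyps(2)]]])
  then show ?case using near_trans[OF step.hyps(4)] by simp
qed

definition mtimes :: "('q \<Rightarrow> 'k) set \<Rightarrow> ('q \<Rightarrow> 'k) set" where
  "mtimes D = {\<lambda>v. a v * d v | a d. a \<in> maxid \<and> d \<in> D}"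

lemma mtimes_gideal:
  assumes "e \<in> gideal D" "a \<in> maxid"
  shows "(\<lambda>v. a v * e v) \<in> gideal (mtimes D)"
  using assms(1)
proof (induction rule: gideal.induct)
  case (zero e)
  have "near (\<lambda>v. a v * e v) (\<lambda>v. a v * 0)" by (rule near_mult[OF near_refl zero])
  then show ?case by (intro gideal.zero) simp
next
  case (step e s k b)
  have "(\<lambda>v. a v * s v) \<in> mtimes D" unfolding mtimes_def using assms(2) step.hyps(2) by blast
  from gideal.step[OF step.IH this step.hyps(3) near_refl]
  have "(\<lambda>v. a v * e v + k v * (a v * s v)) \<in> gideal (mtimes D)" .
  moreover have "near (\<lambda>v. a v * b v) (\<lambda>v. a v * (e v + k v * s v))"
    by (rule near_mult[OF near_refl step.hyps(4)])
  then have "near (\<lambda>v. a v * b v) (\<lambda>v. a v * e v + k v * (a v * s v))"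
    by (simp add: distrib_left mult.left_commute)
  ultimately show ?case by (rule gideal_near)
qed

text \<open>Collects all multiples of \<open>d\<close> into a single coefficient, which still lies
  in the maximal ideal; this is the linear equation that Nakayama's lemma solves for
  \<open>d\<close>.\<close>

lemma mtimes_insert:
  assumes "e \<in> gideal (mtimes (insert d D))"
  shows "\<exists>\<mu> e'. \<mu> \<in> maxid \<and> e' \<in> gideal (mtimes D) \<and> near e (\<lambda>v. \<mu> v * d v + e' v)"
  using assms
proof (induction rule: gideal.induct)
  case (zero e)
  have "(\<lambda>_. 0) \<in> maxid" by (rule maxidI[OF loc_const]) simp
  then show ?case using zero gideal_zero by (intro exI[of _ "\<lambda>_. 0"]) simp
next
  case (step e s k b)
  from step.IH obtain \<mu> e' where IH: "\<mu> \<in> maxid" "e' \<in> gideal (mtimes D)" "near e (\<lambda>v. \<mu> v * d v + e' v)"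
    by (elim exE conjE)
  from step.hyps(2) obtain a d' where s: "s = (\<lambda>v. a v * d' v)" "a \<in> maxid" "d' \<in> insert d D"
    unfolding mtimes_def by blast
  have b: "near b (\<lambda>v. (\<mu> v * d v + e' v) + k v * s v)"
    by (rule near_trans[OF step.hyps(4) near_add[OF IH(3) near_refl]])
  show ?case
  proof (cases "d' = d")
    case True
    have "(\<lambda>v. \<mu> v + k v * a v) \<in> maxid"
      by (rule maxidI) (use IH(1) s(2) step.hyps(3) in \<open>simp_all add: maxid_def loc_add loc_mult\<close>)
    moreover have "near b (\<lambda>v. (\<mu> v + k v * a v) * d v + e' v)"
      using b unfolding s(1) True by (simp add: algebra_simps)
    ultimately show ?thesis using IH(2) by blast
  next
    case False
    then have "(\<lambda>v. e' v + k v * s v) \<in> gideal (mtimes D)"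
      using s IH(2) step.hyps(3) by (intro gideal_add[OF gideal_scaled]) (auto simp: mtimes_def)
    moreover have "near b (\<lambda>v. \<mu> v * d v + (e' v + k v * s v))"
      using b by (simp add: add.assoc)
    ultimately show ?thesis using IH(1) by blast
  qed
qed

text \<open>Elimination of one generator at a time: \<open>d\<close> equals \<mu> times
  \<open>d\<close> plus \<open>e\<close>, and 1 - \<mu> is a unit, so \<open>d\<close> can be
  expressed through the others and substituted into their relations.\<close>

lemma nakayama:
  assumes "finite D" "\<forall>d\<in>D. d \<in> gideal (mtimes D)"
  shows "\<forall>d\<in>D. near d (\<lambda>_. 0)"
  using assms
proof (induction D rule: finite_induct)
  case empty
  then show ?case by simp
next
  case (insert d D)
  have "d \<in> gideal (mtimes (insert d D))" using insert.prems by simp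
  from mtimes_insert[OF this] obtain \<mu> e where
    \<mu>: "\<mu> \<in> maxid" "e \<in> gideal (mtimes D)" "near d (\<lambda>v. \<mu> v * d v + e v)" by (elim exE conjE)
  have l: "(\<lambda>v. 1 - \<mu> v) \<in> loc" by (rule loc_diff[OF loc_const maxid_loc[OF \<mu>(1)]])
  have u: "1 - \<mu> y \<noteq> 0" using maxid_zero[OF \<mu>(1)] by simp
  have "near d (\<lambda>v. inverse (1 - \<mu> v) * e v)"
    using \<mu>(3) loc_inverse(2)[OF l u] unfolding near_def
    by (rule eventually_elim2) (simp add: field_simps)
  moreover have "(\<lambda>v. inverse (1 - \<mu> v) * e v) \<in> gideal (mtimes D)"
    by (rule gideal_mult[OF \<mu>(2) loc_inverse(1)[OF l u]])
  ultimately have d: "d \<in> gideal (mtimes D)" using gideal_near by blast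
  have D: "x \<in> gideal (mtimes D)" if x: "x \<in> D" for x
  proof -
    have "x \<in> gideal (mtimes (insert d D))" using insert.prems x by simp
    from mtimes_insert[OF this] obtain \<nu> e' where
      \<nu>: "\<nu> \<in> maxid" "e' \<in> gideal (mtimes D)" "near x (\<lambda>v. \<nu> v * d v + e' v)" by (elim exE conjE)
    have "(\<lambda>v. \<nu> v * d v + e' v) \<in> gideal (mtimes D)"
      by (rule gideal_add[OF \<nu>(2) gideal_mult[OF d maxid_loc[OF \<nu>(1)]]])
    then show ?thesis using \<nu>(3) by (rule gideal_near)
  qed
  have nz: "near x (\<lambda>_. 0)" if "x \<in> D" for x
    using insert.IH D that by blast
  have "near s (\<lambda>_. 0)" if s: "s \<in> mtimes D" for s
  proof -
    from s obtain a x where ax: "s = (\<lambda>v. a v * x v)" "x \<in> D" unfolding mtimes_def by blast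
    have "near (\<lambda>v. a v * x v) (\<lambda>v. a v * 0)" by (rule near_mult[OF near_refl nz[OF ax(2)]])
    then show ?thesis by (simp add: ax(1))
  qed
  from gideal_near_zero[OF d this] nz show ?case by blast
qed

definition maxid2 where "maxid2 = gideal (mtimes maxid)"

lemma maxid2_mult: "a \<in> maxid \<Longrightarrow> b \<in> maxid \<Longrightarrow> (\<lambda>v. a v * b v) \<in> maxid2"
  unfolding maxid2_def by (rule gideal_base) (auto simp: mtimes_def)

lemma maxid2_act: "a \<in> maxid2 \<Longrightarrow> g \<in> carrier G \<Longrightarrow> (\<lambda>v. a (\<sigma> g v)) \<in> maxid2"
  unfolding maxid2_def
proof (rule gideal_act)
  fix s assume g: "g \<in> carrier G" and "s \<in> mtimes maxid"
  then obtain a b where "s = (\<lambda>v. a v * b v)" "a \<in> maxid" "b \<in> maxid" unfolding mtimes_def by blast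
  then show "(\<lambda>v. s (\<sigma> g v)) \<in> gideal (mtimes maxid)"
    using maxid2_mult[OF maxid_act[OF _ g] maxid_act[OF _ g]] unfolding maxid2_def by simp
qed

text \<open>Write the function as P/Q near \<open>y\<close>; then P vanishes at the coordinates of
  \<open>y\<close> and expands in the coordinate differences, while Q is a unit.\<close>

lemma maxid_generated:
  assumes U: "chart Y U N x" "y \<in> U" and a: "a \<in> maxid"
  shows "a \<in> gideal {\<lambda>v. x j v - x j y | j. j < N}"
proof -
  let ?X = "\<lambda>v. Matrix.vec N (\<lambda>i. x i v)"
  have xloc: "x i \<in> loc" if "i < N" for i
    using chart_open[OF U(1)] U(2) chart_coord[OF swf U(1) that] by (rule locI)
  obtain W where W: "openin (zar Y) W" "y \<in> W" "a \<in> regf Y W" using maxid_loc[OF a] by (rule locE)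
  note op = openin_Int[OF W(1) chart_open[OF U(1)]]
  have "a \<in> regf Y (W \<inter> U)" by (rule regf_subset[OF swf W(1) op _ W(3)]) blast
  from chart_local[OF U(1) op _ _ this, of y] W(2) U(2) obtain V P Q where
    V: "openin (zar Y) V" "y \<in> V" and PQ: "P \<in> polyfun N" "Q \<in> polyfun N"
    "\<forall>v\<in>V. Q (?X v) \<noteq> 0 \<and> a v = P (?X v) / Q (?X v)"
    by auto
  have Qloc: "(\<lambda>v. Q (?X v)) \<in> loc"
    using PQ(2) by (rule polyfun_subst_closed) (use xloc loc_const loc_add loc_mult in auto)
  have Q0: "Q (?X y) \<noteq> 0" and P0: "P (?X y) = 0"
    using PQ(3) V(2) maxid_zero[OF a] by auto
  have "\<exists>C. (\<forall>i<N. C i \<in> loc) \<and> (\<forall>v. P (?X v) - P (Matrix.vec N (\<lambda>i. x i y)) = (\<Sum>i<N. C i v * (x i v - x i y)))"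
    using PQ(1) by (rule polyfun_diff_factor[where h = "\<lambda>i v. x i y"]) (use xloc loc_const loc_add loc_mult in auto)
  then obtain C where C: "\<forall>i<N. C i \<in> loc" "\<forall>v. P (?X v) - P (?X y) = (\<Sum>i<N. C i v * (x i v - x i y))"
    by (elim exE conjE)
  have "(\<lambda>v. \<Sum>i<N. C i v * (x i v - x i y)) \<in> gideal {\<lambda>v. x j v - x j y | j. j < N}"
    by (intro gideal_sum gideal_scaled) (use C(1) in auto)
  from gideal_mult[OF this loc_inverse(1)[OF Qloc Q0]]
  have "(\<lambda>v. inverse (Q (?X v)) * (\<Sum>i<N. C i v * (x i v - x i y))) \<in> gideal {\<lambda>v. x j v - x j y | j. j < N}" .
  moreover have "near a (\<lambda>v. inverse (Q (?X v)) * (\<Sum>i<N. C i v * (x i v - x i y)))"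
    unfolding near_def eventually_near
    by (rule exI[of _ V]) (use V PQ(3) C(2) P0 in \<open>simp add: field_simps\<close>)
  ultimately show ?thesis by (rule gideal_near)
qed

text \<open>A local fraction of polynomials in the coordinates can be moved by \<open>g\<close> only
  as far as the coordinates are. This gives a finite set of generators to which Nakayama's lemma
  applies.\<close>

lemma act_diff_generated:
  assumes U: "chart Y U N x" "y \<in> U" and a: "a \<in> loc" and g: "g \<in> carrier G"
  shows "(\<lambda>v. a (\<sigma> g v) - a v) \<in> gideal {\<lambda>v. x j (\<sigma> g v) - x j v | j. j < N}"
proof -
  let ?X = "\<lambda>v. Matrix.vec N (\<lambda>i. x i v)" and ?X' = "\<lambda>v. Matrix.vec N (\<lambda>i. x i (\<sigma> g v))"
  let ?D = "{\<lambda>v. x j (\<sigma> g v) - x j v | j. j < N}"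
  have xloc: "x i \<in> loc" if "i < N" for i
    using chart_open[OF U(1)] U(2) chart_coord[OF swf U(1) that] by (rule locI)
  have xloc': "(\<lambda>v. x i (\<sigma> g v)) \<in> loc" if "i < N" for i by (rule loc_act[OF xloc[OF that] g])
  obtain W where W: "openin (zar Y) W" "y \<in> W" "a \<in> regf Y W" using a by (rule locE)
  note op = openin_Int[OF W(1) chart_open[OF U(1)]]
  have "a \<in> regf Y (W \<inter> U)" by (rule regf_subset[OF swf W(1) op _ W(3)]) blast
  from chart_local[OF U(1) op _ _ this, of y] W(2) U(2) obtain V P Q where
    V: "openin (zar Y) V" "y \<in> V" and PQ: "P \<in> polyfun N" "Q \<in> polyfun N"
    "\<forall>v\<in>V. Q (?X v) \<noteq> 0 \<and> a v = P (?X v) / Q (?X v)"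
    by auto
  have loc: "(\<lambda>v. P (?X v)) \<in> loc" "(\<lambda>v. Q (?X v)) \<in> loc" "(\<lambda>v. Q (?X' v)) \<in> loc"
    by (rule polyfun_subst_closed[OF PQ(1)] polyfun_subst_closed[OF PQ(2)];
        use xloc xloc' loc_const loc_add loc_mult in simp)+
  have Q0: "Q (?X y) \<noteq> 0" using PQ(3) V(2) by auto
  have X'y: "?X' y = ?X y" by (simp add: y_fixed[OF g])
  have Q0': "Q (?X' y) \<noteq> 0" using Q0 X'y by simp
  have factor: "\<exists>C. (\<forall>i<N. C i \<in> loc) \<and> (\<forall>v. S (?X' v) - S (?X v) = (\<Sum>i<N. C i v * (x i (\<sigma> g v) - x i v)))"
    if "S \<in> polyfun N" for S
    using that by (rule polyfun_diff_factor) (use xloc xloc' loc_const loc_add loc_mult in auto)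
  have ideal: "(\<lambda>v. S (?X' v) - S (?X v)) \<in> gideal ?D" if "S \<in> polyfun N" for S
  proof -
    from factor[OF that] obtain C where C: "\<forall>i<N. C i \<in> loc"
      "\<forall>v. S (?X' v) - S (?X v) = (\<Sum>i<N. C i v * (x i (\<sigma> g v) - x i v))" by (elim exE conjE)
    have "(\<lambda>v. \<Sum>i<N. C i v * (x i (\<sigma> g v) - x i v)) \<in> gideal ?D"
      by (intro gideal_sum gideal_scaled) (use C(1) in auto)
    then show ?thesis using C(2) by simp
  qed
  \<comment> \<open>The quotient rule for differences: P'/Q' - P/Q equals Q(P' - P) - P(Q' - Q)
    divided by QQ'.\<close>
  have "(\<lambda>v. inverse (Q (?X v)) * inverse (Q (?X' v)) * (Q (?X v) * (P (?X' v) - P (?X v)) - P (?X v) * (Q (?X' v) - Q (?X v)))) \<in> gideal ?D"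
    by (intro gideal_mult[OF gideal_diff] gideal_mult ideal loc_mult loc_inverse(1) loc PQ Q0 Q0')
  moreover have "near (\<lambda>v. a (\<sigma> g v) - a v)
     (\<lambda>v. inverse (Q (?X v)) * inverse (Q (?X' v)) * (Q (?X v) * (P (?X' v) - P (?X v)) - P (?X v) * (Q (?X' v) - Q (?X v))))"
  proof -
    have e: "eventually (\<lambda>v. Q (?X v) \<noteq> 0 \<and> a v = P (?X v) / Q (?X v)) (nhdsin (zar Y) y)"
      unfolding eventually_near by (rule exI[of _ V]) (use V PQ(3) in simp)
    from e eventually_act[OF e g] show ?thesis
      unfolding near_def by eventually_elim (simp add: field_simps)
  qed
  ultimately show ?thesis by (rule gideal_near)
qed

text \<open>Averaging over the powers of \<open>g\<close> replaces \<open>a\<close> by \<open>a - a'\<close> with \<open>a'\<close> invariant, so that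
  \<open>(g - 1) a = (g - 1) (a - a')\<close> with \<open>a - a'\<close> in the square of the maximal ideal.\<close>

lemma act_diff_maxid2:
  assumes g: "g \<in> carrier G" and triv: "\<And>a. a \<in> maxid \<Longrightarrow> (\<lambda>v. a (\<sigma> g v) - a v) \<in> maxid2"
    and a: "a \<in> maxid"
  shows "\<exists>b\<in>maxid2. near (\<lambda>v. a (\<sigma> g v) - a v) (\<lambda>v. b (\<sigma> g v) - b v)"
proof -
  define n where "n = card (carrier G)"
  \<comment> \<open>The order of the group replaces the order of \<open>g\<close>: the averaging
    needs only that \<open>g\<close> to the power \<open>n\<close> is the identity and that
    \<open>n\<close> is invertible.\<close>
  have n: "of_nat n \<noteq> (0::'k)" using fin one_closed by (auto simp: n_def card_eq_0_iff)
  have gn: "g [^] n = \<one>" using power_order_eq_one[OF fin g] by (simp add: n_def)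
  let ?s = "\<lambda>i. \<sigma> (g [^] (i::nat))"
  have pow: "?s (Suc i) v = ?s i (\<sigma> g v)" if "v \<in> points Y" for i v
    using act_mult[OF nat_pow_closed[OF g] g that] by simp
  have s0: "?s 0 v = v" "?s n v = v" if "v \<in> points Y" for v
    using act_one[OF that] gn by simp_all
  have d: "(\<lambda>v. a (?s i v) - a v) \<in> maxid2" for i
  proof (induction i)
    case 0
    have "near (\<lambda>v. a (?s 0 v) - a v) (\<lambda>_. 0)" by (rule near_eqI) (simp add: act_one)
    then show ?case unfolding maxid2_def by (rule gideal.zero)
  next
    case (Suc i)
    have "(\<lambda>v. a (?s i v)) \<in> maxid" by (rule maxid_act[OF a nat_pow_closed[OF g]])
    from gideal_add[OF Suc[unfolded maxid2_def] triv[OF this, unfolded maxid2_def]]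
    have "(\<lambda>v. a (?s i (\<sigma> g v)) - a (?s i v) + (a (?s i v) - a v)) \<in> gideal (mtimes maxid)" .
    moreover have "near (\<lambda>v. a (?s (Suc i) v) - a v) (\<lambda>v. a (?s i (\<sigma> g v)) - a (?s i v) + (a (?s i v) - a v))"
      by (rule near_eqI) (simp only: pow diff_add_cancel add_diff_eq)
    ultimately show ?case unfolding maxid2_def by (rule gideal_near)
  qed
  \<comment> \<open>This is \<open>a\<close> minus its average over the powers of \<open>g\<close>,
    written through the differences that are already known to lie in \<open>maxid2\<close>.\<close>
  define b where "b = (\<lambda>v. - inverse (of_nat n) * (\<Sum>i<n. a (?s i v) - a v))"
  have "b \<in> maxid2"
    unfolding b_def maxid2_def by (intro gideal_mult gideal_sum loc_const d[unfolded maxid2_def])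
  moreover have "near (\<lambda>v. a (\<sigma> g v) - a v) (\<lambda>v. b (\<sigma> g v) - b v)"
  proof (rule near_eqI)
    fix v assume v: "v \<in> points Y"
    have bv: "b w = a w - inverse (of_nat n) * (\<Sum>i<n. a (?s i w))" for w
      using n by (simp add: b_def sum_subtractf algebra_simps)
    have "(\<Sum>i<n. a (?s i (\<sigma> g v))) = (\<Sum>i<n. a (?s (Suc i) v))"
      using pow[OF v] by simp
    also have "\<dots> = (\<Sum>i<Suc n. a (?s i v)) - a (?s 0 v)"
      by (subst sum.lessThan_Suc_shift) simp
    also have "\<dots> = (\<Sum>i<n. a (?s i v))" using s0[OF v] by simp
    finally show "a (\<sigma> g v) - a v = b (\<sigma> g v) - b v" unfolding bv by simp
  qed
  ultimately show ?thesis by (intro bexI[of _ b])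
qed

text \<open>Let \<open>?D\<close> consist of the differences of the coordinates under
  \<open>g\<close>. Differences of elements of \<open>maxid2\<close> lie in the maximal ideal times
  \<open>?D\<close>, and by averaging the elements of \<open>?D\<close> are such differences.
  Nakayama's lemma makes \<open>?D\<close> vanish, so \<open>g\<close> fixes a neighbourhood of
  \<open>y\<close>.\<close>

lemma trivial_on_cotangent:
  assumes g: "g \<in> carrier G" and triv: "\<And>a. a \<in> maxid \<Longrightarrow> (\<lambda>v. a (\<sigma> g v) - a v) \<in> maxid2"
  shows "g = \<one>"
proof (rule ccontr)
  assume "g \<noteq> \<one>"
  obtain U N x where U: "y \<in> U" "chart Y U N x" by (rule prevariety_chart[OF prevar y_point])
  let ?D = "{\<lambda>v. x j (\<sigma> g v) - x j v | j. j < N}"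
  have xloc: "x i \<in> loc" if "i < N" for i
    using chart_open[OF U(2)] U(1) chart_coord[OF swf U(2) that] by (rule locI)
  note dideal = act_diff_generated[OF U(2,1) _ g]
  have b: "(\<lambda>v. b (\<sigma> g v) - b v) \<in> gideal (mtimes ?D)" if "b \<in> maxid2" for b
    using that unfolding maxid2_def
  proof (induction rule: gideal.induct)
    case (zero b)
    have "near (\<lambda>v. b (\<sigma> g v) - b v) (\<lambda>_. 0)"
      using zero near_act[OF zero g] unfolding near_def by eventually_elim simp
    then show ?case by (rule gideal.zero)
  next
    case (step b s k d)
    from step.hyps(2) obtain p q where s: "s = (\<lambda>v. p v * q v)" "p \<in> maxid" "q \<in> maxid"
      unfolding mtimes_def by blast
    \<comment> \<open>The Leibniz rule for the difference operator of \<open>g\<close> on a product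
      of three factors: in each of the three terms a factor \<open>p\<close> or \<open>q\<close>,
      possibly translated, stays in front and lies in the maximal ideal.\<close>
    have 1: "(\<lambda>v. k (\<sigma> g v) * p (\<sigma> g v) * (q (\<sigma> g v) - q v)) \<in> gideal (mtimes ?D)"
      by (intro mtimes_gideal dideal maxid_mult' loc_act maxid_act maxid_loc s g step.hyps)
    have 2: "(\<lambda>v. k (\<sigma> g v) * q v * (p (\<sigma> g v) - p v)) \<in> gideal (mtimes ?D)"
      by (intro mtimes_gideal dideal maxid_mult' loc_act maxid_loc s g step.hyps)
    have 3: "(\<lambda>v. p v * q v * (k (\<sigma> g v) - k v)) \<in> gideal (mtimes ?D)"
      by (intro mtimes_gideal dideal maxid_mult maxid_loc s g step.hyps)
    have "(\<lambda>v. k (\<sigma> g v) * p (\<sigma> g v) * (q (\<sigma> g v) - q v) + (k (\<sigma> g v) * q v * (p (\<sigma> g v) - p v)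
       + (p v * q v * (k (\<sigma> g v) - k v) + (b (\<sigma> g v) - b v)))) \<in> gideal (mtimes ?D)"
      by (intro gideal_add 1 2 3 step.IH)
    moreover have "near (\<lambda>v. d (\<sigma> g v) - d v) (\<lambda>v. k (\<sigma> g v) * p (\<sigma> g v) * (q (\<sigma> g v) - q v) + (k (\<sigma> g v) * q v * (p (\<sigma> g v) - p v)
       + (p v * q v * (k (\<sigma> g v) - k v) + (b (\<sigma> g v) - b v))))"
      using step.hyps(4) near_act[OF step.hyps(4) g] unfolding near_def s(1)
      by eventually_elim (simp add: algebra_simps)
    ultimately show ?case by (rule gideal_near)
  qed
  have "\<forall>d\<in>?D. near d (\<lambda>_. 0)"
  proof (rule nakayama, goal_cases)
    case 1
    have "?D = (\<lambda>j v. x j (\<sigma> g v) - x j v) ` {..<N}" by auto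
    then show ?case by simp
  next
    case 2
    show ?case
    proof
      fix d assume "d \<in> ?D"
      then obtain j where j: "j < N" "d = (\<lambda>v. x j (\<sigma> g v) - x j v)" by blast
      have "(\<lambda>v. x j v - x j y) \<in> maxid"
        by (rule maxidI[OF loc_diff[OF xloc[OF j(1)] loc_const]]) simp
      from act_diff_maxid2[OF g triv this] obtain b' where "b' \<in> maxid2"
        "near (\<lambda>v. x j (\<sigma> g v) - x j y - (x j v - x j y)) (\<lambda>v. b' (\<sigma> g v) - b' v)" by blast
      then show "d \<in> gideal (mtimes ?D)"
        using gideal_near[OF b] by (simp add: j(2))
    qed
  qed
  then have near: "near (\<lambda>v. x j (\<sigma> g v) - x j v) (\<lambda>_. 0)" if "j < N" for j using that by blast
  have "eventually (\<lambda>v. \<forall>j\<in>{..<N}. x j (\<sigma> g v) - x j v = 0) (nhdsin (zar Y) y)"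
    by (rule eventually_ball_finite) (use near in \<open>auto simp: near_def\<close>)
  moreover have Uev: "eventually (\<lambda>v. v \<in> U) (nhdsin (zar Y) y)"
    unfolding eventually_near using chart_open[OF U(2)] U(1) by blast
  moreover note eventually_act[OF Uev g]
  ultimately have "eventually (\<lambda>v. \<sigma> g v = v) (nhdsin (zar Y) y)"
  proof eventually_elim
    case (elim v)
    show ?case by (rule chart_separates[OF U(2) elim(3,2)]) (use elim(1) in auto)
  qed
  then obtain S where "openin (zar Y) S" "y \<in> S" "\<forall>v\<in>S. \<sigma> g v = v"
    unfolding eventually_near by (elim exE conjE)
  then show False using faithful[OF g \<open>g \<noteq> \<one>\<close>, of S] by blast
qed

end

lemma card_roots_of_unity_le:
  assumes "p > 0"
  shows "finite {z::'k::field_char_0. z ^ p = 1}" "card {z::'k::field_char_0. z ^ p = 1} \<le> p"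
proof -
  let ?p = "monom 1 p - 1 :: 'k poly"
  have "poly ?p 0 \<noteq> 0" using assms by (simp add: poly_monom power_0_left)
  then have nz: "?p \<noteq> 0" by auto
  have eq: "{z. poly ?p z = 0} = {z. z ^ p = 1}" by (simp add: poly_monom)
  show "finite {z::'k::field_char_0. z ^ p = 1}" using poly_roots_finite[OF nz] unfolding eq .
  have "card {z. poly ?p z = 0} \<le> degree ?p" by (rule card_poly_roots_bound[OF nz])
  also have "\<dots> \<le> p" by (rule degree_diff_le) (simp_all add: degree_monom_le)
  finally show "card {z::'k::field_char_0. z ^ p = 1} \<le> p" unfolding eq .
qed

section \<open>Eigenbasis of the cotangent space and the dual tangent vectors\<close>

context action_fixed_point
begin

definition cotangent_span :: "('q \<Rightarrow> 'k) set \<Rightarrow> ('q \<Rightarrow> 'k) \<Rightarrow> bool" where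
  "cotangent_span F a \<longleftrightarrow> (\<exists>lam. (\<lambda>v. a v - (\<Sum>e\<in>F. lam e * e v)) \<in> maxid2)"

lemma maxid2_closed:
  "near b a \<Longrightarrow> a \<in> maxid2 \<Longrightarrow> b \<in> maxid2"
  "a \<in> maxid2 \<Longrightarrow> b \<in> maxid2 \<Longrightarrow> (\<lambda>v. a v + b v) \<in> maxid2"
  "a \<in> maxid2 \<Longrightarrow> b \<in> maxid2 \<Longrightarrow> (\<lambda>v. a v - b v) \<in> maxid2"
  "a \<in> maxid2 \<Longrightarrow> k \<in> loc \<Longrightarrow> (\<lambda>v. k v * a v) \<in> maxid2"
  "(\<lambda>_. 0) \<in> maxid2"
  unfolding maxid2_def
  by (erule (1) gideal_near[rotated], erule (1) gideal_add[rotated], erule (1) gideal_diff, erule (1) gideal_mult, rule gideal_zero)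

lemma cotangent_span_near: "cotangent_span F a \<Longrightarrow> near b a \<Longrightarrow> cotangent_span F b"
  unfolding cotangent_span_def
proof (elim exE)
  fix lam assume b: "near b a" and a: "(\<lambda>v. a v - (\<Sum>e\<in>F. lam e * e v)) \<in> maxid2"
  have "near (\<lambda>v. b v - (\<Sum>e\<in>F. lam e * e v)) (\<lambda>v. a v - (\<Sum>e\<in>F. lam e * e v))"
    using b unfolding near_def by eventually_elim simp
  then show "\<exists>lam. (\<lambda>v. b v - (\<Sum>e\<in>F. lam e * e v)) \<in> maxid2"
    using maxid2_closed(1) a by blast
qed

lemma cotangent_span_add:
  assumes "cotangent_span F a" "cotangent_span F b"
  shows "cotangent_span F (\<lambda>v. a v + b v)"
proof -
  from assms obtain lam \<mu> where "(\<lambda>v. a v - (\<Sum>e\<in>F. lam e * e v)) \<in> maxid2" "(\<lambda>v. b v - (\<Sum>e\<in>F. \<mu> e * e v)) \<in> maxid2"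
    unfolding cotangent_span_def by (elim exE)
  from maxid2_closed(2)[OF this] have "(\<lambda>v. a v + b v - (\<Sum>e\<in>F. (lam e + \<mu> e) * e v)) \<in> maxid2"
    by (simp add: distrib_right sum.distrib algebra_simps)
  then show ?thesis unfolding cotangent_span_def by (rule exI[of _ "\<lambda>e. lam e + \<mu> e"])
qed

lemma cotangent_span_scale:
  assumes "cotangent_span F a"
  shows "cotangent_span F (\<lambda>v. k * a v)"
proof -
  from assms obtain lam where "(\<lambda>v. a v - (\<Sum>e\<in>F. lam e * e v)) \<in> maxid2"
    unfolding cotangent_span_def by (elim exE)
  from maxid2_closed(4)[OF this loc_const[of k]] have "(\<lambda>v. k * a v - (\<Sum>e\<in>F. (k * lam e) * e v)) \<in> maxid2"
    by (simp add: right_diff_distrib sum_distrib_left mult.assoc)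
  then show ?thesis unfolding cotangent_span_def by (rule exI[of _ "\<lambda>e. k * lam e"])
qed

lemma cotangent_span_maxid2: "a \<in> maxid2 \<Longrightarrow> cotangent_span F a"
  unfolding cotangent_span_def by (rule exI[of _ "\<lambda>_. 0"]) simp

lemma cotangent_span_base: "finite F \<Longrightarrow> e \<in> F \<Longrightarrow> cotangent_span F e"
  unfolding cotangent_span_def
proof (rule exI[of _ "\<lambda>e'. if e' = e then 1 else 0"])
  assume "finite F" "e \<in> F"
  then have "(\<Sum>e'\<in>F. (if e' = e then 1 else 0) * e' v) = e v" for v
    by (simp add: if_distribR if_distrib cong: if_cong)
  then show "(\<lambda>v. e v - (\<Sum>e'\<in>F. (if e' = e then 1 else 0) * e' v)) \<in> maxid2"
    using maxid2_closed(5) by simp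
qed

lemma cotangent_span_sum: "(\<And>i. i \<in> I \<Longrightarrow> cotangent_span F (a i)) \<Longrightarrow> cotangent_span F (\<lambda>v. \<Sum>i\<in>I. a i v)"
  by (induction I rule: infinite_finite_induct)
    (simp_all add: cotangent_span_add cotangent_span_maxid2[OF maxid2_closed(5)])

text \<open>Project the functions \<open>x j v - x j y\<close> to all characters. The projections
  still vanish at \<open>y\<close> because the group fixes this point, and the original functions
  are their sums.\<close>

lemma ex_eigen_generators:
  "\<exists>E. finite E \<and> E \<subseteq> maxid \<and> (\<forall>e\<in>E. \<exists>a. eigen (chi a) e) \<and> (\<forall>b\<in>maxid. cotangent_span E b)"
proof -
  obtain U N x where U: "y \<in> U" "chart Y U N x" by (rule prevariety_chart[OF prevar y_point])
  have Uo: "openin (zar Y) U" by (rule chart_open[OF U(2)])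
  have xreg: "x j \<in> regf Y U" if "j < N" for j using chart_coord[OF swf U(2) that] .
  define t where "t j = (\<lambda>v. x j v - x j y)" for j
  have treg: "t j \<in> regf Y U" if "j < N" for j
    using regf_add[OF swf Uo xreg[OF that] regf_const[OF swf Uo, of "- x j y"]] by (simp add: t_def)
  define e where "e p = (\<lambda>v. inverse (of_nat (card chars)) * proj (chi (snd p)) (t (fst p)) v)" for p
  define E where "E = e ` ({..<N} \<times> chars)"
  have finE: "finite E" unfolding E_def using finite_chars by simp
  have em: "e (j, a) \<in> maxid" if "j < N" for j a
  proof (rule maxidI)
    have "y \<in> invariant_core U" unfolding invariant_core_def using y_point y_fixed U(1) by simp
    then show "e (j, a) \<in> loc"
      unfolding e_def
      by (intro loc_mult loc_const locI[OF open_invariant_core[OF Uo]] regf_proj[OF Uo]) (simp_all add: treg that)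
    have "t j (\<sigma> g y) = 0" if "g \<in> carrier G" for g using y_fixed[OF that] by (simp add: t_def)
    then show "e (j, a) y = 0" by (simp add: e_def proj_def)
  qed
  have ee: "eigen (chi a) (e (j, a))" for j a
    using proj_eigen[OF character_chi, of a "t j"] unfolding eigen_def e_def by simp
  have tspan: "cotangent_span E (t j)" if j: "j < N" for j
  proof -
    have "cotangent_span E (\<lambda>v. \<Sum>a\<in>chars. e (j, a) v)"
      by (rule cotangent_span_sum, rule cotangent_span_base[OF finE]) (auto simp: E_def j)
    moreover have "near (t j) (\<lambda>v. \<Sum>a\<in>chars. e (j, a) v)"
    proof (rule near_eqI)
      fix v assume "v \<in> points Y"
      then show "t j v = (\<Sum>a\<in>chars. e (j, a) v)"
        using card_chars_pos by (simp add: e_def sum_distrib_left[symmetric] proj_sum)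
    qed
    ultimately show ?thesis by (rule cotangent_span_near)
  qed
  have "cotangent_span E b" if b: "b \<in> gideal {t j | j. j < N}" for b
    using b
  proof (induction rule: gideal.induct)
    case (zero b)
    show ?case by (rule cotangent_span_near[OF cotangent_span_maxid2[OF maxid2_closed(5)] zero])
  next
    case (step b s k d)
    from step.hyps(2) obtain j where j: "j < N" "s = t j" by blast
    have "t j \<in> maxid" using locI[OF Uo U(1) treg[OF j(1)]] by (intro maxidI) (simp_all add: t_def)
    \<comment> \<open>A coefficient may be replaced by its value at \<open>y\<close>: the rest of
      the product lies in \<open>maxid2\<close>.\<close>
    moreover have "(\<lambda>v. k v - k y) \<in> maxid"
      by (rule maxidI[OF loc_diff[OF step.hyps(3) loc_const]]) simp
    ultimately have "(\<lambda>v. (k v - k y) * t j v) \<in> maxid2" using maxid2_mult by blast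
    then have "cotangent_span E (\<lambda>v. b v + (k y * t j v + (k v - k y) * t j v))"
      by (intro cotangent_span_add step.IH cotangent_span_scale tspan j cotangent_span_maxid2)
    then have "cotangent_span E (\<lambda>v. b v + k v * s v)"
      by (simp add: j(2) left_diff_distrib)
    then show ?case using step.hyps(4) by (rule cotangent_span_near)
  qed
  then have "cotangent_span E b" if "b \<in> maxid" for b
    using maxid_generated[OF U(2,1) that] by (simp add: t_def)
  moreover have "E \<subseteq> maxid"
    unfolding E_def using em by auto
  moreover have "\<forall>e\<in>E. \<exists>a. eigen (chi a) e"
  proof
    fix e' assume "e' \<in> E"
    then obtain j a where "e' = e (j, a)" unfolding E_def by auto
    then show "\<exists>a. eigen (chi a) e'" using ee[of a j] by auto
  qed
  ultimately show ?thesis using finE by blast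
qed

text \<open>A generating set of least cardinality is independent modulo \<open>maxid2\<close>, since
  a relation would allow one generator to be dropped. The eigenvectors are thinned out, never
  recombined, so they remain eigenvectors.\<close>

lemma ex_eigen_basis:
  "\<exists>F. finite F \<and> F \<subseteq> maxid \<and> (\<forall>e\<in>F. \<exists>a. eigen (chi a) e) \<and> (\<forall>b\<in>maxid. cotangent_span F b) \<and>
    (\<forall>lam. (\<lambda>v. \<Sum>e\<in>F. lam e * e v) \<in> maxid2 \<longrightarrow> (\<forall>e\<in>F. lam e = 0))"
proof -
  let ?G = "\<lambda>E. finite E \<and> E \<subseteq> maxid \<and> (\<forall>e\<in>E. \<exists>a. eigen (chi a) e) \<and> (\<forall>b\<in>maxid. cotangent_span E b)"
  obtain E0 where "?G E0" using ex_eigen_generators by (elim exE)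
  from ex_has_least_nat[of ?G, OF this, of card]
  obtain F where F0: "?G F \<and> (\<forall>E. ?G E \<longrightarrow> card F \<le> card E)" by (elim exE)
  note F = conjunct1[OF F0] conjunct2[OF F0, THEN spec, THEN mp]
  have "lam f = 0" if rel: "(\<lambda>v. \<Sum>e\<in>F. lam e * e v) \<in> maxid2" and f: "f \<in> F" for lam f
  proof (rule ccontr)
    assume nz: "lam f \<noteq> 0"
    have fin: "finite F" using F(1) by blast
    have "cotangent_span (F - {f}) b" if b: "b \<in> maxid" for b
    proof -
      from F(1) b obtain \<mu> where \<mu>: "(\<lambda>v. b v - (\<Sum>e\<in>F. \<mu> e * e v)) \<in> maxid2"
        unfolding cotangent_span_def by blast
      let ?k = "\<mu> f / lam f"
      have A: "(\<lambda>v. (b v - (\<Sum>e\<in>F. \<mu> e * e v)) + ?k * (\<Sum>e\<in>F. lam e * e v)) \<in> maxid2"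
        by (rule maxid2_closed(2)[OF \<mu> maxid2_closed(4)[OF rel loc_const]])
      have eq: "(b v - (\<Sum>e\<in>F. \<mu> e * e v)) + ?k * (\<Sum>e\<in>F. lam e * e v) =
          b v - (\<Sum>e\<in>F-{f}. (\<mu> e - ?k * lam e) * e v)" for v
        using nz by (simp add: sum.remove[OF fin f] sum_subtractf left_diff_distrib sum_distrib_left algebra_simps)
      have "(\<lambda>v. b v - (\<Sum>e\<in>F-{f}. (\<mu> e - ?k * lam e) * e v)) \<in> maxid2"
        using A unfolding eq .
      then show ?thesis unfolding cotangent_span_def by (rule exI[of _ "\<lambda>e. \<mu> e - ?k * lam e"])
    qed
    then have "card F \<le> card (F - {f})" using F(1) by (intro F(2)) auto
    moreover have "card F > 0" using fin f by (auto simp: card_gt_0_iff)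
    ultimately show False using f fin by (simp add: card_Diff_singleton)
  qed
  then show ?thesis using F(1) by blast
qed

lemma germ_mem: "(V, b) \<in> germ Y y U a \<longleftrightarrow> openin (zar Y) V \<and> y \<in> V \<and> b \<in> regf Y V \<and>
  (\<exists>W. openin (zar Y) W \<and> y \<in> W \<and> W \<subseteq> U \<inter> V \<and> (\<forall>v\<in>W. a v = b v))"
  by (simp add: germ_def)

lemma germ_near: "(V, b) \<in> germ Y y U a \<Longrightarrow> b \<in> loc \<and> near b a"
proof -
  assume "(V, b) \<in> germ Y y U a"
  then obtain W where W: "openin (zar Y) V" "y \<in> V" "b \<in> regf Y V"
    "openin (zar Y) W" "y \<in> W" "\<forall>v\<in>W. a v = b v"
    unfolding germ_mem by (elim conjE exE)
  have "near b a" unfolding near_def eventually_near by (rule exI[of _ W]) (use W in simp)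
  then show ?thesis using locI[OF W(1,2,3)] by simp
qed

lemma germ_self: "openin (zar Y) U \<Longrightarrow> y \<in> U \<Longrightarrow> a \<in> regf Y U \<Longrightarrow> (U, a) \<in> germ Y y U a"
  unfolding germ_mem by auto

text \<open>The coefficients of \<open>a v - a y\<close> with respect to \<open>F\<close>, modulo
  \<open>maxid2\<close>, are derivations at \<open>y\<close>, and they form the family dual to
  \<open>F\<close>.\<close>

lemma card_le_dim_tangent_space:
  assumes F: "finite F" "F \<subseteq> maxid" "\<forall>b\<in>maxid. cotangent_span F b"
    and ind: "\<forall>lam. (\<lambda>v. \<Sum>e\<in>F. lam e * e v) \<in> maxid2 \<longrightarrow> (\<forall>e\<in>F. lam e = 0)"
    and dim: "scale_fun.dim (tangent_space Y y) > 0"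
  shows "card F \<le> scale_fun.dim (tangent_space Y y)"
proof -
  define P where "P a lam \<longleftrightarrow> (\<lambda>v. a v - a y - (\<Sum>e\<in>F. lam e * e v)) \<in> maxid2" for a and lam :: "('q \<Rightarrow> 'k) \<Rightarrow> 'k"
  define co where "co a = (SOME lam. P a lam)" for a
  have P_ex: "P a (co a)" if "a \<in> loc" for a
  proof -
    have "(\<lambda>v. a v - a y) \<in> maxid" by (rule maxidI[OF loc_diff[OF that loc_const]]) simp
    from bspec[OF F(3) this] have "\<exists>lam. P a lam" unfolding cotangent_span_def P_def .
    then show ?thesis unfolding co_def by (rule someI_ex)
  qed
  have P_unique: "lam e = \<mu> e" if "P a lam" "P a \<mu>" "e \<in> F" for a lam \<mu> e
  proof -
    have "(\<lambda>v. \<Sum>e\<in>F. (\<mu> e - lam e) * e v) \<in> maxid2"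
      using maxid2_closed(3)[OF that(1,2)[unfolded P_def]] by (simp add: sum_subtractf left_diff_distrib)
    then show ?thesis using ind that(3) by force
  qed
  have P_near: "P b lam" if "P a lam" "near b a" for a b lam
  proof -
    have "near (\<lambda>v. b v - b y - (\<Sum>e\<in>F. lam e * e v)) (\<lambda>v. a v - a y - (\<Sum>e\<in>F. lam e * e v))"
      using that(2) unfolding near_def by eventually_elim (simp add: near_at[OF that(2)])
    then show ?thesis using that(1) unfolding P_def by (rule maxid2_closed(1))
  qed
  have co_eq: "co a e = lam e" if "a \<in> loc" "P a lam" "e \<in> F" for a lam e
    using P_unique P_ex that by blast
  define germs where "germs = {germ Y y U f | U f. openin (zar Y) U \<and> y \<in> U \<and> f \<in> regf Y U}"
  \<comment> \<open>The value is read off from an arbitrary representative; \<open>P_near\<close>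
    and the uniqueness of coefficients make it independent of the choice.\<close>
  define D where "D e s = (if s \<in> germs then co (snd (SOME p. p \<in> s)) e else 0)" for e s
  have D_germ: "D e (germ Y y U a) = co a e"
    if U: "openin (zar Y) U" "y \<in> U" "a \<in> regf Y U" and e: "e \<in> F" for e U a
  proof -
    have "(SOME p. p \<in> germ Y y U a) \<in> germ Y y U a" by (rule someI[of "\<lambda>p. p \<in> germ Y y U a", OF germ_self[OF U]])
    then obtain V b where b: "(SOME p. p \<in> germ Y y U a) = (V, b)" "(V, b) \<in> germ Y y U a"
      by (metis surj_pair)
    have bl: "b \<in> loc" "near b a" using germ_near[OF b(2)] by auto
    have "P b (co a)" using P_near[OF P_ex[OF locI[OF U]] bl(2)] .
    then have "co b e = co a e" using co_eq[OF bl(1) _ e] by blast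
    then show ?thesis unfolding D_def germs_def using U b(1) by auto
  qed
  have D_tangent: "D e \<in> tangent_space Y y" if e: "e \<in> F" for e
    unfolding tangent_space_def
  proof (intro CollectI conjI allI impI ballI)
    show "D e s = 0" if "s \<notin> {germ Y y U f |U f. openin (zar Y) U \<and> y \<in> U \<and> f \<in> regf Y U}" for s
    proof -
      have "s \<notin> germs" using that unfolding germs_def .
      then show ?thesis by (simp add: D_def)
    qed
    fix U assume U: "openin (zar Y) U \<and> y \<in> U"
    note U1 = conjunct1[OF U] and U2 = conjunct2[OF U]
    show "D e (germ Y y U (\<lambda>_. k)) = 0" for k
    proof -
      have "P (\<lambda>_. k) (\<lambda>_. 0)" unfolding P_def using maxid2_closed(5) by simp
      then show ?thesis
        using D_germ[OF U1 U2 regf_const[OF swf U1] e] co_eq[OF loc_const _ e, of k "\<lambda>_. 0"] by simp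
    qed
    fix a b assume a: "a \<in> regf Y U" and b: "b \<in> regf Y U"
    note al = locI[OF U1 U2 a] and bl = locI[OF U1 U2 b]
    have Pa: "(\<lambda>v. a v - a y - (\<Sum>e\<in>F. co a e * e v)) \<in> maxid2" using P_ex[OF al] unfolding P_def .
    have Pb: "(\<lambda>v. b v - b y - (\<Sum>e\<in>F. co b e * e v)) \<in> maxid2" using P_ex[OF bl] unfolding P_def .
    have "P (\<lambda>v. a v + b v) (\<lambda>e. co a e + co b e)"
      using maxid2_closed(2)[OF Pa Pb] unfolding P_def by (simp add: distrib_right sum.distrib algebra_simps)
    then show "D e (germ Y y U (\<lambda>v. a v + b v)) = D e (germ Y y U a) + D e (germ Y y U b)"
      using D_germ[OF U1 U2 _ e] regf_add[OF swf U1 a b] a b co_eq[OF loc_add[OF al bl] _ e] by simp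
    have am: "(\<lambda>v. a v - a y) \<in> maxid" by (rule maxidI[OF loc_diff[OF al loc_const]]) simp
    have bm: "(\<lambda>v. b v - b y) \<in> maxid" by (rule maxidI[OF loc_diff[OF bl loc_const]]) simp
    \<comment> \<open>The product rule: \<open>a v * b v - a y * b y\<close> differs from the linear
      terms by a product of two elements of \<open>maxid\<close>, which vanishes modulo
      \<open>maxid2\<close>.\<close>
    have "(\<lambda>v. (a v - a y) * (b v - b y) + (a y * (b v - b y - (\<Sum>e\<in>F. co b e * e v)) + b y * (a v - a y - (\<Sum>e\<in>F. co a e * e v)))) \<in> maxid2"
      by (intro maxid2_closed(2,4) maxid2_mult am bm Pa Pb loc_const)
    moreover have "(a v - a y) * (b v - b y) + (a y * (b v - b y - (\<Sum>e\<in>F. co b e * e v)) + b y * (a v - a y - (\<Sum>e\<in>F. co a e * e v)))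
      = a v * b v - a y * b y - (\<Sum>e\<in>F. (a y * co b e + b y * co a e) * e v)" for v
    proof -
      have "(\<Sum>e\<in>F. (a y * co b e + b y * co a e) * e v) = a y * (\<Sum>e\<in>F. co b e * e v) + b y * (\<Sum>e\<in>F. co a e * e v)"
        by (simp add: distrib_right sum.distrib sum_distrib_left mult.assoc)
      then show ?thesis by (simp add: algebra_simps)
    qed
    ultimately have "P (\<lambda>v. a v * b v) (\<lambda>e. a y * co b e + b y * co a e)"
      unfolding P_def by simp
    then show "D e (germ Y y U (\<lambda>v. a v * b v)) = a y * D e (germ Y y U b) + b y * D e (germ Y y U a)"
      using D_germ[OF U1 U2 _ e] regf_mult[OF swf U1 a b] a b co_eq[OF loc_mult[OF al bl] _ e] by simp
  qed
  have "\<forall>f\<in>F. \<exists>U. openin (zar Y) U \<and> y \<in> U \<and> f \<in> regf Y U"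
    using F(2) unfolding maxid_def loc_def by auto
  from bchoice[OF this] obtain dom where dom: "\<forall>f\<in>F. openin (zar Y) (dom f) \<and> y \<in> dom f \<and> f \<in> regf Y (dom f)" ..
  have delta: "D e (germ Y y (dom f) f) = (if e = f then 1 else 0)" if e: "e \<in> F" and f: "f \<in> F" for e f
  proof -
    have fm: "f \<in> maxid" using F(2) f by blast
    have "(\<Sum>e\<in>F. (if e = f then 1 else 0) * e v) = f v" for v
      using F(1) f by (simp add: if_distribR if_distrib cong: if_cong)
    then have "P f (\<lambda>e. if e = f then 1 else 0)"
      unfolding P_def using maxid_zero[OF fm] maxid2_closed(5) by simp
    then show ?thesis
      using D_germ[of "dom f" f e] dom f e co_eq[OF maxid_loc[OF fm] _ e] by simp
  qed
  have inj: "inj_on D F"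
  proof (rule inj_onI)
    fix e f assume *: "e \<in> F" "f \<in> F" "D e = D f"
    show "e = f"
      using delta[OF *(1) *(1)] delta[OF *(2) *(1)] unfolding *(3) by (auto split: if_splits)
  qed
  have indep: "scale_fun.independent (D ` F)"
  proof
    assume "scale_fun.dependent (D ` F)"
    then obtain u where u: "\<exists>w\<in>D ` F. u w \<noteq> 0" "(\<Sum>w\<in>D ` F. scale_fun (u w) w) = 0"
      using scale_fun.dependent_finite[of "D ` F"] F(1) by auto
    have u0: "(\<Sum>e\<in>F. scale_fun (u (D e)) (D e)) = 0"
      using u(2) by (simp add: sum.reindex[OF inj])
    have "u (D f) = 0" if f: "f \<in> F" for f
    proof -
      have "(\<Sum>e\<in>F. scale_fun (u (D e)) (D e)) (germ Y y (dom f) f) = (\<Sum>e\<in>F. u (D e) * D e (germ Y y (dom f) f))"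
        by (simp add: sum_fun_apply scale_fun_def)
      also have "\<dots> = (\<Sum>e\<in>F. if e = f then u (D e) else 0)"
        by (intro sum.cong refl) (simp add: delta f)
      also have "\<dots> = u (D f)" using F(1) f by simp
      finally show ?thesis unfolding u0 by simp
    qed
    then show False using u(1) by blast
  qed
  obtain B where B: "B \<subseteq> tangent_space Y y" "scale_fun.independent B" "tangent_space Y y \<subseteq> scale_fun.span B"
    "card B = scale_fun.dim (tangent_space Y y)"
    by (rule scale_fun.basis_exists)
  \<comment> \<open>Both \<open>card\<close> and the dimension are 0 in the infinite case, so the
    positive dimension is what guarantees a finite basis.\<close>
  have "finite B" using B(4) dim by (metis card.infinite less_irrefl)
  then have "card (D ` F) \<le> card B"
    using scale_fun.independent_span_bound[OF _ indep, of B] D_tangent B(3) by blast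
  then show ?thesis using B(4) card_image[OF inj] by simp
qed

text \<open>There are \<open>p ^ r\<close> elements killed by \<open>p\<close>, and each is
  determined by the values of \<open>card F\<close> characters, all of them p-th roots of unity;
  hence \<open>p ^ r\<close> \<le> \<open>p ^ card F\<close>.\<close>

lemma rank_le_dim_tangent_space:
  assumes p: "prime p" "\<And>i. i < r \<Longrightarrow> p dvd m i" and dim: "scale_fun.dim (tangent_space Y y) > 0"
  shows "r \<le> scale_fun.dim (tangent_space Y y)"
proof -
  have p1: "p > 1" using p(1) by (rule prime_gt_1_nat)
  obtain F where F: "finite F" "F \<subseteq> maxid" "\<forall>e\<in>F. \<exists>a. eigen (chi a) e" "\<forall>b\<in>maxid. cotangent_span F b"
    "\<forall>lam. (\<lambda>v. \<Sum>e\<in>F. lam e * e v) \<in> maxid2 \<longrightarrow> (\<forall>e\<in>F. lam e = 0)"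
    using ex_eigen_basis by (elim exE conjE)
  from bchoice[OF F(3)] obtain ch where ch: "\<forall>e\<in>F. eigen (chi (ch e)) e" ..
  have trivial: "g = \<one>" if g: "g \<in> carrier G" and ch1: "\<And>e. e \<in> F \<Longrightarrow> chi (ch e) g = 1" for g
  proof (rule trivial_on_cotangent[OF g])
    fix a assume a: "a \<in> maxid"
    then obtain lam where lam: "(\<lambda>v. a v - (\<Sum>e\<in>F. lam e * e v)) \<in> maxid2"
      using F(4) unfolding cotangent_span_def by blast
    from maxid2_closed(3)[OF maxid2_act[OF lam g] lam]
    have *: "(\<lambda>v. a (\<sigma> g v) - (\<Sum>e\<in>F. lam e * e (\<sigma> g v)) - (a v - (\<Sum>e\<in>F. lam e * e v))) \<in> maxid2" .
    show "(\<lambda>v. a (\<sigma> g v) - a v) \<in> maxid2"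
    proof (rule maxid2_closed(1)[OF near_eqI *])
      fix v assume v: "v \<in> points Y"
      have "e (\<sigma> g v) = e v" if "e \<in> F" for e
        using ch that ch1[OF that] g v unfolding eigen_def by force
      then have "(\<Sum>e\<in>F. lam e * e (\<sigma> g v)) = (\<Sum>e\<in>F. lam e * e v)"
        by (intro sum.cong refl) simp
      then show "a (\<sigma> g v) - a v = a (\<sigma> g v) - (\<Sum>e\<in>F. lam e * e (\<sigma> g v)) - (a v - (\<Sum>e\<in>F. lam e * e v))"
        by simp
    qed
  qed
  let ?B = "{..<r} \<rightarrow>\<^sub>E {..<p}" and ?T = "F \<rightarrow>\<^sub>E {z::'k. z ^ p = 1}"
  \<comment> \<open>In a cyclic group of order \<open>m i\<close> the elements killed by
    \<open>p\<close> are the multiples of \<open>m i div p\<close>.\<close>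
  have "\<forall>b\<in>?B. \<exists>g. g \<in> carrier G \<and> (\<forall>i<r. c g i = b i * (m i div p))"
  proof
    fix b assume b: "b \<in> ?B"
    have "b i * (m i div p) < m i" if i: "i < r" for i
    proof -
      have "b i < p" using b i by auto
      then have "b i * (m i div p) < p * (m i div p)"
        using m_pos[OF i] p(2)[OF i] p1 by (intro mult_strict_right_mono) (auto elim!: dvdE)
      then show ?thesis using p(2)[OF i] by simp
    qed
    then show "\<exists>g. g \<in> carrier G \<and> (\<forall>i<r. c g i = b i * (m i div p))"
      using c_surj[of "\<lambda>i. b i * (m i div p)"] by blast
  qed
  from bchoice[OF this] obtain \<gamma> where \<gamma>: "\<forall>b\<in>?B. \<gamma> b \<in> carrier G \<and> (\<forall>i<r. c (\<gamma> b) i = b i * (m i div p))" ..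
  have tors: "chi a (\<gamma> b) ^ p = 1" if b: "b \<in> ?B" for a b
  proof -
    have "psi i (\<gamma> b) ^ p = 1" if i: "i < r" for i
    proof -
      have "c (\<gamma> b) i * p = b i * m i" using \<gamma> b i p(2)[OF i] by (simp add: mult.assoc)
      then have "m i dvd c (\<gamma> b) i * p" by simp
      then show ?thesis using primitive[OF i] by (simp add: psi_def power_mult[symmetric])
    qed
    then have "(psi i (\<gamma> b) ^ a i) ^ p = 1" if "i < r" for i
    proof -
      have "(psi i (\<gamma> b) ^ a i) ^ p = (psi i (\<gamma> b) ^ p) ^ a i"
        by (simp only: power_mult[symmetric] mult.commute)
      then show ?thesis using \<open>\<And>i. i < r \<Longrightarrow> psi i (\<gamma> b) ^ p = 1\<close>[OF that] by simp
    qed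
    then show ?thesis unfolding chi_def by (simp add: prod_power_distrib)
  qed
  let ?h = "\<lambda>b. restrict (\<lambda>e. chi (ch e) (\<gamma> b)) F"
  have inj: "inj_on ?h ?B"
  proof (rule inj_onI)
    fix b b' assume b: "b \<in> ?B" and b': "b' \<in> ?B" and eq: "?h b = ?h b'"
    have \<gamma>G: "\<gamma> b \<in> carrier G" "\<gamma> b' \<in> carrier G" using \<gamma> b b' by auto
    have "\<gamma> b \<otimes> inv (\<gamma> b') = \<one>"
    proof (rule trivial)
      show "\<gamma> b \<otimes> inv (\<gamma> b') \<in> carrier G" using \<gamma>G by simp
      fix e assume e: "e \<in> F"
      have "?h b e = ?h b' e" using eq by (rule fun_cong)
      then have 1: "chi (ch e) (\<gamma> b) = chi (ch e) (\<gamma> b')" using e by simp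
      note hom = character_chi[of "ch e", unfolded character_def, THEN conjunct2, THEN bspec, THEN bspec]
      moreover have "chi (ch e) (\<gamma> b' \<otimes> inv (\<gamma> b')) = chi (ch e) (\<gamma> b') * chi (ch e) (inv (\<gamma> b'))"
        by (rule hom[OF \<gamma>G(2) inv_closed[OF \<gamma>G(2)]])
      moreover have "chi (ch e) (\<gamma> b \<otimes> inv (\<gamma> b')) = chi (ch e) (\<gamma> b) * chi (ch e) (inv (\<gamma> b'))"
        by (rule hom[OF \<gamma>G(1) inv_closed[OF \<gamma>G(2)]])
      moreover have "chi (ch e) (\<gamma> b' \<otimes> inv (\<gamma> b')) = 1"
        unfolding r_inv[OF \<gamma>G(2)] using character_chi[of "ch e"] unfolding character_def by (rule conjunct1)
      ultimately show "chi (ch e) (\<gamma> b \<otimes> inv (\<gamma> b')) = 1" using 1 by (simp only:)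
    qed
    then have "\<gamma> b \<otimes> inv (\<gamma> b') \<otimes> \<gamma> b' = \<gamma> b'" using \<gamma>G by simp
    then have g: "\<gamma> b = \<gamma> b'" using \<gamma>G by (simp add: m_assoc)
    show "b = b'"
    proof (rule PiE_ext[OF b b'])
      fix i assume "i \<in> {..<r}"
      then have i: "i < r" by simp
      have "c (\<gamma> b) i = b i * (m i div p)" "c (\<gamma> b') i = b' i * (m i div p)"
        using bspec[OF \<gamma> b] bspec[OF \<gamma> b'] i by auto
      then have "b i * (m i div p) = b' i * (m i div p)" using g by (simp only:)
      moreover have "m i div p > 0" using m_pos[OF i] p(2)[OF i] p1 by (auto elim!: dvdE)
      ultimately show "b i = b' i" by simp
    qed
  qed
  have "?h ` ?B \<subseteq> ?T" using tors by auto
  moreover have finT: "finite ?T" using F(1) card_roots_of_unity_le(1)[of p] p1 by (intro finite_PiE) auto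
  ultimately have "card ?B \<le> card ?T" by (rule card_inj_on_le[OF inj])
  also have "\<dots> = card {z::'k. z ^ p = 1} ^ card F" using F(1) by (simp add: card_PiE)
  also have "\<dots> \<le> p ^ card F" using card_roots_of_unity_le(2)[of p] p1 by (intro power_mono) auto
  finally have "p ^ r \<le> p ^ card F" by (simp add: card_PiE)
  then have "r \<le> card F" using p1 by (simp add: power_increasing_iff)
  also have "\<dots> \<le> scale_fun.dim (tangent_space Y y)"
    by (rule card_le_dim_tangent_space[OF F(1,2,4,5) dim])
  finally show ?thesis .
qed

end

section \<open>Invariant factors and coordinates\<close>

lemma invariant_factors_coordinates:
  fixes G :: "('g, 'a) monoid_scheme"
  assumes G: "comm_group G" "finite (carrier G)" and ms: "invariant_factors G ms"
  shows "\<exists>c (\<zeta> :: nat \<Rightarrow> 'k :: {alg_closed_field, field_char_0}). abelian_coordinates G (length ms) (\<lambda>i. ms ! i) c \<zeta>"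
proof -
  let ?r = "length ms" and ?Z = "\<lambda>i. integer_mod_group (ms ! i)"
  let ?H = "sum_group {..<?r} ?Z"
  have "G \<cong> ?H" using ms by (simp add: invariant_factors_def)
  then obtain f where f: "f \<in> iso G ?H" unfolding is_iso_def by blast
  have hom: "f \<in> hom G ?H" and bij: "bij_betw f (carrier G) (carrier ?H)" using f by (simp_all add: iso_def)
  have carr: "carrier ?H = (\<Pi>\<^sub>E i\<in>{..<?r}. carrier (?Z i))"
    by (subst carrier_sum_group) auto
  \<comment> \<open>\<open>integer_mod_group 0\<close> is the infinite cyclic group, which cannot be
    a factor of a finite group.\<close>
  have pos: "ms ! i > 0" if i: "i < ?r" for i
  proof (rule ccontr)
    assume "\<not> ms ! i > 0"
    then have 0: "ms ! i = 0" by simp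
    let ?e = "\<lambda>k::int. \<lambda>j\<in>{..<?r}. if j = i then k else 0"
    have "range ?e \<subseteq> carrier ?H"
      unfolding carr using 0 by (intro image_subsetI) (auto simp: restrict_PiE_iff carrier_integer_mod_group)
    moreover have "finite (carrier ?H)" using bij_betw_finite[OF bij] G(2) by simp
    ultimately have "finite (range ?e)" by (rule finite_subset)
    moreover have "inj ?e"
    proof (rule injI)
      fix k l assume "?e k = ?e l"
      then have "?e k i = ?e l i" by (rule fun_cong)
      then show "k = l" using i by simp
    qed
    ultimately have "finite (UNIV :: int set)" by (rule finite_imageD)
    then show False using infinite_UNIV_int by blast
  qed
  define c where "c g i = nat (f g i)" for g i
  have fg: "0 \<le> f g i" "f g i < int (ms ! i)" if "g \<in> carrier G" "i < ?r" for g i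
  proof -
    have "f g \<in> carrier ?H" using bij that(1) by (rule bij_betw_apply)
    then have "f g i \<in> carrier (?Z i)" unfolding carr using that(2) by auto
    then show "0 \<le> f g i" "f g i < int (ms ! i)" using pos[OF that(2)] by (simp_all add: carrier_integer_mod_group)
  qed
  have "\<forall>i\<in>{..<?r}. \<exists>z :: 'k. \<forall>k. z ^ k = 1 \<longleftrightarrow> ms ! i dvd k"
    using ex_primitive_root_of_unity pos by blast
  from bchoice[OF this] obtain \<zeta> :: "nat \<Rightarrow> 'k" where \<zeta>: "\<forall>i\<in>{..<?r}. \<forall>k. \<zeta> i ^ k = 1 \<longleftrightarrow> ms ! i dvd k" ..
  interpret comm_group G by (rule G(1))
  have "abelian_coordinates G ?r (\<lambda>i. ms ! i) c \<zeta>"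
  proof
    show "finite (carrier G)" by (rule G(2))
    show "ms ! i > 0" if "i < ?r" for i by (rule pos[OF that])
    show "c g i < ms ! i" if "g \<in> carrier G" "i < ?r" for g i
      using fg[OF that] by (simp add: c_def nat_less_iff)
    show "c (g \<otimes>\<^bsub>G\<^esub> h) i = (c g i + c h i) mod ms ! i" if "g \<in> carrier G" "h \<in> carrier G" "i < ?r" for g h i
    proof -
      have "f (g \<otimes>\<^bsub>G\<^esub> h) = f g \<otimes>\<^bsub>?H\<^esub> f h" using hom that(1,2) by (rule hom_mult)
      then have "f (g \<otimes>\<^bsub>G\<^esub> h) i = (f g i + f h i) mod int (ms ! i)" using that(3) by simp
      then show ?thesis
        using fg[OF that(1,3)] fg[OF that(2,3)] by (simp add: c_def nat_mod_distrib nat_add_distrib)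
    qed
    show "\<exists>g\<in>carrier G. \<forall>i<?r. c g i = a i" if a: "\<And>i. i < ?r \<Longrightarrow> a i < ms ! i" for a
    proof -
      let ?x = "\<lambda>i\<in>{..<?r}. int (a i)"
      have "?x \<in> carrier ?H" unfolding carr using a pos by (auto simp: carrier_integer_mod_group)
      then have "?x \<in> f ` carrier G" unfolding bij_betw_imp_surj_on[OF bij] .
      then obtain g where g: "f g = ?x" "g \<in> carrier G" by (rule imageE) (rule that, rule sym)
      have "c g i = a i" if "i < ?r" for i using that by (simp add: c_def g(1))
      then show ?thesis using g(2) by blast
    qed
    show "g = h" if g: "g \<in> carrier G" and h: "h \<in> carrier G" and eq: "\<And>i. i < ?r \<Longrightarrow> c g i = c h i" for g h
    proof -
      have 1: "f g \<in> (\<Pi>\<^sub>E i\<in>{..<?r}. carrier (?Z i))" "f h \<in> (\<Pi>\<^sub>E i\<in>{..<?r}. carrier (?Z i))"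
        using bij_betw_apply[OF bij g] bij_betw_apply[OF bij h] unfolding carr by auto
      have fgh: "f g = f h"
      proof (rule PiE_ext[OF 1])
        fix i assume "i \<in> {..<?r}"
        then have i: "i < ?r" by simp
        show "f g i = f h i" using eq[OF i] fg[OF g i] fg[OF h i] by (simp add: c_def)
      qed
      show ?thesis by (rule inj_onD[OF bij_betw_imp_inj_on[OF bij] fgh g h])
    qed
    show "\<zeta> i ^ k = 1 \<longleftrightarrow> ms ! i dvd k" if "i < ?r" for i k using \<zeta> that by simp
  qed
  then show ?thesis by blast
qed

text \<open>The \<open>m i\<close> powers of the primitive root are distinct, and the equation has
  at most \<open>m i\<close> solutions.\<close>

lemma (in abelian_coordinates) root_of_unity_eq_power:
  assumes i: "i < r" and t: "t ^ m i = 1"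
  shows "\<exists>k<m i. t = \<zeta> i ^ k"
proof -
  let ?R = "{z :: 'k. z ^ m i = 1}"
  have inj: "inj_on (\<lambda>k. \<zeta> i ^ k) {..<m i}"
  proof (rule linorder_inj_onI)
    fix k l assume *: "k < l" "k \<in> {..<m i}" "l \<in> {..<m i}"
    show "\<zeta> i ^ k \<noteq> \<zeta> i ^ l"
    proof
      assume "\<zeta> i ^ k = \<zeta> i ^ l"
      moreover have "\<zeta> i ^ l = \<zeta> i ^ k * \<zeta> i ^ (l - k)" using * by (simp add: power_add[symmetric])
      ultimately have "\<zeta> i ^ (l - k) = 1" using root_nonzero[OF i] by simp
      then have "m i dvd l - k" using primitive[OF i] by simp
      then show False using * by (auto dest: dvd_imp_le)
    qed
  qed auto
  have sub: "(\<lambda>k. \<zeta> i ^ k) ` {..<m i} \<subseteq> ?R"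
    using primitive[OF i] by (auto simp: power_mult[symmetric])
  have "(\<lambda>k. \<zeta> i ^ k) ` {..<m i} = ?R"
  proof (rule card_seteq[OF card_roots_of_unity_le(1)[OF m_pos[OF i]] sub])
    show "card ?R \<le> card ((\<lambda>k. \<zeta> i ^ k) ` {..<m i})"
      using card_roots_of_unity_le(2)[OF m_pos[OF i]] by (simp add: card_image[OF inj])
  qed
  then have "t \<in> (\<lambda>k. \<zeta> i ^ k) ` {..<m i}" using t by simp
  then show ?thesis by auto
qed

section \<open>Equivariant rational maps\<close>

text \<open>Extracts a pointwise identity from the equality of two classes: the composite of the
  chosen representatives belongs to one side, hence to the other.\<close>

lemma equivariant_agree:
  assumes X: "irred_space X" and Y: "irred_space Y"
    and \<phi>: "\<phi> \<in> rational_maps X Y" "dominant Y \<phi>" "(A, a) \<in> \<phi>"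
    and \<rho>: "\<rho> \<in> rational_maps X X" "dominant X \<rho>" "(U, f) \<in> \<rho>"
    and s: "morphism Y Y s" and eq: "rat_comp X Y \<phi> \<rho> = rat_comp X Y (rat_of Y Y s) \<phi>"
  obtains W where "openin (zar X) W" "W \<noteq> {}" "W \<subseteq> U \<inter> A" "f ` W \<subseteq> A" "\<forall>x\<in>W. a (f x) = s (a x)"
proof -
  interpret X: irred_space X by fact
  interpret Y: irred_space Y by fact
  let ?S = "{x \<in> U. f x \<in> A}"
  have rA: "(A, a) \<in> rat_reps X Y" using X.rational_maps_rep(1)[OF \<phi>(1,3)] .
  have S: "openin (zar X) ?S" "?S \<noteq> {}"
    using X.dominant_preimage[OF \<rho> rat_reps_open[OF rA] rat_reps_nonempty[OF rA]] .
  have "(?S, a \<circ> f) \<in> rat_reps X Y"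
    by (rule rat_reps_comp[OF X.rational_maps_rep(1)[OF \<rho>(1,3)] rA S(2)])
  then have "(?S, a \<circ> f) \<in> rat_comp X Y \<phi> \<rho>"
    unfolding X.rat_comp_iff[OF \<rho> X \<phi>(1,3)]
    using S by (intro conjI exI[of _ ?S]) auto
  then have mem: "(?S, a \<circ> f) \<in> rat_comp X Y (rat_of Y Y s) \<phi>" using eq by simp
  note rs = Y.rat_of_morphism_rep[OF s]
  have so: "rat_of Y Y s \<in> rational_maps Y Y" "(points Y, s) \<in> rat_of Y Y s"
    unfolding rat_of_def by (rule Y.rat_class_in[OF rs], rule Y.rat_class_self[OF rs])
  from mem obtain W where W: "openin (zar X) W" "W \<noteq> {}" "W \<subseteq> ?S \<inter> A" "\<forall>x\<in>W. (a \<circ> f) x = s (a x)"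
    unfolding X.rat_comp_iff[OF \<phi> Y so] by (elim conjE exE)
  show ?thesis
  proof (rule that[OF W(1,2)])
    show "W \<subseteq> U \<inter> A" "f ` W \<subseteq> A" "\<forall>x\<in>W. a (f x) = s (a x)" using W(3,4) by auto
  qed
qed

lemma birational_isoD:
  assumes "birational_iso X Y \<phi>"
  shows "\<phi> \<in> rational_maps X Y" "dominant Y \<phi>"
    "\<exists>\<psi>\<in>rational_maps Y X. dominant X \<psi> \<and> rat_comp X X \<psi> \<phi> = rat_of X X (\<lambda>x. x)"
  using assms unfolding birational_iso_def by auto

text \<open>Transfers triviality from the model back to \<open>X\<close>: where \<open>s\<close> is
  the identity, \<open>a (f x) = a x\<close>, and the inverse \<open>b\<close> of \<open>a\<close>
  gives \<open>f x = x\<close>. Applied contrapositively, it shows that the regular action is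
  faithful on every open set.\<close>

lemma rational_action_trivial:
  assumes X: "irred_space X" and Y: "irred_space Y"
    and \<phi>: "birational_iso X Y \<phi>" and \<rho>: "birational_iso X X \<rho>"
    and s: "morphism Y Y s" and eq: "rat_comp X Y \<phi> \<rho> = rat_comp X Y (rat_of Y Y s) \<phi>"
    and W: "openin (zar Y) W" "W \<noteq> {}" "\<forall>v\<in>W. s v = v"
  shows "\<rho> = rat_of X X (\<lambda>x. x)"
proof -
  interpret X: irred_space X by fact
  interpret Y: irred_space Y by fact
  note \<phi>1 = birational_isoD(1,2)[OF \<phi>] and \<rho>1 = birational_isoD(1,2)[OF \<rho>]
  obtain \<psi> where \<psi>: "\<psi> \<in> rational_maps Y X" "rat_comp X X \<psi> \<phi> = rat_of X X (\<lambda>x. x)"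
    using birational_isoD(3)[OF \<phi>] by blast
  obtain A a where a: "(A, a) \<in> \<phi>" using \<phi>1(1) by (rule X.rational_maps_nonempty)
  obtain B b where b: "(B, b) \<in> \<psi>" using \<psi>(1) by (rule Y.rational_maps_nonempty)
  obtain U f where f: "(U, f) \<in> \<rho>" using \<rho>1(1) by (rule X.rational_maps_nonempty)
  obtain W1 where W1: "openin (zar X) W1" "W1 \<noteq> {}" "W1 \<subseteq> U \<inter> A" "f ` W1 \<subseteq> A" "\<forall>x\<in>W1. a (f x) = s (a x)"
    by (rule equivariant_agree[OF X Y \<phi>1 a \<rho>1 f s eq])
  note W2 = X.dominant_preimage[OF \<phi>1 a W(1,2)]
  have "(points X, \<lambda>x. x) \<in> rat_comp X X \<psi> \<phi>"
    unfolding \<psi>(2) rat_of_def by (rule X.rat_class_self[OF X.rat_of_id_rep])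
  then obtain W3 where W3: "openin (zar X) W3" "W3 \<noteq> {}" "W3 \<subseteq> points X \<inter> A" "\<forall>x\<in>W3. x = b (a x)"
    unfolding X.rat_comp_iff[OF \<phi>1 a Y \<psi>(1) b] by (elim conjE exE)
  note W4 = X.dominant_preimage[OF \<rho>1 f W3(1,2)]
  let ?W = "W1 \<inter> {x \<in> A. a x \<in> W} \<inter> W3 \<inter> {x \<in> U. f x \<in> W3}"
  have i1: "openin (zar X) (W1 \<inter> {x \<in> A. a x \<in> W})" "W1 \<inter> {x \<in> A. a x \<in> W} \<noteq> {}"
    using openin_Int[OF W1(1) W2(1)] X.meet[OF W1(1) W2(1) W1(2) W2(2)] .
  have i2: "openin (zar X) (W1 \<inter> {x \<in> A. a x \<in> W} \<inter> W3)" "W1 \<inter> {x \<in> A. a x \<in> W} \<inter> W3 \<noteq> {}"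
    using openin_Int[OF i1(1) W3(1)] X.meet[OF i1(1) W3(1) i1(2) W3(2)] .
  have i3: "openin (zar X) ?W" "?W \<noteq> {}"
    using openin_Int[OF i2(1) W4(1)] X.meet[OF i2(1) W4(1) i2(2) W4(2)] .
  have "f x = x" if x: "x \<in> ?W" for x
  proof -
    have "a (f x) = a x" using W1(5) W(3) x by simp
    moreover have "x = b (a x)" "f x = b (a (f x))" using W3(4) x by auto
    ultimately show ?thesis by simp
  qed
  then have "(points X, \<lambda>x. x) \<in> rat_eq X X `` {(U, f)}"
    unfolding X.rat_class_iff using X.rational_maps_rep(1)[OF \<rho>1(1) f] X.rat_of_id_rep i3 W1(3) W3(3)
    by (intro conjI exI[of _ ?W]) auto
  then have "((U, f), (points X, \<lambda>x. x)) \<in> rat_eq X X" by simp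
  then show ?thesis
    using X.rational_maps_rep(2)[OF \<rho>1(1) f] equiv_class_eq[OF X.equiv_rat_eq] unfolding rat_of_def by simp
qed

section \<open>Algebraic independence and dimension under dominant maps\<close>

lemma alg_independent_pullback:
  assumes X: "irred_space X" and Y: "irred_space Y"
    and \<phi>: "\<phi> \<in> rational_maps X Y" "dominant Y \<phi>" "(A, a) \<in> \<phi>"
    and V: "openin (zar Y) V" "\<And>i. i < d \<Longrightarrow> f i \<in> regf Y V" and ind: "alg_independent Y V d f"
    and P: "P \<in> polyfun d" "w \<in> carrier_vec d" "P w \<noteq> 0"
  shows "\<exists>x\<in>{x \<in> A. a x \<in> V}. P (Matrix.vec d (\<lambda>i. f i (a x))) \<noteq> 0"
proof -
  interpret X: irred_space X by fact
  interpret Y: irred_space Y by fact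
  have "\<exists>v\<in>V. P (Matrix.vec d (\<lambda>i. f i v)) \<noteq> 0"
  proof (rule ccontr)
    assume "\<not> ?thesis"
    then have "\<forall>v\<in>V. P (Matrix.vec d (\<lambda>i. f i v)) = 0" by simp
    with bspec[OF ind[unfolded alg_independent_def] P(1)] have "\<forall>v\<in>carrier_vec d. P v = 0" by (rule mp)
    then show False using P(2,3) by blast
  qed
  then have ne: "{v \<in> V. P (Matrix.vec d (\<lambda>i. f i v)) \<noteq> 0} \<noteq> {}" by blast
  have "openin (zar Y) {v \<in> V. P (Matrix.vec d (\<lambda>i. f i v)) \<noteq> 0}"
    by (rule Y.openin_nonzero[OF V(1) regf_polyfun[OF Y.swf V(1) P(1) V(2)]])
  from X.dominant_preimage(2)[OF \<phi> this ne] show ?thesis by blast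
qed

lemma dimension_dominant_le:
  assumes X: "irred_space X" and Y: "irred_space Y"
    and \<phi>: "\<phi> \<in> rational_maps X Y" "dominant Y \<phi>"
  shows "dimension Y \<le> dimension X"
  unfolding dimension_def
proof (rule SUP_subset_mono)
  interpret X: irred_space X by fact
  obtain A a where a: "(A, a) \<in> \<phi>" using \<phi>(1) by (rule X.rational_maps_nonempty)
  show "{d. \<exists>U f. openin (zar Y) U \<and> U \<noteq> {} \<and> (\<forall>i<d. f i \<in> regf Y U) \<and> alg_independent Y U d f}
    \<subseteq> {d. \<exists>U f. openin (zar X) U \<and> U \<noteq> {} \<and> (\<forall>i<d. f i \<in> regf X U) \<and> alg_independent X U d f}"
  proof
    fix d assume "d \<in> {d. \<exists>U f. openin (zar Y) U \<and> U \<noteq> {} \<and> (\<forall>i<d. f i \<in> regf Y U) \<and> alg_independent Y U d f}"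
    then have "\<exists>U f. openin (zar Y) U \<and> U \<noteq> {} \<and> (\<forall>i<d. f i \<in> regf Y U) \<and> alg_independent Y U d f"
      by simp
    then obtain V f where V: "openin (zar Y) V" "V \<noteq> {}" "\<forall>i<d. f i \<in> regf Y V" "alg_independent Y V d f"
      by (elim exE conjE)
    let ?S = "{x \<in> A. a x \<in> V}"
    note S = X.dominant_preimage[OF \<phi> a V(1,2)]
    have "f i \<circ> a \<in> regf X ?S" if "i < d" for i
      by (rule rat_reps_regf[OF X.rational_maps_rep(1)[OF \<phi>(1) a] V(1)]) (use V(3) that in simp)
    moreover have "alg_independent X ?S d (\<lambda>i. f i \<circ> a)"
      unfolding alg_independent_def
    proof (intro ballI impI)
      fix P and w :: "'b vec" assume P: "P \<in> polyfun d" "\<forall>x\<in>?S. P (Matrix.vec d (\<lambda>i. (f i \<circ> a) x)) = 0" "w \<in> carrier_vec d"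
      show "P w = 0"
      proof (rule ccontr)
        assume "P w \<noteq> 0"
        have "\<exists>x\<in>?S. P (Matrix.vec d (\<lambda>i. f i (a x))) \<noteq> 0"
          by (rule alg_independent_pullback[OF X Y \<phi> a V(1) _ V(4) P(1,3) \<open>P w \<noteq> 0\<close>]) (use V(3) in simp)
        then show False using P(2) by (elim bexE) simp
      qed
    qed
    ultimately have "\<exists>U f. openin (zar X) U \<and> U \<noteq> {} \<and> (\<forall>i<d. f i \<in> regf X U) \<and> alg_independent X U d f"
      using S by (intro exI[of _ ?S] exI[of _ "\<lambda>i. f i \<circ> a"]) simp
    then show "d \<in> {d. \<exists>U f. openin (zar X) U \<and> U \<noteq> {} \<and> (\<forall>i<d. f i \<in> regf X U) \<and> alg_independent X U d f}"
      by simp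
  qed
qed simp

text \<open>Independent families of length \<open>n\<close> must exist, since otherwise all lengths
  would be at most \<open>n - 1\<close>, which is smaller than \<open>n\<close> because of
  \<open>n \<ge> 1\<close>.\<close>

lemma dimension_attained:
  assumes dim: "dimension X = enat n" and n: "n \<ge> 1"
  shows "\<exists>U f. openin (zar X) U \<and> U \<noteq> {} \<and> (\<forall>i<n. f i \<in> regf X U) \<and> alg_independent X U n f"
proof (rule ccontr)
  let ?D = "{d. \<exists>U f. openin (zar X) U \<and> U \<noteq> {} \<and> (\<forall>i<d. f i \<in> regf X U) \<and> alg_independent X U d f}"
  assume "\<not> ?thesis"
  then have "n \<notin> ?D" by simp
  have "enat d \<le> enat (n - 1)" if d: "d \<in> ?D" for d
  proof -
    have "enat d \<le> (SUP d\<in>?D. enat d)" using d by (rule SUP_upper)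
    then have "enat d \<le> enat n" using dim unfolding dimension_def by simp
    moreover have "d \<noteq> n" using d \<open>n \<notin> ?D\<close> by blast
    ultimately show ?thesis by simp
  qed
  then have "(SUP d\<in>?D. enat d) \<le> enat (n - 1)" by (rule SUP_least)
  then show False using dim n unfolding dimension_def by simp
qed

section \<open>The linear model\<close>

lemma mat_diag_mult_vec:
  assumes "v \<in> carrier_vec n"
  shows "mat_diag n f *\<^sub>v v = Matrix.vec n (\<lambda>i. f i * v $ i)"
proof (rule eq_vecI)
  fix i assume "i < dim_vec (Matrix.vec n (\<lambda>i. f i * v $ i))"
  then have i: "i < n" by simp
  have "(mat_diag n f *\<^sub>v v) $ i = (\<Sum>j\<in>{0..<n}. (if i = j then f j else 0) * v $ j)"
    using i assms by (simp add: mat_diag_def scalar_prod_def)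
  also have "\<dots> = f i * v $ i" using i by (simp add: if_distribR if_distrib cong: if_cong)
  finally show "(mat_diag n f *\<^sub>v v) $ i = Matrix.vec n (\<lambda>i. f i * v $ i) $ i" using i by simp
qed (simp add: mat_diag_def)

context abelian_coordinates
begin

definition diag_rep :: "nat \<Rightarrow> 'g \<Rightarrow> 'k mat" where
  "diag_rep n g = mat_diag n (\<lambda>i. if i < r then psi i g else 1)"

lemma diag_rep_mult:
  "g \<in> carrier G \<Longrightarrow> h \<in> carrier G \<Longrightarrow> diag_rep n (g \<otimes> h) = diag_rep n g * diag_rep n h"
proof -
  assume gh: "g \<in> carrier G" "h \<in> carrier G"
  have "(\<lambda>i. if i < r then psi i (g \<otimes> h) else 1) = (\<lambda>i. (if i < r then psi i g else 1) * (if i < r then psi i h else 1))"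
    using character_psi gh by (auto simp: character_def)
  then show ?thesis unfolding diag_rep_def by simp
qed

lemma diag_rep_one: "diag_rep n \<one> = 1\<^sub>m n"
proof -
  have "(\<lambda>i. if i < r then psi i \<one> else 1) = (\<lambda>i. 1)"
    using character_psi by (auto simp: character_def)
  then show ?thesis unfolding diag_rep_def by simp
qed

text \<open>With \<open>r \<le> n\<close> all basis characters occur on the diagonal, and together
  they separate the elements of \<open>G\<close>.\<close>

lemma diag_rep_mon:
  assumes "r \<le> n"
  shows "diag_rep n \<in> mon G (GL TYPE('k) n)"
  unfolding mon_def
proof (intro CollectI conjI homI inj_onI)
  have carr: "diag_rep n g \<in> carrier_mat n n" for g by (simp add: diag_rep_def)
  show "diag_rep n g \<in> carrier (GL TYPE('k) n)" if g: "g \<in> carrier G" for g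
  proof -
    have "diag_rep n g * diag_rep n (inv g) = 1\<^sub>m n" "diag_rep n (inv g) * diag_rep n g = 1\<^sub>m n"
      using g by (simp_all add: diag_rep_mult[symmetric] diag_rep_one)
    then have "diag_rep n g \<in> Units (ring_mat TYPE('k) n ())"
      unfolding Units_def using carr
      by (intro CollectI conjI bexI[of _ "diag_rep n (inv g)"]) (simp_all add: ring_mat_def)
    then show ?thesis unfolding GL_def units_of_carrier .
  qed
  show "diag_rep n (g \<otimes> h) = diag_rep n g \<otimes>\<^bsub>GL TYPE('k) n\<^esub> diag_rep n h" if "g \<in> carrier G" "h \<in> carrier G" for g h
    using diag_rep_mult[OF that] by (simp add: GL_def units_of_def ring_mat_def)
  show "g = h" if g: "g \<in> carrier G" and h: "h \<in> carrier G" and eq: "diag_rep n g = diag_rep n h" for g h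
  proof (rule c_inj[OF g h])
    fix i assume i: "i < r"
    have "diag_rep n g $$ (i, i) = diag_rep n h $$ (i, i)" using eq by simp
    then have e: "psi i g = psi i h" using i assms by (simp add: diag_rep_def mat_diag_def)
    note hom = character_psi[OF i, unfolded character_def, THEN conjunct2, THEN bspec, THEN bspec, OF _ inv_closed[OF h]]
    have "psi i (h \<otimes> inv h) = 1"
      unfolding r_inv[OF h] using character_psi[OF i] unfolding character_def by (rule conjunct1)
    then have "psi i (g \<otimes> inv h) = 1" using hom[OF g] hom[OF h] e by (simp only:)
    then have "m i dvd c (g \<otimes> inv h) i" using primitive[OF i] by (simp add: psi_def)
    then have z: "c (g \<otimes> inv h) i = 0"
      using c_less[OF m_closed[OF g inv_closed[OF h]] i] by (auto dest: dvd_imp_le)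
    have "c (g \<otimes> inv h \<otimes> h) i = (c (g \<otimes> inv h) i + c h i) mod m i"
      by (rule c_mult[OF m_closed[OF g inv_closed[OF h]] h i])
    then show "c g i = c h i" using z g h c_less[OF h i] by (simp add: m_assoc)
  qed
qed

text \<open>Diagonal entries can be prescribed independently: each root of unity is a power of the
  primitive one, and the exponents are the coordinates of a group element.\<close>

lemma diag_rep_image:
  assumes "length ms = r" "\<And>i. i < r \<Longrightarrow> ms ! i = m i"
  shows "diag_rep n ` carrier G = T_group n ms"
proof
  show "diag_rep n ` carrier G \<subseteq> T_group n ms"
  proof
    fix A assume "A \<in> diag_rep n ` carrier G"
    then obtain g where "A = diag_rep n g" by (elim imageE)
    then have "A = mat_diag n (\<lambda>i. if i < length ms then psi i g else 1)"
      unfolding diag_rep_def assms(1) .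
    moreover have "\<forall>i<length ms. psi i g ^ (ms ! i) = 1" using psi_power assms by simp
    ultimately show "A \<in> T_group n ms"
      unfolding T_group_def by (intro CollectI exI[of _ "\<lambda>i. psi i g"] conjI)
  qed
  show "T_group n ms \<subseteq> diag_rep n ` carrier G"
  proof
    fix A :: "'k mat" assume "A \<in> T_group n ms"
    then obtain t where t0: "A = mat_diag n (\<lambda>i. if i < length ms then t i else 1)" "\<forall>i<length ms. t i ^ (ms ! i) = 1"
      unfolding T_group_def by (elim CollectE exE conjE)
    have A: "A = mat_diag n (\<lambda>i. if i < r then t i else 1)" using t0(1) assms(1) by simp
    have t: "t i ^ m i = 1" if "i < r" for i using t0(2) assms that by simp
    have "\<forall>i\<in>{..<r}. \<exists>k. k < m i \<and> t i = \<zeta> i ^ k"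
      using root_of_unity_eq_power[OF _ t] by simp
    from bchoice[OF this] obtain k where k: "\<forall>i\<in>{..<r}. k i < m i \<and> t i = \<zeta> i ^ k i" ..
    obtain g where g: "g \<in> carrier G" "\<forall>i<r. c g i = k i" using c_surj[of k] k by auto
    have "(\<lambda>i. if i < r then t i else 1) = (\<lambda>i. if i < r then psi i g else 1)"
    proof
      fix i show "(if i < r then t i else 1) = (if i < r then psi i g else 1)"
        using bspec[OF k, of i] g(2) by (cases "i < r") (simp_all add: psi_def)
    qed
    then have "A = diag_rep n g" unfolding A diag_rep_def by simp
    then show "A \<in> diag_rep n ` carrier G" using g(1) by blast
  qed
qed

end

text \<open>The coordinates of the map are eigenfunctions whose characters are the diagonal entries
  of \<open>diag_rep\<close>. Eigenvalue equations give equivariance, algebraic independence gives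
  dominance, and the proper power in coordinate 0 prevents birationality.\<close>

lemma nontrivial_base_changeI:
  fixes X :: "('p, 'k::{alg_closed_field, field_char_0}) fspace" and Y :: "('q, 'k) fspace"
  assumes X: "irred_space X" and act: "abelian_action G r m c \<zeta> Y \<sigma>"
    and \<phi>: "birational_iso X Y \<phi>" "equivariant G X \<rho> Y (\<lambda>g. rat_of Y Y (\<sigma> g)) \<phi>"
    and \<rho>: "\<And>g. g \<in> carrier G \<Longrightarrow> birational_iso X X (\<rho> g)"
    and dim: "dimension Y = enat n" and n: "n \<ge> 1" and r: "r \<ge> 1"
  shows "nontrivial_base_change G X \<rho> (affine_space n)
    (linear_rational_action n (abelian_coordinates.diag_rep r c \<zeta> n))"
proof -
  interpret abelian_action G r m c \<zeta> Y \<sigma> by (rule act)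
  interpret X: irred_space X by (rule X)
  let ?A = "affine_space n :: ('k vec, 'k) fspace"
  interpret A: irred_space ?A by (rule irred_space_affine)
  have Y: "irred_space Y" by unfold_locales
  define \<psi> where "\<psi> i = (if i < r then psi i else (\<lambda>_. 1))" for i
  have \<psi>: "character (\<psi> i)" for i using character_psi character_one by (simp add: \<psi>_def)
  obtain U0 f0 where U0: "openin (zar Y) U0" "U0 \<noteq> {}" "\<forall>i<n. f0 i \<in> regf Y U0" "alg_independent Y U0 n f0"
    using dimension_attained[OF dim n] by (elim exE conjE)
  have "\<exists>V h. openin (zar Y) V \<and> V \<noteq> {} \<and> (\<forall>i<n. h i \<in> regf Y V \<and> eigen (\<psi> i) (h i)) \<and> alg_independent Y V n h"
    by (rule ex_independent_eigenfunctions[OF \<psi> U0(1,2) _ U0(4)]) (use U0(3) in blast)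
  then obtain V h where V: "openin (zar Y) V" "V \<noteq> {}" and h: "\<forall>i<n. h i \<in> regf Y V \<and> eigen (\<psi> i) (h i)"
    and ind: "alg_independent Y V n h"
    by (elim exE conjE)
  interpret D: function_domain V "regf Y V" by (rule function_domain_regf[OF Y V])
  \<comment> \<open>The first character has order dividing \<open>m 0\<close>, so its q-th power is
    itself; as \<open>m 0\<close> is positive, \<open>q\<close> is at least 2.\<close>
  define q where "q = Suc (m 0)"
  have q: "q \<ge> 2" using m_pos[of 0] r by (simp add: q_def)
  have psi_q: "psi 0 g ^ q = psi 0 g" for g using psi_power[of 0 g] r by (simp add: q_def)
  define k where "k = h(0 := \<lambda>v. h 0 v ^ q)"
  have kreg: "k i \<in> regf Y V" if "i < n" for i
    using h that D.R_power[of "h 0" q] n by (auto simp: k_def)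
  have keig: "k i (\<sigma> g v) = \<psi> i g * k i v" if i: "i < n" and gv: "g \<in> carrier G" "v \<in> points Y" for i g v
  proof (cases "i = 0")
    case True
    have "h 0 (\<sigma> g v) = \<psi> 0 g * h 0 v" using h n gv unfolding eigen_def by simp
    then show ?thesis using r psi_q by (simp add: True k_def \<psi>_def power_mult_distrib)
  next
    case False
    have "eigen (\<psi> i) (h i)" using h i by blast
    then show ?thesis using False gv unfolding eigen_def by (simp add: k_def)
  qed
  have kind: "alg_independent Y V n k"
  proof -
    have "D.indep n h" using ind unfolding alg_independent_def D.indep_def .
    moreover have "\<exists>y. y ^ q = x" for x :: 'k using nth_root_exists[of q x] q by auto
    ultimately have "D.indep n k" unfolding k_def using q by (intro D.indep_power_0) auto
    then show ?thesis unfolding alg_independent_def D.indep_def .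
  qed
  note \<phi>1 = birational_isoD(1,2)[OF \<phi>(1)]
  obtain B a where a: "(B, a) \<in> \<phi>" using \<phi>1(1) by (rule X.rational_maps_nonempty)
  note ra = X.rational_maps_rep(1)[OF \<phi>1(1) a]
  define S where "S = {x \<in> B. a x \<in> V}"
  have S: "openin (zar X) S" "S \<noteq> {}" unfolding S_def using X.dominant_preimage[OF \<phi>1 a V] .
  define H where "H x = Matrix.vec n (\<lambda>i. k i (a x))" for x
  have pull: "g \<circ> a \<in> regf X S" if "g \<in> regf Y V" for g
    unfolding S_def by (rule rat_reps_regf[OF ra V(1) that])
  have rH: "(S, H) \<in> rat_reps X ?A"
    by (rule X.rat_reps_affine[OF S, of n "\<lambda>i. k i \<circ> a"]) (simp_all add: pull kreg H_def)
  define \<Phi> where "\<Phi> = rat_eq X ?A `` {(S, H)}"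
  have \<Phi>: "\<Phi> \<in> rational_maps X ?A" "(S, H) \<in> \<Phi>"
    unfolding \<Phi>_def by (rule X.rat_class_in[OF rH], rule X.rat_class_self[OF rH])
  \<comment> \<open>Every nonempty open set of affine space contains the locus where some polynomial
    is nonzero, and by independence this polynomial does not vanish identically on the
    image.\<close>
  have dom: "dominant ?A \<Phi>"
  proof -
    have "zar ?A closure_of (H ` S) = points ?A"
    proof (rule equalityI[OF closure_of_subset_topspace], rule subsetI)
      fix w assume w: "w \<in> points ?A"
      show "w \<in> zar ?A closure_of (H ` S)"
        unfolding in_closure_of
      proof (intro conjI w allI impI)
        fix T assume T: "w \<in> T \<and> openin (zar ?A) T"
        obtain P where P: "P \<in> polyfun n" "P w \<noteq> 0" "{v \<in> carrier_vec n. P v \<noteq> 0} \<subseteq> T"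
          using conjunct2[OF T] conjunct1[OF T] unfolding zar_affine by (rule openin_affine_basic)
        have "w \<in> carrier_vec n" using w by (simp add: points_affine)
        from alg_independent_pullback[OF X Y \<phi>1 a V(1) kreg kind P(1) this P(2)]
        obtain x where "x \<in> S" "P (H x) \<noteq> 0" unfolding S_def H_def by blast
        then have "H x \<in> T" using P(3) by (auto simp: H_def)
        then show "\<exists>v. v \<in> H ` S \<and> v \<in> T" using \<open>x \<in> S\<close> by blast
      qed
    qed
    then show ?thesis unfolding dominant_def using \<Phi>(2) by (intro bexI[OF _ \<Phi>(2)]) simp
  qed
  have equiv: "equivariant G X \<rho> ?A (linear_rational_action n (diag_rep n)) \<Phi>"
    unfolding equivariant_def
  proof
    fix g assume g: "g \<in> carrier G"
    note \<rho>1 = birational_isoD(1,2)[OF \<rho>[OF g]]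
    obtain U f where f: "(U, f) \<in> \<rho> g" using \<rho>1(1) by (rule X.rational_maps_nonempty)
    have "rat_comp X Y \<phi> (\<rho> g) = rat_comp X Y (rat_of Y Y (\<sigma> g)) \<phi>"
      using \<phi>(2) g unfolding equivariant_def by blast
    then obtain W1 where W1: "openin (zar X) W1" "W1 \<noteq> {}" "W1 \<subseteq> U \<inter> B" "f ` W1 \<subseteq> B" "\<forall>x\<in>W1. a (f x) = \<sigma> g (a x)"
      by (rule equivariant_agree[OF X Y \<phi>1 a \<rho>1 f act[OF g]])
    note W2 = X.dominant_preimage[OF \<rho>1 f S]
    \<comment> \<open>Here both \<open>H x\<close> and \<open>H (f x)\<close> are given by the
      chosen representatives. Intersecting with \<open>E\<close> converts a witness for either
      composite into one for the other.\<close>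
    define E where "E = W1 \<inter> S \<inter> {x \<in> U. f x \<in> S}"
    have i1: "openin (zar X) (W1 \<inter> S)" "W1 \<inter> S \<noteq> {}"
      using openin_Int[OF W1(1) S(1)] X.meet[OF W1(1) S(1) W1(2) S(2)] .
    have E: "openin (zar X) E" "E \<noteq> {}"
      unfolding E_def using openin_Int[OF i1(1) W2(1)] X.meet[OF i1(1) W2(1) i1(2) W2(2)] .
    let ?T = "\<lambda>v. diag_rep n g *\<^sub>v v"
    have T: "?T v = Matrix.vec n (\<lambda>i. \<psi> i g * v $ i)" if "v \<in> carrier_vec n" for v
      unfolding diag_rep_def mat_diag_mult_vec[OF that] by (intro eq_vecI) (auto simp: \<psi>_def)
    have HT: "H (f x) = ?T (H x)" if x: "x \<in> E" for x
    proof -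
      have ax: "a (f x) = \<sigma> g (a x)" using W1(5) x unfolding E_def by blast
      have "x \<in> B" using x W1(3) unfolding E_def by blast
      then have "a x \<in> points Y" by (rule rat_reps_points[OF ra])
      then have "H (f x) = Matrix.vec n (\<lambda>i. \<psi> i g * H x $ i)"
        unfolding H_def ax using keig g by (intro eq_vecI) auto
      then show ?thesis using T[of "H x"] by (simp add: H_def)
    qed
    have rT: "(points ?A, ?T) \<in> rat_reps ?A ?A"
    proof (rule A.rat_reps_affine[of _ n "\<lambda>i v. \<psi> i g * v $ i"])
      show "openin (zar ?A) (points ?A)" "points ?A \<noteq> {}" using A.points_nonempty by simp_all
      show "?T v = Matrix.vec n (\<lambda>i. \<psi> i g * v $ i)" if "v \<in> points ?A" for v
        using T that by (simp add: points_affine)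
      show "(\<lambda>v. \<psi> i g * v $ i) \<in> regf ?A (points ?A)" if i: "i < n" for i
        unfolding affine_space_def
      proof (rule regf_embeddedI)
        fix v assume v: "v \<in> points (embedded_space n (carrier_vec n :: 'k vec set))"
        show "\<exists>W P Q. openin (zar (embedded_space n (carrier_vec n))) W \<and> v \<in> W \<and>
          W \<subseteq> points (embedded_space n (carrier_vec n)) \<and> P \<in> polyfun n \<and> Q \<in> polyfun n \<and>
          (\<forall>y\<in>W. Q y \<noteq> 0 \<and> \<psi> i g * y $ i = P y / Q y)"
          by (rule exI[of _ "points (embedded_space n (carrier_vec n))"], rule exI[of _ "\<lambda>v. \<psi> i g * v $ i"], rule exI[of _ "\<lambda>_. 1"])
            (use v i in \<open>simp add: polyfun.const polyfun.mult polyfun.coord\<close>)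
      qed
    qed
    have \<tau>: "linear_rational_action n (diag_rep n) g \<in> rational_maps ?A ?A"
      "(points ?A, ?T) \<in> linear_rational_action n (diag_rep n) g"
      unfolding linear_rational_action_def rat_of_def by (rule A.rat_class_in[OF rT], rule A.rat_class_self[OF rT])
    have HA: "H x \<in> points ?A" for x by (simp add: H_def points_affine)
    have *: "(W, l) \<in> rat_comp X ?A \<Phi> (\<rho> g) \<longleftrightarrow> (W, l) \<in> rat_comp X ?A (linear_rational_action n (diag_rep n) g) \<Phi>" for W l
      unfolding X.rat_comp_iff[OF \<rho>1 f X \<Phi>] X.rat_comp_iff[OF \<Phi>(1) dom \<Phi>(2) irred_space_affine \<tau>]
    proof (rule conj_cong[OF refl], rule iffI; elim exE conjE)
      fix W' assume *: "openin (zar X) W'" "W' \<noteq> {}" "W' \<subseteq> W \<inter> U" "f ` W' \<subseteq> S" "\<forall>x\<in>W'. l x = H (f x)"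
      have "openin (zar X) (W' \<inter> E)" "W' \<inter> E \<noteq> {}"
        using openin_Int[OF *(1) E(1)] X.meet[OF *(1) E(1) *(2) E(2)] .
      moreover have "W' \<inter> E \<subseteq> W \<inter> S" using *(3) unfolding E_def by blast
      moreover have "\<forall>x\<in>W' \<inter> E. l x = ?T (H x)" using *(5) HT by auto
      ultimately show "\<exists>W'. openin (zar X) W' \<and> W' \<noteq> {} \<and> W' \<subseteq> W \<inter> S \<and> H ` W' \<subseteq> points ?A \<and> (\<forall>x\<in>W'. l x = ?T (H x))"
        using HA by (intro exI[of _ "W' \<inter> E"] conjI image_subsetI)
    next
      fix W' assume *: "openin (zar X) W'" "W' \<noteq> {}" "W' \<subseteq> W \<inter> S" "H ` W' \<subseteq> points ?A" "\<forall>x\<in>W'. l x = ?T (H x)"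
      have "openin (zar X) (W' \<inter> E)" "W' \<inter> E \<noteq> {}"
        using openin_Int[OF *(1) E(1)] X.meet[OF *(1) E(1) *(2) E(2)] .
      moreover have "W' \<inter> E \<subseteq> W \<inter> U" "f ` (W' \<inter> E) \<subseteq> S" using *(3) unfolding E_def by auto
      moreover have "\<forall>x\<in>W' \<inter> E. l x = H (f x)" using *(5) HT by auto
      ultimately show "\<exists>W'. openin (zar X) W' \<and> W' \<noteq> {} \<and> W' \<subseteq> W \<inter> U \<and> f ` W' \<subseteq> S \<and> (\<forall>x\<in>W'. l x = H (f x))"
        by (intro exI[of _ "W' \<inter> E"] conjI)
    qed
    show "rat_comp X ?A \<Phi> (\<rho> g) = rat_comp X ?A (linear_rational_action n (diag_rep n) g) \<Phi>"
    proof (rule Set.set_eqI)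
      fix p show "p \<in> rat_comp X ?A \<Phi> (\<rho> g) \<longleftrightarrow> p \<in> rat_comp X ?A (linear_rational_action n (diag_rep n) g) \<Phi>"
        by (cases p) (simp only: *)
    qed
  qed
  have "\<not> birational_iso X ?A \<Phi>"
  proof (rule not_birational_power[OF X \<Phi> n q])
    show "h 0 \<circ> a \<in> regf X S" using pull h n by simp
    show "(h 0 \<circ> a) x ^ q = H x $ 0" if "x \<in> S" for x using n by (simp add: H_def k_def)
  qed
  then show ?thesis
    unfolding nontrivial_base_change_def using \<Phi>(1) dom equiv by blast
qed

theorem theorem2p13:
  fixes G :: "('g, 'a) monoid_scheme"
    and X :: "('p, 'k :: {alg_closed_field, field_char_0}) fspace"
    and \<rho> :: "'g \<Rightarrow> ('p, 'p) rat_map"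
    and n :: nat and ms :: "nat list"
  assumes "comm_group G" and "finite (carrier G)" and "invariant_factors G ms"
    and "irreducible_variety X" and "dimension X = enat n" and "n \<ge> 1"
    and "rational_action G X \<rho>"
    and "has_fixed_point TYPE('q) G X \<rho>"
  shows "n \<ge> length ms \<and>
    (\<exists>L \<in> mon G (GL TYPE('k) n). L ` carrier G = T_group n ms \<and>
       nontrivial_base_change G X \<rho> (affine_space n) (linear_rational_action n L))"
proof -
  from assms(8) obtain Y :: "('q, 'k) fspace" and \<sigma> y where reg: "regularization G X \<rho> Y \<sigma>"
    and y: "y \<in> points Y" "\<forall>g\<in>carrier G. \<sigma> g y = y"
    unfolding has_fixed_point_def by (elim exE conjE bexE)
  from reg obtain \<phi> where Yv: "irreducible_variety Y" "smooth Y" and act: "regular_action G Y \<sigma>"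
    and \<phi>: "birational_iso X Y \<phi>" "equivariant G X \<rho> Y (\<lambda>g. rat_of Y Y (\<sigma> g)) \<phi>"
    unfolding regularization_def by (elim exE conjE)
  have X: "irred_space X" and Y: "irred_space Y"
    by (rule irred_space_variety[OF assms(4)], rule irred_space_variety[OF Yv(1)])
  interpret Y: irred_space Y by (rule Y)
  interpret G: comm_group G by (rule assms(1))
  have mor: "morphism Y Y (\<sigma> g)" if "g \<in> carrier G" for g
    using act that unfolding regular_action_def by blast
  have ga: "group_action G (points Y) \<sigma>" using act unfolding regular_action_def by blast
  have \<rho>: "birational_iso X X (\<rho> g)" if "g \<in> carrier G" for g
    using assms(7) that unfolding rational_action_def mon_def hom_def Bir_def by auto
  have inj: "inj_on \<rho> (carrier G)" using assms(7) unfolding rational_action_def mon_def by blast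
  have comp: "rat_comp X Y \<phi> (\<rho> g) = rat_comp X Y (rat_of Y Y (\<sigma> g)) \<phi>" if "g \<in> carrier G" for g
    using \<phi>(2) that unfolding equivariant_def by blast
  have trivial: "\<rho> g = rat_of X X (\<lambda>x. x)" if "g \<in> carrier G" "openin (zar Y) W" "W \<noteq> {}" "\<forall>v\<in>W. \<sigma> g v = v" for g W
    by (rule rational_action_trivial[OF X Y \<phi>(1) \<rho> mor comp]) (use that in auto)
  obtain c and \<zeta> :: "nat \<Rightarrow> 'k" where coords: "abelian_coordinates G (length ms) (\<lambda>i. ms ! i) c \<zeta>"
    using invariant_factors_coordinates[OF assms(1-3)] by blast
  interpret C: abelian_coordinates G "length ms" "\<lambda>i. ms ! i" c \<zeta> by (rule coords)
  have "prevariety Y" using Yv(1) unfolding irreducible_variety_def variety_def by blast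
  \<comment> \<open>An element that fixes an open set has the same image under \<rho> as the neutral
    element, and \<rho> is injective.\<close>
  moreover have "\<exists>v\<in>W. \<sigma> g v \<noteq> v" if g: "g \<in> carrier G" "g \<noteq> \<one>\<^bsub>G\<^esub>" and W: "openin (zar Y) W" "W \<noteq> {}" for g W
  proof (rule ccontr)
    assume "\<not> ?thesis"
    then have "\<rho> g = rat_of X X (\<lambda>x. x)" using trivial[OF g(1) W] by blast
    moreover have "\<rho> \<one>\<^bsub>G\<^esub> = rat_of X X (\<lambda>x. x)"
    proof (rule trivial[OF G.one_closed, of "points Y"])
      show "\<forall>v\<in>points Y. \<sigma> \<one>\<^bsub>G\<^esub> v = v"
        using group_action.id_eq_one[OF ga] by (metis restrict_apply')
    qed (use Y.points_nonempty in simp_all)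
    ultimately show False using inj_onD[OF inj, of g "\<one>\<^bsub>G\<^esub>"] g by simp
  qed
  ultimately have "abelian_action_axioms G Y \<sigma>"
    using mor by (intro abelian_action_axioms.intro) auto
  then have aa: "abelian_action G (length ms) (\<lambda>i. ms ! i) c \<zeta> Y \<sigma>"
    by (intro abelian_action.intro coords Y ga)
  have ms: "ms \<noteq> []" "\<forall>i. Suc i < length ms \<longrightarrow> ms ! i dvd ms ! Suc i"
    "Coset.order G > 1 \<longrightarrow> ms ! 0 > 1" "Coset.order G = 1 \<longrightarrow> length ms = 1"
    using assms(3) unfolding invariant_factors_def by auto
  obtain \<psi> where \<psi>: "\<psi> \<in> rational_maps Y X" "dominant X \<psi>"
    using birational_isoD(3)[OF \<phi>(1)] by blast
  have dimY: "dimension Y = enat n"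
    \<comment> \<open>Dominance of the birational map and of its inverse gives the two
      inequalities.\<close>
    using dimension_dominant_le[OF X Y birational_isoD(1,2)[OF \<phi>(1)]] dimension_dominant_le[OF Y X \<psi>] assms(5) by simp
  have rn: "length ms \<le> n"
  proof (cases "Coset.order G = 1")
    case True
    \<comment> \<open>The trivial group has one invariant factor, 1, which no prime divides; the
      bound is then just \<open>n \<ge> 1\<close>.\<close>
    then show ?thesis using ms(4) assms(6) by simp
  next
    case False
    have "Coset.order G > 0" using G.order_gt_0_iff_finite assms(2) by blast
    then have "ms ! 0 > 1" using False ms(3) by simp
    then obtain p where p: "prime p" "p dvd ms ! 0" using prime_factor_nat[of "ms ! 0"] by auto
    \<comment> \<open>A prime divisor of the first invariant factor divides all of them, so the
      elements killed by \<open>p\<close> form a group of full rank.\<close>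
    have pd: "p dvd ms ! i" if "i < length ms" for i
      using that
    proof (induction i)
      case 0
      then show ?case using p(2) by simp
    next
      case (Suc i)
      then show ?case using ms(2) dvd_trans[of p "ms ! i" "ms ! Suc i"] by simp
    qed
    have "action_fixed_point G (length ms) (\<lambda>i. ms ! i) c \<zeta> Y \<sigma> y"
      by (intro action_fixed_point.intro aa action_fixed_point_axioms.intro) (use y in auto)
    moreover have dimT: "scale_fun.dim (tangent_space Y y) = n"
      using Yv(2) y(1) dimY unfolding smooth_def by auto
    ultimately show ?thesis
      using action_fixed_point.rank_le_dim_tangent_space[of G "length ms" "\<lambda>i. ms ! i" c \<zeta> Y \<sigma> y p] p(1) pd assms(6)
      by simp
  qed
  have "nontrivial_base_change G X \<rho> (affine_space n) (linear_rational_action n (C.diag_rep n))"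
    by (rule nontrivial_base_changeI[OF X aa \<phi> \<rho> dimY assms(6)]) (use ms(1) in \<open>auto simp: Suc_le_eq\<close>)
  moreover have "C.diag_rep n ` carrier G = T_group n ms" by (rule C.diag_rep_image) auto
  ultimately show ?thesis using rn C.diag_rep_mon[OF rn] by blast
qed

end
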